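(* Let $(W,S)$ be a right-angled Coxeter system (with $S$ finite), and let $\gamma_A(t)\in\mathbb{Q}[[t]]$ and $\tilde\gamma_A(t)\in\mathbb{Q}[W][[t]]$ denote, respectively, the greedy growth series and the complete greedy growth series of $W$. Then $\gamma_A(t)$ and $\tilde\gamma_A(t)$ are both rational series. Moreover, if the nerve of $(W,S)$ is an Eulerian $k$-sphere, then $$\gamma_A(t^{-1})=(-1)^{k+1}\gamma_A(t)\qquad\text{and}\qquad\tilde\gamma_A(t^{-1})=(-1)^{k+1}\tilde\gamma_A(t).$$
   Context: A Coxeter system $(W,S)$: $W=\langle S\mid (ss')^{m(s,s')}=1\rangle$ (one relation for each pair with $m(s,s')<\infty$), $m$ symmetric with values in $\{1,2,\dots,\infty\}$, $m(s,s')=1$ iff $s=s'$; right-angled means $m(s,s')\in\{2,\infty\}$ for $s\ne s'$. The nerve $N$ is the abstract simplicial complex of all subsets $\sigma\subset S$ (including $\emptyset$) that generate a finite subgroup $W_\sigma$ of $W$; $\mathcal{A}=N\setminus\{\emptyset\}$; $w_\sigma$ is the longest element (with respect to word length in $S$) of $W_\sigma$. Let $A=\{w_\sigma:\sigma\in\mathcal{A}\}\subset W$, a generating set of $W$, and let $|w|_A$ be the word length of $w$ with respect to $A$. Then $$\gamma_A(t)=\sum_{w\in W}t^{|w|_A},\qquad\tilde\gamma_A(t)=\sum_{w\in W}w\,t^{|w|_A},$$ where $t$ is a single indeterminate commuting with the coefficients in the group ring $\mathbb{Q}[W]$. For $R=\mathbb{Q}$ or $\mathbb{Q}[W]$, a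 series in $R[[t]]$ is rational if it can be obtained from finitely many polynomials in $R[t]$ by a finite sequence of additions, multiplications and quasi-inversions ($\lambda\mapsto\lambda^+=\sum_{n\ge1}\lambda^n$ for $\lambda$ with zero constant term). Meaning of $t\mapsto t^{-1}$: $\gamma_A$ is the expansion of a rational function in $\mathbb{Q}(t)$, in which $t$ is replaced by $t^{-1}$. For $\tilde\gamma_A$ (and equivalently for $\gamma_A$): with $R=\mathbb{Q}[W]$, consider expressions $\tilde\gamma_A(t)=C(I-Q(t))^{-1}B$ with $C\in\mathbb{Q}^{1\times n}$, $B\in\mathbb{Q}^{n\times1}$ and $Q(t)$ an $n\times n$ matrix over $R[t]$ whose entries have zero constant term; $\tilde\gamma_A(t^{-1})$ means $C(I-Q(t^{-1}))^{-1}B$ for such an expression for which $I-Q(t^{-1})$ is invertible over $R((t))$. The claim includes that such an expression exists; the resulting value does not depend on the choice. For a finite simplicial complex $K$ (empty simplex included, of dimension $-1$), $\bar{\boldsymbol\chi}(K)=\sum_{\sigma\in K}(-1)^{\dim\sigma}$. $K$ is an Eulerian $k$-sphere if $\bar{\boldsymbol\chi}(K)=(-1)^k$ and $\bar{\boldsymbol\chi}(\mathrm{Lk}(\sigma))=(-1)^{k-1-\dim\sigma}$ for every simplex $\sigma$ of $K$. *)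

theory Defs
  imports
    "HOL-Library.Poly_Mapping"
    "HOL-Library.Extended_Nat"
    "HOL-Computational_Algebra.Computational_Algebra"
    "Jordan_Normal_Form.Matrix"
begin

text \<open>
  Groups are types of class \<^class>\<open>group_add\<close>, which is not assumed commutative: the group \<open>W\<close>
  is the whole type \<open>'w\<close>, its product is written \<open>+\<close> and its unit \<open>0\<close>. With this convention
  \<open>'w \<Rightarrow>\<^sub>0 rat\<close> (with the convolution product of \<^theory>\<open>HOL-Library.Poly_Mapping\<close>) is the group
  ring \<open>\<rat>[W]\<close>, and \<open>Poly_Mapping.single w c\<close> is the element \<open>c w\<close>.
\<close>

section \<open>Presentations and Coxeter systems\<close>

text \<open>
  The letter \<open>(x, True)\<close> stands for \<open>x\<close> and \<open>(x, False)\<close> for its formal inverse. The group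
  presented by generators \<open>X\<close> and relators \<open>R\<close> is the set of words over \<open>X\<close> modulo the equivalence
  generated by free reduction and deletion of relators.
\<close>

definition words_over :: "'w set \<Rightarrow> ('w \<times> bool) list set" where
  "words_over X = lists (X \<times> UNIV)"

definition eval_word :: "('w::group_add \<times> bool) list \<Rightarrow> 'w" where
  "eval_word u = sum_list (map (\<lambda>(x, b). if b then x else - x) u)"

inductive presentation_step ::
    "'w set \<Rightarrow> ('w \<times> bool) list set \<Rightarrow> ('w \<times> bool) list \<Rightarrow> ('w \<times> bool) list \<Rightarrow> bool"
  for X R where
  cancel: "u \<in> words_over X \<Longrightarrow> v \<in> words_over X \<Longrightarrow> x \<in> X \<Longrightarrow>
    presentation_step X R (u @ [(x, b), (x, \<not> b)] @ v) (u @ v)"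
| relator: "u \<in> words_over X \<Longrightarrow> v \<in> words_over X \<Longrightarrow> r \<in> R \<Longrightarrow>
    presentation_step X R (u @ r @ v) (u @ v)"

text \<open>The canonical map from the group presented by \<open>X\<close> and \<open>R\<close> to \<open>W\<close> is an isomorphism.\<close>

definition has_presentation :: "'w::group_add set \<Rightarrow> ('w \<times> bool) list set \<Rightarrow> bool" where
  "has_presentation X R \<longleftrightarrow>
     eval_word ` words_over X = UNIV \<and>
     (\<forall>u\<in>words_over X. \<forall>v\<in>words_over X.
        eval_word u = eval_word v \<longleftrightarrow> equivclp (presentation_step X R) u v)"

definition coxeter_relators :: "'w set \<Rightarrow> ('w \<Rightarrow> 'w \<Rightarrow> enat) \<Rightarrow> ('w \<times> bool) list set" where
  "coxeter_relators S m =
     {concat (replicate n [(s, True), (t, True)]) | s t n. s \<in> S \<and> t \<in> S \<and> m s t = enat n}"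

definition coxeter_system :: "'w::group_add set \<Rightarrow> ('w \<Rightarrow> 'w \<Rightarrow> enat) \<Rightarrow> bool" where
  "coxeter_system S m \<longleftrightarrow>
     (\<forall>s\<in>S. \<forall>t\<in>S. m s t = m t s \<and> 1 \<le> m s t \<and> (m s t = 1 \<longleftrightarrow> s = t)) \<and>
     has_presentation S (coxeter_relators S m)"

definition right_angled :: "'w set \<Rightarrow> ('w \<Rightarrow> 'w \<Rightarrow> enat) \<Rightarrow> bool" where
  "right_angled S m \<longleftrightarrow> (\<forall>s\<in>S. \<forall>t\<in>S. s \<noteq> t \<longrightarrow> m s t = 2 \<or> m s t = \<infinity>)"


section \<open>Word length, nerve and greedy generators\<close>

definition generated :: "'w::group_add set \<Rightarrow> 'w set" where
  "generated X = {sum_list xs | xs. set xs \<subseteq> X \<union> uminus ` X}"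

definition word_length :: "'w::group_add set \<Rightarrow> 'w \<Rightarrow> nat" where
  "word_length X w =
     (LEAST n. \<exists>xs. set xs \<subseteq> X \<union> uminus ` X \<and> length xs = n \<and> sum_list xs = w)"

definition nerve :: "'w::group_add set \<Rightarrow> 'w set set" where
  "nerve S = {\<sigma>. \<sigma> \<subseteq> S \<and> finite (generated \<sigma>)}"

definition longest_element :: "'w::group_add set \<Rightarrow> 'w set \<Rightarrow> 'w" where
  "longest_element S \<sigma> =
     (THE w. w \<in> generated \<sigma> \<and> (\<forall>v\<in>generated \<sigma>. word_length S v \<le> word_length S w))"

definition greedy_generators :: "'w::group_add set \<Rightarrow> 'w set" where
  "greedy_generators S = {longest_element S \<sigma> | \<sigma>. \<sigma> \<in> nerve S - {{}}}"

text \<open>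
  The sums below range over finite sets when \<open>S\<close> is finite, since then so is the set of greedy
  generators.
\<close>

definition greedy_growth :: "'w::group_add set \<Rightarrow> rat fps" where
  "greedy_growth S = Abs_fps (\<lambda>n. \<Sum>w | word_length (greedy_generators S) w = n. 1)"

definition complete_greedy_growth :: "'w::group_add set \<Rightarrow> ('w \<Rightarrow>\<^sub>0 rat) fps" where
  "complete_greedy_growth S =
     Abs_fps (\<lambda>n. \<Sum>w | word_length (greedy_generators S) w = n. Poly_Mapping.single w 1)"


section \<open>Eulerian spheres\<close>

definition chi_bar :: "'v set set \<Rightarrow> rat" where
  "chi_bar K = (\<Sum>\<sigma>\<in>K. (- 1) powi (int (card \<sigma>) - 1))"

definition link :: "'v set set \<Rightarrow> 'v set \<Rightarrow> 'v set set" where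
  "link K \<sigma> = {\<tau> \<in> K. \<sigma> \<inter> \<tau> = {} \<and> \<sigma> \<union> \<tau> \<in> K}"

definition eulerian_sphere :: "int \<Rightarrow> 'v set set \<Rightarrow> bool" where
  "eulerian_sphere k K \<longleftrightarrow>
     chi_bar K = (- 1) powi k \<and>
     (\<forall>\<sigma>\<in>K. chi_bar (link K \<sigma>) = (- 1) powi (k - 1 - (int (card \<sigma>) - 1)))"


section \<open>Rational series\<close>

text \<open>The infinite sum is taken in the \<open>t\<close>-adic topology, for which the library has an instance.\<close>

definition quasi_inverse :: "'r::ring_1 fps \<Rightarrow> 'r fps" where
  "quasi_inverse f = suminf (\<lambda>n. f ^ Suc n)"

inductive rational_series :: "'r::ring_1 fps \<Rightarrow> bool" where
  polynomial: "rational_series (fps_of_poly p)"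
| add: "rational_series f \<Longrightarrow> rational_series g \<Longrightarrow> rational_series (f + g)"
| mult: "rational_series f \<Longrightarrow> rational_series g \<Longrightarrow> rational_series (f * g)"
| quasi: "rational_series f \<Longrightarrow> fps_nth f 0 = 0 \<Longrightarrow> rational_series (quasi_inverse f)"


section \<open>Substitution of the inverse of the indeterminate\<close>

text \<open>
  For noncommutative \<open>R\<close>, \<open>R poly\<close> is used only as the type of coefficient sequences; it is
  interpreted in \<open>R((t))\<close> by \<open>eval_at p u\<close> with \<open>u = t\<close> or \<open>u = t\<^sup>-\<^sup>1\<close>.
\<close>

definition eval_at :: "'r::ring_1 poly \<Rightarrow> 'r fls \<Rightarrow> 'r fls" where
  "eval_at p u = (\<Sum>i\<le>degree p. fls_const (coeff p i) * u ^ i)"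

text \<open>
  Rational functions are regarded as elements of the field \<open>\<rat>((t))\<close>, which contains \<open>\<rat>(t)\<close>:
  if \<open>f\<close> is the expansion of \<open>p / q\<close>, then \<open>g\<close> is \<open>p(t\<^sup>-\<^sup>1) / q(t\<^sup>-\<^sup>1)\<close>.
\<close>

definition ratfun_value_at_inverse :: "rat fps \<Rightarrow> rat fls \<Rightarrow> bool" where
  "ratfun_value_at_inverse f g \<longleftrightarrow>
     (\<exists>p q. q \<noteq> 0 \<and> fps_to_fls f = eval_at p fls_X / eval_at q fls_X \<and>
            g = eval_at p fls_X_inv / eval_at q fls_X_inv)"

definition ratfun_at_inverse :: "rat fps \<Rightarrow> rat fls" where
  "ratfun_at_inverse f = (THE g. ratfun_value_at_inverse f g)"

definition scalar :: "rat \<Rightarrow> ('w::monoid_add \<Rightarrow>\<^sub>0 rat) fls" where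
  "scalar c = fls_const (Poly_Mapping.single 0 c)"

text \<open>\<open>g = C (I - M)\<^sup>-\<^sup>1 B\<close>, including that \<open>I - M\<close> is invertible; the size is that of \<open>M\<close>.\<close>

definition resolvent_value ::
    "rat mat \<Rightarrow> ('w::monoid_add \<Rightarrow>\<^sub>0 rat) fls mat \<Rightarrow> rat mat \<Rightarrow> ('w \<Rightarrow>\<^sub>0 rat) fls \<Rightarrow> bool" where
  "resolvent_value C M B g \<longleftrightarrow>
     (\<exists>N \<in> carrier_mat (dim_row M) (dim_row M).
        inverts_mat (1\<^sub>m (dim_row M) - M) N \<and> inverts_mat N (1\<^sub>m (dim_row M) - M) \<and>
        map_mat scalar C * N * map_mat scalar B = mat 1 1 (\<lambda>_. g))"

definition value_at_inverse ::
    "('w::monoid_add \<Rightarrow>\<^sub>0 rat) fps \<Rightarrow> ('w \<Rightarrow>\<^sub>0 rat) fls \<Rightarrow> bool" where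
  "value_at_inverse f g \<longleftrightarrow>
     (\<exists>n. \<exists>C \<in> carrier_mat 1 n. \<exists>Q \<in> carrier_mat n n. \<exists>B \<in> carrier_mat n 1.
        (\<forall>q \<in> elements_mat Q. coeff q 0 = 0) \<and>
        resolvent_value C (map_mat (\<lambda>q. eval_at q fls_X) Q) B (fps_to_fls f) \<and>
        resolvent_value C (map_mat (\<lambda>q. eval_at q fls_X_inv) Q) B g)"

definition at_inverse :: "('w::monoid_add \<Rightarrow>\<^sub>0 rat) fps \<Rightarrow> ('w \<Rightarrow>\<^sub>0 rat) fls" where
  "at_inverse f = (THE g. value_at_inverse f g)"

end

theory Submission
  imports Defs "Jordan_Normal_Form.Char_Poly"
begin

text \<open>
  An element of \<open>W\<close> is a unique product \<open>w\<^sub>\<sigma>\<^sub>1 \<dots> w\<^sub>\<sigma>\<^sub>n\<close> of nonempty cliques in which no generator of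
  a clique could be moved into the preceding one, and \<open>n\<close> is its length with respect to the greedy
  generators. So the growth series are resolvents of the transfer matrix \<open>P D\<close>, where \<open>P\<close> records which
  cliques may follow each other and \<open>D = diag(w\<^sub>\<sigma>)\<close>, and eliminating unknowns one by one shows that they
  are rational. With \<open>E = diag((-1)\<^bsup>|\<sigma>|\<^esup>)\<close>, the nerve being flag and Eulerian gives \<open>(P E)\<^sup>2 = 1\<close>; as \<open>D\<^sup>2 = 1\<close>,
  the transfer matrix is explicitly invertible on nonempty cliques, which evaluates the resolvent at
  the inverse of \<open>t\<close>.

  The value at the inverse does not depend on the expression because \<open>W\<close> is residually finite: under
  a finite permutation representation a resolvent over \<open>\<rat>[W]\<close> becomes one over \<open>\<rat>\<close>, which by Cramer's
  rule is a matrix of rational functions.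
\<close>

section \<open>Rational series and linear systems\<close>

text \<open>\<open>W\<close> is given only by its presentation, so two elements can be told apart
  only by an action that separates them; normal forms and residual finiteness both come from one
  such action. The Eulerian condition enters through inclusion-exclusion: by flagness,
  \<open>linked \<sigma> \<rho>\<close> is the alternating sum over those faces of \<rho> that span
  a simplex with \<sigma>, and after exchanging sums only alternating sums over the simplices above
  a given one have to be evaluated. Each evaluation produces the sign \<open>\<epsilon>\<close>. The
  square of \<open>P E\<close> uses it twice, so no sign is left there, and the sign of the
  reciprocity is the one put into the initial vector. The empty clique is kept as a state: its
  column in the involution identity supplies the row sums of \<open>P E\<close>, and at the inverse
  of \<open>t\<close> it alone carries the constant term. Since the transfer matrix vanishes on it,
  only a group inverse is available. The series over the rationals follows from the complete one,
  because the augmentation of the group ring is the permutation representation on one point.\<close>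

lemma fps_power_nth_eq_0:
  fixes f :: "'r::ring_1 fps"
  assumes "fps_nth f 0 = 0" "n < k"
  shows "fps_nth (f ^ k) n = 0"
  using assms(2)
proof (induction k arbitrary: n)
  case (Suc k)
  have "fps_nth f i * fps_nth (f ^ k) (n - i) = 0" if "i \<le> n" for i
    using that Suc assms(1) by (cases "i = 0") auto
  then show ?case by (simp add: fps_mult_nth)
qed simp

text \<open>Powers of \<open>f\<close> with exponent above \<open>n\<close> do not reach the
  coefficient \<open>n\<close>, so the partial sums stabilise. Any truncation \<open>N\<close> that
  is at least \<open>n\<close> is allowed, so that one truncation can serve all coefficients in a
  convolution.\<close>

lemma quasi_inverse_nth:
  fixes f :: "'r::ring_1 fps"
  assumes "fps_nth f 0 = 0" "n \<le> N"
  shows "fps_nth (quasi_inverse f) n = (\<Sum>k<N. fps_nth (f ^ Suc k) n)"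
proof -
  define g where "g = Abs_fps (\<lambda>n. \<Sum>k<n. fps_nth (f ^ Suc k) n)"
  have stable: "fps_nth (\<Sum>k<N. f ^ Suc k) n = fps_nth g n" if "n \<le> N" for n N
  proof -
    have "(\<Sum>k<N. fps_nth (f ^ Suc k) n) = (\<Sum>k<n. fps_nth (f ^ Suc k) n)"
      using that assms(1) by (intro sum.mono_neutral_right) (auto intro!: fps_power_nth_eq_0 simp del: power_Suc)
    then show ?thesis by (simp add: g_def fps_sum_nth)
  qed
  have "(\<lambda>N. \<Sum>k<N. f ^ Suc k) \<longlonglongrightarrow> g"
    by (rule tendsto_fpsI, rule eventually_mono[OF eventually_ge_at_top]) (rule stable)
  then have "quasi_inverse f = g"
    unfolding quasi_inverse_def by (intro sums_unique[symmetric]) (simp add: sums_def)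
  then show ?thesis using stable[OF assms(2)] by (simp add: fps_sum_nth)
qed

lemma quasi_inverse_nth_0 [simp]:
  fixes f :: "'r::ring_1 fps"
  shows "fps_nth f 0 = 0 \<Longrightarrow> fps_nth (quasi_inverse f) 0 = 0"
  by (simp add: quasi_inverse_nth[where N = 0])

text \<open>Says that \<open>1 + quasi_inverse f\<close> is a left inverse of \<open>1 - f\<close>,
  which suffices to solve equations whose coefficients stand to the left of the unknowns.\<close>

lemma quasi_inverse_left:
  fixes f :: "'r::ring_1 fps"
  assumes "fps_nth f 0 = 0"
  shows "quasi_inverse f = f + quasi_inverse f * f"
proof (rule fps_ext)
  fix n
  have "fps_nth (quasi_inverse f * f) n = (\<Sum>i=0..n. (\<Sum>k<n. fps_nth (f ^ Suc k) i) * fps_nth f (n - i))"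
    unfolding fps_mult_nth using assms by (intro sum.cong) (auto simp: quasi_inverse_nth[where N = n] simp del: power_Suc)
  also have "\<dots> = (\<Sum>k<n. fps_nth (f ^ Suc k * f) n)"
    unfolding fps_mult_nth sum_distrib_right by (rule sum.swap)
  finally have "fps_nth (f + quasi_inverse f * f) n = (\<Sum>k<Suc n. fps_nth (f ^ Suc k) n)"
    unfolding sum.lessThan_Suc_shift by (simp add: power_commutes mult.assoc)
  then show "fps_nth (quasi_inverse f) n = fps_nth (f + quasi_inverse f * f) n"
    using quasi_inverse_nth[OF assms, of n "Suc n"] by simp
qed

lemma rational_series_const: "rational_series (fps_const (c::'r::ring_1))"
  using rational_series.polynomial[of "[:c:]"] by (simp add: fps_of_poly_const)

lemma rational_series_X: "rational_series (fps_X :: 'r::ring_1 fps)"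
proof -
  have "fps_of_poly (monom 1 1) = (fps_X :: 'r fps)"
    by (rule fps_ext) (simp add: fps_X_def)
  then show ?thesis using rational_series.polynomial by metis
qed

lemma rational_series_sum:
  "(\<And>i. i \<in> I \<Longrightarrow> rational_series (f i)) \<Longrightarrow> rational_series (\<Sum>i\<in>I. f i :: 'r::ring_1 fps)"
proof (induction I rule: infinite_finite_induct)
  case (insert i I)
  then show ?case by (simp add: rational_series.add)
qed (use rational_series_const[of "0 :: 'r"] in simp_all)

text \<open>Gaussian elimination over a noncommutative ring: the equation of \<open>k\<close> is
  solved for \<open>y k\<close> by the left inverse \<open>r\<close> of \<open>1 - q k k\<close> and
  substituted into the others. The new coefficients \<open>q i j + q i k * r * q k j\<close> again
  have zero constant term, so the induction continues.\<close>

lemma rational_series_linear_system: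
  fixes y b :: "'i \<Rightarrow> 'r::ring_1 fps" and q :: "'i \<Rightarrow> 'i \<Rightarrow> 'r fps"
  assumes "finite I"
    and "\<And>i. i \<in> I \<Longrightarrow> y i = b i + (\<Sum>j\<in>I. q i j * y j)"
    and "\<And>i. i \<in> I \<Longrightarrow> rational_series (b i)"
    and "\<And>i j. i \<in> I \<Longrightarrow> j \<in> I \<Longrightarrow> rational_series (q i j)"
    and "\<And>i j. i \<in> I \<Longrightarrow> j \<in> I \<Longrightarrow> fps_nth (q i j) 0 = 0"
    and "i \<in> I"
  shows "rational_series (y i)"
  using assms
proof (induction I arbitrary: b q i rule: finite_induct)
  case (insert k I)
  define r where "r = 1 + quasi_inverse (q k k)"
  have r: "rational_series r"
    using insert.prems rational_series_const[of "1::'r"] by (auto simp: r_def intro!: rational_series.intros)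
  have "r * (1 - q k k) = 1"
    using quasi_inverse_left[of "q k k"] insert.prems(4)[of k k] by (simp add: r_def algebra_simps)
  moreover have "(1 - q k k) * y k = b k + (\<Sum>j\<in>I. q k j * y j)"
    using insert.prems(1)[of k] insert.hyps by (simp add: algebra_simps)
  ultimately have yk: "y k = r * b k + (\<Sum>j\<in>I. r * q k j * y j)"
    by (metis (no_types, lifting) distrib_left mult.assoc mult_1 sum.cong sum_distrib_left)
  have IH: "rational_series (y i)" if i: "i \<in> I" for i
  proof (rule insert.IH[where b = "\<lambda>i. b i + q i k * r * b k" and q = "\<lambda>i j. q i j + q i k * r * q k j"])
    show "y i = b i + q i k * r * b k + (\<Sum>j\<in>I. (q i j + q i k * r * q k j) * y j)" if "i \<in> I" for i
    proof -
      have "y i = b i + q i k * y k + (\<Sum>j\<in>I. q i j * y j)"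
        using insert.prems(1)[of i] insert.hyps that by (simp add: algebra_simps)
      then show ?thesis
        by (subst (asm) yk) (simp add: algebra_simps sum.distrib sum_distrib_left mult.assoc)
    qed
    show "rational_series (b i + q i k * r * b k)" if "i \<in> I" for i
      using that r insert.prems by (intro rational_series.intros) auto
    show "rational_series (q i j + q i k * r * q k j)" if "i \<in> I" "j \<in> I" for i j
      using that r insert.prems by (intro rational_series.intros) auto
  qed (use i insert.prems in auto)
  moreover have "rational_series (y k)"
    unfolding yk using r IH insert.prems by (intro rational_series.intros rational_series_sum) auto
  ultimately show ?case using insert.prems by auto
qed simp

section \<open>Alternating sums over Eulerian spheres\<close>

text \<open>For a simplex \<sigma> this contains the vertices of \<sigma> themselves, so avoiding it
  includes being disjoint from \<sigma>.\<close>

definition star_vertices :: "'v set set \<Rightarrow> 'v set \<Rightarrow> 'v set" where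
  "star_vertices K \<sigma> = {v. insert v \<sigma> \<in> K}"

text \<open>Adding or removing \<open>v\<close> is a sign-reversing involution of \<open>A\<close>
  without fixed points.\<close>

lemma sum_toggle_eq_0:
  assumes "finite A" and ins: "\<And>\<sigma>. \<sigma> \<in> A \<Longrightarrow> insert v \<sigma> \<in> A" and del: "\<And>\<sigma>. \<sigma> \<in> A \<Longrightarrow> \<sigma> - {v} \<in> A"
    and fin: "\<And>\<sigma>. \<sigma> \<in> A \<Longrightarrow> finite \<sigma>"
  shows "(\<Sum>\<sigma>\<in>A. (- 1) ^ card \<sigma> :: rat) = 0"
proof -
  let ?A0 = "{\<sigma> \<in> A. v \<notin> \<sigma>}" and ?A1 = "{\<sigma> \<in> A. v \<in> \<sigma>}"
  have "(\<Sum>\<sigma>\<in>?A1. (- 1) ^ card \<sigma> :: rat) = (\<Sum>\<sigma>\<in>?A0. - ((- 1) ^ card \<sigma>))"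
  proof (rule sum.reindex_bij_witness[of _ "insert v" "\<lambda>\<sigma>. \<sigma> - {v}"])
    show "- ((- 1) ^ card (\<sigma> - {v})) = ((- 1) ^ card \<sigma> :: rat)" if "\<sigma> \<in> ?A1" for \<sigma>
    proof -
      have "card \<sigma> = Suc (card (\<sigma> - {v}))" using that fin[of \<sigma>] by (metis (mono_tags, lifting) card_Suc_Diff1 mem_Collect_eq)
      then show ?thesis by simp
    qed
  qed (use ins del in \<open>auto simp: insert_absorb\<close>)
  moreover have "(\<Sum>\<sigma>\<in>A. (- 1) ^ card \<sigma> :: rat) = (\<Sum>\<sigma>\<in>?A0. (- 1) ^ card \<sigma>) + (\<Sum>\<sigma>\<in>?A1. (- 1) ^ card \<sigma>)"
    using assms(1) sum.Int_Diff[of A "\<lambda>\<sigma>. (- 1) ^ card \<sigma> :: rat" "{\<sigma>. v \<notin> \<sigma>}"]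
    by (simp add: Int_def set_diff_eq)
  ultimately show ?thesis by (simp add: sum_negf)
qed

text \<open>Moebius inversion in the Boolean lattice: a vertex of \<tau> outside \<sigma> can be
  toggled, and without such a vertex the interval has at most one element.\<close>

lemma sum_interval_alternating:
  assumes "finite \<tau>"
  shows "(\<Sum>\<alpha> | \<sigma> \<subseteq> \<alpha> \<and> \<alpha> \<subseteq> \<tau>. (- 1) ^ card \<alpha> :: rat) = (if \<sigma> = \<tau> then (- 1) ^ card \<tau> else 0)"
proof (cases "\<tau> \<subseteq> \<sigma>")
  case True
  then have "{\<alpha>. \<sigma> \<subseteq> \<alpha> \<and> \<alpha> \<subseteq> \<tau>} = (if \<sigma> = \<tau> then {\<tau>} else {})" by auto
  then show ?thesis by simp
next
  case False
  then obtain v where v: "v \<in> \<tau>" "v \<notin> \<sigma>" by auto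
  have "(\<Sum>\<alpha> | \<sigma> \<subseteq> \<alpha> \<and> \<alpha> \<subseteq> \<tau>. (- 1) ^ card \<alpha> :: rat) = 0"
    by (rule sum_toggle_eq_0[where v = v]) (use v assms in \<open>auto intro: finite_subset rev_finite_subset[of "Pow \<tau>"]\<close>)
  then show ?thesis using False by auto
qed

text \<open>Flagness is stated in the form in which it is used: \<tau> spans a simplex with \<sigma>
  as soon as each single vertex of \<tau> does.\<close>

locale flag_complex =
  fixes K :: "'v set set"
  assumes finite_K: "finite K"
    and finite_simplex: "\<sigma> \<in> K \<Longrightarrow> finite \<sigma>"
    and empty_simplex: "{} \<in> K"
    and face: "\<sigma> \<in> K \<Longrightarrow> \<tau> \<subseteq> \<sigma> \<Longrightarrow> \<tau> \<in> K"
    and flag: "\<sigma> \<in> K \<Longrightarrow> \<tau> \<in> K \<Longrightarrow> \<tau> \<subseteq> star_vertices K \<sigma> \<Longrightarrow> \<sigma> \<union> \<tau> \<in> K"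
begin

definition linked :: "'v set \<Rightarrow> 'v set \<Rightarrow> bool" where
  "linked \<sigma> \<tau> \<longleftrightarrow> \<tau> \<inter> star_vertices K \<sigma> = {}"

lemma union_in_K_iff: 
  assumes "\<sigma> \<in> K" "\<tau> \<in> K"
  shows "\<sigma> \<union> \<tau> \<in> K \<longleftrightarrow> \<tau> \<subseteq> star_vertices K \<sigma>"
proof
  assume *: "\<sigma> \<union> \<tau> \<in> K"
  show "\<tau> \<subseteq> star_vertices K \<sigma>"
  proof
    fix v assume "v \<in> \<tau>"
    then have "insert v \<sigma> \<subseteq> \<sigma> \<union> \<tau>" by auto
    then show "v \<in> star_vertices K \<sigma>" using face[OF *] by (simp add: star_vertices_def)
  qed
qed (use assms flag in blast)

text \<open>By flagness the faces of \<rho> that span a simplex with \<sigma> are all subsets of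
  \<open>\<rho> \<inter> star_vertices K \<sigma>\<close>, and the alternating sum over a power set
  detects whether the set is empty. This turns the relation into sums that the Eulerian condition
  can evaluate.\<close>

lemma linked_alternating:
  assumes "\<sigma> \<in> K" "\<rho> \<in> K"
  shows "of_bool (linked \<sigma> \<rho>) = (\<Sum>\<beta> | \<beta> \<subseteq> \<rho> \<and> \<sigma> \<union> \<beta> \<in> K. (- 1) ^ card \<beta> :: rat)"
proof -
  let ?I = "\<rho> \<inter> star_vertices K \<sigma>"
  have "{\<beta>. \<beta> \<subseteq> \<rho> \<and> \<sigma> \<union> \<beta> \<in> K} = {\<beta>. {} \<subseteq> \<beta> \<and> \<beta> \<subseteq> ?I}"
    using assms face union_in_K_iff by blast
  then show ?thesis
    using sum_interval_alternating[of ?I "{}"] finite_simplex[OF assms(2)] by (auto simp: linked_def)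
qed

end

locale eulerian_flag_complex = flag_complex +
  fixes k :: int
  assumes eulerian: "eulerian_sphere k K"
begin

text \<open>The sums below carry the sign of the cardinality, whereas \<open>chi_bar\<close> carries
  that of the dimension; this shifts the exponent \<open>k\<close> by one.\<close>

definition \<epsilon> :: rat where "\<epsilon> = (- 1) powi (k + 1)"

lemma \<epsilon>_square: "\<epsilon> * \<epsilon> = 1"
  by (simp add: \<epsilon>_def power_int_minus_one_mult_self)

text \<open>Removing \<beta> identifies the simplices above \<beta> with its link. The sign of
  \<open>card \<beta>\<close> cancels against the drop in dimension of the link sphere, so the value
  is the same for every \<beta>.\<close>

lemma alternating_sum_above:
  assumes "\<beta> \<in> K"
  shows "(\<Sum>\<rho> | \<rho> \<in> K \<and> \<beta> \<subseteq> \<rho>. (- 1) ^ card \<rho>) = \<epsilon>"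
proof -
  have fin: "finite \<sigma>" if "\<sigma> \<in> link K \<beta>" for \<sigma>
    using that finite_simplex by (auto simp: link_def)
  have "(\<Sum>\<rho> | \<rho> \<in> K \<and> \<beta> \<subseteq> \<rho>. (- 1) ^ card \<rho>) = (\<Sum>\<tau>\<in>link K \<beta>. (- 1) ^ (card \<beta> + card \<tau>) :: rat)"
  proof (rule sum.reindex_bij_witness[of _ "\<lambda>\<tau>. \<beta> \<union> \<tau>" "\<lambda>\<rho>. \<rho> - \<beta>"])
    show "(- 1) ^ (card \<beta> + card (\<rho> - \<beta>)) = (- 1) ^ card \<rho>" if "\<rho> \<in> {\<rho> \<in> K. \<beta> \<subseteq> \<rho>}" for \<rho>
      using that finite_simplex[of \<rho>] by (auto simp: card_Diff_subset card_mono finite_subset simp flip: power_add)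
  next
    show "\<rho> - \<beta> \<in> link K \<beta>" if "\<rho> \<in> {\<rho> \<in> K. \<beta> \<subseteq> \<rho>}" for \<rho>
      using that face[of \<rho> "\<rho> - \<beta>"] by (auto simp: link_def Un_absorb1)
  qed (auto simp: link_def)
  also have "\<dots> = - ((- 1) ^ card \<beta> * chi_bar (link K \<beta>))"
    by (simp add: chi_bar_def power_add sum_distrib_left power_int_diff flip: sum_negf)
  also have "\<dots> = \<epsilon>"
  proof -
    have "chi_bar (link K \<beta>) = (- 1) powi (k - int (card \<beta>))"
      using eulerian assms by (auto simp: eulerian_sphere_def)
    then show ?thesis by (simp add: \<epsilon>_def power_int_diff power_int_add)
  qed
  finally show ?thesis .
qed

text \<open>A vertex of \<alpha> outside \<beta> can be toggled in \<rho> without affecting either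
  condition, so everything cancels. If there is none, the condition on
  \<open>\<alpha> \<union> \<rho>\<close> is automatic and the previous sum remains.\<close>

lemma alternating_sum_above_star:
  assumes "\<alpha> \<in> K" "\<beta> \<in> K"
  shows "(\<Sum>\<rho> | \<rho> \<in> K \<and> \<beta> \<subseteq> \<rho> \<and> \<alpha> \<union> \<rho> \<in> K. (- 1) ^ card \<rho>) = \<epsilon> * of_bool (\<alpha> \<subseteq> \<beta>)"
proof (cases "\<alpha> \<subseteq> \<beta>")
  case True
  then have "{\<rho>. \<rho> \<in> K \<and> \<beta> \<subseteq> \<rho> \<and> \<alpha> \<union> \<rho> \<in> K} = {\<rho>. \<rho> \<in> K \<and> \<beta> \<subseteq> \<rho>}"
    by (auto simp: Un_absorb1)
  then show ?thesis using True alternating_sum_above[OF assms(2)] by simp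
next
  case False
  then obtain v where "v \<in> \<alpha>" "v \<notin> \<beta>" by auto
  then have "(\<Sum>\<rho> | \<rho> \<in> K \<and> \<beta> \<subseteq> \<rho> \<and> \<alpha> \<union> \<rho> \<in> K. (- 1) ^ card \<rho> :: rat) = 0"
  proof (intro sum_toggle_eq_0[where v = v])
    fix \<rho> assume \<rho>: "\<rho> \<in> {\<rho>. \<rho> \<in> K \<and> \<beta> \<subseteq> \<rho> \<and> \<alpha> \<union> \<rho> \<in> K}"
    show "insert v \<rho> \<in> {\<rho>. \<rho> \<in> K \<and> \<beta> \<subseteq> \<rho> \<and> \<alpha> \<union> \<rho> \<in> K}"
      using \<rho> \<open>v \<in> \<alpha>\<close> face[of "\<alpha> \<union> \<rho>" "insert v \<rho>"] by (auto simp: insert_absorb)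
    show "\<rho> - {v} \<in> {\<rho>. \<rho> \<in> K \<and> \<beta> \<subseteq> \<rho> \<and> \<alpha> \<union> \<rho> \<in> K}"
      using \<rho> \<open>v \<notin> \<beta>\<close> face[of "\<alpha> \<union> \<rho>" "\<alpha> \<union> (\<rho> - {v})"] face[of \<rho> "\<rho> - {v}"] by auto
  qed (use finite_K finite_simplex in auto)
  then show ?thesis using False by simp
qed

text \<open>After expanding \<open>linked\<close> by \<open>linked_alternating\<close> and
  exchanging the sums, the inner sum over \<sigma> vanishes for every face \<beta> of \<tau> except
  the empty one.\<close>

lemma alternating_sum_linked_left:
  assumes "\<tau> \<in> K"
  shows "(\<Sum>\<sigma>\<in>K. (- 1) ^ card \<sigma> * of_bool (linked \<sigma> \<tau>)) = \<epsilon>"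
proof -
  have "(\<Sum>\<sigma>\<in>K. (- 1) ^ card \<sigma> * of_bool (linked \<sigma> \<tau>)) =
    (\<Sum>\<sigma>\<in>K. \<Sum>\<beta> | \<beta> \<in> Pow \<tau> \<and> \<sigma> \<union> \<beta> \<in> K. (- 1) ^ card \<sigma> * (- 1) ^ card \<beta> :: rat)"
    using assms by (intro sum.cong) (simp_all add: linked_alternating sum_distrib_left)
  also have "\<dots> = (\<Sum>\<beta>\<in>Pow \<tau>. \<Sum>\<sigma> | \<sigma> \<in> K \<and> \<sigma> \<union> \<beta> \<in> K. (- 1) ^ card \<sigma> * (- 1) ^ card \<beta>)"
    using finite_K finite_simplex[OF assms] by (intro sum.swap_restrict) auto
  also have "\<dots> = (\<Sum>\<beta>\<in>Pow \<tau>. \<epsilon> * of_bool (\<beta> = {}) * (- 1) ^ card \<beta>)"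
  proof (intro sum.cong refl)
    fix \<beta> assume "\<beta> \<in> Pow \<tau>"
    then have "\<beta> \<in> K" using assms face by auto
    then show "(\<Sum>\<sigma> | \<sigma> \<in> K \<and> \<sigma> \<union> \<beta> \<in> K. (- 1) ^ card \<sigma> * (- 1) ^ card \<beta>) = \<epsilon> * of_bool (\<beta> = {}) * (- 1) ^ card \<beta>"
      using alternating_sum_above_star[OF _ empty_simplex, of \<beta>] by (simp add: Un_commute[of _ \<beta>] flip: sum_distrib_right)
  qed
  also have "\<dots> = (\<Sum>\<beta>\<in>{{}} \<inter> Pow \<tau>. \<epsilon> * of_bool (\<beta> = {}) * (- 1) ^ card \<beta>)"
    using finite_simplex[OF assms] by (intro sum.mono_neutral_right) auto
  also have "\<dots> = \<epsilon>" by simp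
  finally show ?thesis .
qed

text \<open>Expanding \<open>linked\<close> and exchanging sums, the sum over \<rho> leaves
  \<open>\<epsilon>\<close> and the condition that \<beta> contains \<alpha>; the remaining sum over
  \<beta> is of the same kind and gives a second \<open>\<epsilon>\<close>. The two signs
  cancel.\<close>

lemma alternating_sum_linked_right:
  assumes "\<sigma> \<in> K" "\<alpha> \<in> K"
  shows "(\<Sum>\<rho> | \<rho> \<in> K \<and> \<alpha> \<union> \<rho> \<in> K. (- 1) ^ card \<rho> * of_bool (linked \<sigma> \<rho>)) = (of_bool (\<sigma> \<subseteq> \<alpha>) :: rat)"
proof -
  have "(\<Sum>\<rho> | \<rho> \<in> K \<and> \<alpha> \<union> \<rho> \<in> K. (- 1) ^ card \<rho> * of_bool (linked \<sigma> \<rho>)) =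
    (\<Sum>\<rho> | \<rho> \<in> K \<and> \<alpha> \<union> \<rho> \<in> K. \<Sum>\<beta> | \<beta> \<in> {\<beta> \<in> K. \<sigma> \<union> \<beta> \<in> K} \<and> \<beta> \<subseteq> \<rho>. (- 1) ^ card \<beta> * (- 1) ^ card \<rho> :: rat)"
  proof (intro sum.cong refl)
    fix \<rho> assume "\<rho> \<in> {\<rho> \<in> K. \<alpha> \<union> \<rho> \<in> K}"
    moreover from this have "{\<beta>. \<beta> \<subseteq> \<rho> \<and> \<sigma> \<union> \<beta> \<in> K} = {\<beta> \<in> {\<beta> \<in> K. \<sigma> \<union> \<beta> \<in> K}. \<beta> \<subseteq> \<rho>}"
      using face[of \<rho>] by auto
    ultimately show "(- 1) ^ card \<rho> * of_bool (linked \<sigma> \<rho>) =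
      (\<Sum>\<beta> | \<beta> \<in> {\<beta> \<in> K. \<sigma> \<union> \<beta> \<in> K} \<and> \<beta> \<subseteq> \<rho>. (- 1) ^ card \<beta> * (- 1) ^ card \<rho> :: rat)"
      using assms(1) by (simp add: linked_alternating sum_distrib_left mult.commute)
  qed
  also have "\<dots> = (\<Sum>\<beta> | \<beta> \<in> K \<and> \<sigma> \<union> \<beta> \<in> K. \<Sum>\<rho> | \<rho> \<in> {\<rho> \<in> K. \<alpha> \<union> \<rho> \<in> K} \<and> \<beta> \<subseteq> \<rho>. (- 1) ^ card \<beta> * (- 1) ^ card \<rho>)"
    using finite_K by (intro sum.swap_restrict) auto
  also have "\<dots> = (\<Sum>\<beta> | \<beta> \<in> K \<and> \<sigma> \<union> \<beta> \<in> K. (- 1) ^ card \<beta> * (\<epsilon> * of_bool (\<alpha> \<subseteq> \<beta>)))"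
  proof (intro sum.cong refl)
    fix \<beta> assume \<beta>: "\<beta> \<in> {\<beta> \<in> K. \<sigma> \<union> \<beta> \<in> K}"
    have "{\<rho> \<in> {\<rho> \<in> K. \<alpha> \<union> \<rho> \<in> K}. \<beta> \<subseteq> \<rho>} = {\<rho>. \<rho> \<in> K \<and> \<beta> \<subseteq> \<rho> \<and> \<alpha> \<union> \<rho> \<in> K}" by auto
    then show "(\<Sum>\<rho> | \<rho> \<in> {\<rho> \<in> K. \<alpha> \<union> \<rho> \<in> K} \<and> \<beta> \<subseteq> \<rho>. (- 1) ^ card \<beta> * (- 1) ^ card \<rho>) = (- 1) ^ card \<beta> * (\<epsilon> * of_bool (\<alpha> \<subseteq> \<beta>))"
      using \<beta> alternating_sum_above_star[OF assms(2)] by (simp flip: sum_distrib_left)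
  qed
  also have "\<dots> = \<epsilon> * (\<Sum>\<beta> | \<beta> \<in> K \<and> \<alpha> \<subseteq> \<beta> \<and> \<sigma> \<union> \<beta> \<in> K. (- 1) ^ card \<beta>)"
    unfolding sum_distrib_left using finite_K
    by (intro sum.mono_neutral_cong_right) auto
  also have "\<dots> = of_bool (\<sigma> \<subseteq> \<alpha>)"
    using alternating_sum_above_star[OF assms] by (simp add: \<epsilon>_square flip: mult.assoc)
  finally show ?thesis .
qed

text \<open>In matrix form, \<open>(P E)\<^sup>2 = 1\<close>.\<close>

lemma linked_sign_involution:
  assumes "\<sigma> \<in> K" "\<tau> \<in> K"
  shows "(\<Sum>\<rho>\<in>K. of_bool (linked \<sigma> \<rho>) * (- 1) ^ card \<rho> * of_bool (linked \<rho> \<tau>) * (- 1) ^ card \<tau>) =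
    (of_bool (\<sigma> = \<tau>) :: rat)"
proof -
  \<comment> \<open>Only the second factor \<open>linked \<rho> \<tau>\<close> is expanded, over
    faces \<alpha> of \<tau>. The sum over \<rho> then is
    \<open>alternating_sum_linked_right\<close>, and what is left is an alternating sum over the
    interval from \<sigma> to \<tau>.\<close>
  have "(\<Sum>\<rho>\<in>K. of_bool (linked \<sigma> \<rho>) * (- 1) ^ card \<rho> * of_bool (linked \<rho> \<tau>) :: rat) =
    (\<Sum>\<rho>\<in>K. \<Sum>\<alpha> | \<alpha> \<in> Pow \<tau> \<and> \<rho> \<union> \<alpha> \<in> K. (- 1) ^ card \<alpha> * ((- 1) ^ card \<rho> * of_bool (linked \<sigma> \<rho>)))"
  proof (intro sum.cong refl)
    fix \<rho> assume "\<rho> \<in> K"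
    then show "of_bool (linked \<sigma> \<rho>) * (- 1) ^ card \<rho> * of_bool (linked \<rho> \<tau>) =
      (\<Sum>\<alpha> | \<alpha> \<in> Pow \<tau> \<and> \<rho> \<union> \<alpha> \<in> K. (- 1) ^ card \<alpha> * ((- 1) ^ card \<rho> * of_bool (linked \<sigma> \<rho>)) :: rat)"
      unfolding sum_distrib_right[symmetric]
      using linked_alternating[OF _ assms(2), of \<rho>] by simp
  qed
  also have "\<dots> = (\<Sum>\<alpha>\<in>Pow \<tau>. \<Sum>\<rho> | \<rho> \<in> K \<and> \<rho> \<union> \<alpha> \<in> K. (- 1) ^ card \<alpha> * ((- 1) ^ card \<rho> * of_bool (linked \<sigma> \<rho>)))"
    using finite_K finite_simplex[OF assms(2)] by (intro sum.swap_restrict) auto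
  also have "\<dots> = (\<Sum>\<alpha>\<in>Pow \<tau>. (- 1) ^ card \<alpha> * of_bool (\<sigma> \<subseteq> \<alpha>))"
  proof (intro sum.cong refl)
    fix \<alpha> assume "\<alpha> \<in> Pow \<tau>"
    then have "\<alpha> \<in> K" using assms face by auto
    then show "(\<Sum>\<rho> | \<rho> \<in> K \<and> \<rho> \<union> \<alpha> \<in> K. (- 1) ^ card \<alpha> * ((- 1) ^ card \<rho> * of_bool (linked \<sigma> \<rho>))) =
        ((- 1) ^ card \<alpha> * of_bool (\<sigma> \<subseteq> \<alpha>) :: rat)"
      using alternating_sum_linked_right[OF assms(1)] by (simp add: Un_commute[of _ \<alpha>] flip: sum_distrib_left)
  qed
  also have "\<dots> = (\<Sum>\<alpha> | \<sigma> \<subseteq> \<alpha> \<and> \<alpha> \<subseteq> \<tau>. (- 1) ^ card \<alpha>)"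
    using finite_simplex[OF assms(2)] by (intro sum.mono_neutral_cong_right) auto
  finally show ?thesis
    using sum_interval_alternating[OF finite_simplex[OF assms(2)], of \<sigma>]
    by (cases "\<sigma> = \<tau>") (simp_all flip: sum_distrib_right power_add)
qed

end

section \<open>Right-angled Coxeter groups\<close>

locale right_angled_coxeter =
  fixes S :: "'w::group_add set" and m :: "'w \<Rightarrow> 'w \<Rightarrow> enat"
  assumes finite_S: "finite S" and coxeter: "coxeter_system S m" and right_angled: "right_angled S m"
begin

text \<open>In the right-angled case these are the generators that have no relation with
  \<open>s\<close>; for \<open>t\<close> in \<open>S\<close> outside this set, \<open>t\<close>
  equals \<open>s\<close> or commutes with it.\<close>

definition nbrs :: "'w \<Rightarrow> 'w set" where
  "nbrs s = {t \<in> S. m s t = \<infinity>}"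

lemma m_sym: "s \<in> S \<Longrightarrow> t \<in> S \<Longrightarrow> m s t = m t s"
  using coxeter unfolding coxeter_system_def by blast

lemma m_self: "s \<in> S \<Longrightarrow> m s s = 1"
  using coxeter unfolding coxeter_system_def by blast

lemma nbrs_sym: "s \<in> S \<Longrightarrow> t \<in> S \<Longrightarrow> t \<in> nbrs s \<longleftrightarrow> s \<in> nbrs t"
  using m_sym by (auto simp: nbrs_def)

lemma nbrs_irrefl [simp]: "s \<notin> nbrs s"
  using m_self[of s] by (auto simp: nbrs_def one_enat_def)

lemma presentation: "has_presentation S (coxeter_relators S m)"
  using coxeter by (simp add: coxeter_system_def)

lemma relator_cases:
  assumes "r \<in> coxeter_relators S m"
  obtains s where "s \<in> S" "r = [(s, True), (s, True)]"
  | s t where "s \<in> S" "t \<in> S" "t \<notin> nbrs s" "r = [(s, True), (t, True), (s, True), (t, True)]"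
proof -
  obtain s t n where r: "r = concat (replicate n [(s, True), (t, True)])" and st: "s \<in> S" "t \<in> S"
    and n: "m s t = enat n"
    using assms unfolding coxeter_relators_def by blast
  show ?thesis
  proof (cases "s = t")
    case True
    then have "n = 1" using n m_self[OF st(1)] by (simp add: one_enat_def)
    then show ?thesis using that(1)[OF st(1)] r True by simp
  next
    case False
    then have "n = 2" using n right_angled st unfolding right_angled_def by (metis enat.distinct(1) enat.inject numeral_eq_enat)
    then show ?thesis using that(2)[OF st] n r by (simp add: numeral_2_eq_2 nbrs_def)
  qed
qed

lemma eval_relator: "r \<in> coxeter_relators S m \<Longrightarrow> eval_word r = 0"
proof -
  assume r: "r \<in> coxeter_relators S m"
  have "r \<in> words_over S" "[] \<in> words_over S"
    using r by (auto simp: words_over_def elim: relator_cases)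
  moreover have "presentation_step S (coxeter_relators S m) ([] @ r @ []) ([] @ [])"
    using r by (intro presentation_step.relator) (auto simp: words_over_def)
  then have "equivclp (presentation_step S (coxeter_relators S m)) r []" by auto
  ultimately have "eval_word r = eval_word []"
    using presentation unfolding has_presentation_def by blast
  then show ?thesis by (simp add: eval_word_def)
qed

lemma generator_square: 
  assumes "s \<in> S"
  shows "s + s = 0"
proof -
  have "m s s = enat 1" using m_self[OF assms] by (simp add: one_enat_def)
  then have "concat (replicate 1 [(s, True), (s, True)]) \<in> coxeter_relators S m"
    using assms unfolding coxeter_relators_def by blast
  from eval_relator[OF this] show ?thesis by (simp add: eval_word_def)
qed

lemma uminus_generator: "s \<in> S \<Longrightarrow> - s = s"
  using generator_square by (simp add: minus_unique)

lemma generators_commute: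
  assumes st: "s \<in> S" "t \<in> S" "t \<notin> nbrs s"
  shows "s + t = t + s"
proof (cases "s = t")
  case False
  then have "m s t = enat 2"
    using right_angled st unfolding right_angled_def nbrs_def
    by (metis (mono_tags, lifting) mem_Collect_eq numeral_eq_enat)
  then have "concat (replicate 2 [(s, True), (t, True)]) \<in> coxeter_relators S m"
    using st unfolding coxeter_relators_def by blast
  from eval_relator[OF this] have "(s + t) + (s + t) = 0"
    by (simp add: eval_word_def numeral_2_eq_2 add.assoc)
  then have "s + t = - (s + t)" by (metis minus_unique)
  also have "\<dots> = t + s" using uminus_generator st by (simp add: minus_add)
  finally show ?thesis .
qed simp

lemma words_surj: obtains u where "u \<in> words_over S" "eval_word u = w"
  using presentation unfolding has_presentation_def by (metis UNIV_I imageE)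

lemma group_induct [case_names zero add]:
  assumes "P 0" and "\<And>w s. s \<in> S \<Longrightarrow> P w \<Longrightarrow> P (w + s)"
  shows "P w"
proof -
  have "u \<in> words_over S \<Longrightarrow> P (eval_word u)" for u
  proof (induction u rule: rev_induct)
    case (snoc a u)
    obtain s b where a: "a = (s, b)" by force
    then have "s \<in> S" "P (eval_word u)" using snoc by (auto simp: words_over_def)
    then show ?case using assms(2)[of s "eval_word u"] uminus_generator[of s] a by (auto simp: eval_word_def)
  qed (simp add: eval_word_def assms(1))
  then show ?thesis using words_surj by metis
qed

subsection \<open>Right actions\<close>

definition commuting_involutions :: "('w \<Rightarrow> 'x \<Rightarrow> 'x) \<Rightarrow> bool" where
  "commuting_involutions f \<longleftrightarrow> (\<forall>s\<in>S. \<forall>x. f s (f s x) = x) \<and>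
     (\<forall>s\<in>S. \<forall>t\<in>S. t \<notin> nbrs s \<longrightarrow> (\<forall>x. f s (f t x) = f t (f s x)))"

text \<open>The exponent of a letter is ignored because the maps \<open>f s\<close> are to be
  involutions. Letters are applied from left to right, which produces a right action.\<close>

definition run :: "('w \<Rightarrow> 'x \<Rightarrow> 'x) \<Rightarrow> ('w \<times> bool) list \<Rightarrow> 'x \<Rightarrow> 'x" where
  "run f u = fold (\<lambda>(s, b). f s) u"

definition act :: "('w \<Rightarrow> 'x \<Rightarrow> 'x) \<Rightarrow> 'w \<Rightarrow> 'x \<Rightarrow> 'x" where
  "act f w = run f (SOME u. u \<in> words_over S \<and> eval_word u = w)"

lemma run_step:
  assumes f: "commuting_involutions f" and "presentation_step S (coxeter_relators S m) u v"
  shows "run f u x = run f v x"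
  using assms(2)
proof cases
  case (cancel u' v' s b)
  then show ?thesis using f by (simp add: run_def commuting_involutions_def)
next
  case (relator u' v' r)
  have "run f r x = x" for x
    using relator(5)
  proof (cases rule: relator_cases)
    case (1 s)
    then show ?thesis using f by (simp add: run_def commuting_involutions_def)
  next
    case (2 s t)
    then have "f t (f s (f t (f s x))) = f t (f s (f s (f t x)))"
      using f unfolding commuting_involutions_def by metis
    also have "\<dots> = x" using f 2 by (simp add: commuting_involutions_def)
    finally show ?thesis using 2 by (simp add: run_def)
  qed
  then show ?thesis using relator(1,2) by (simp add: run_def)
qed

text \<open>The presentation enters here: words with the same value are joined by presentation
  steps, and no step changes \<open>run\<close>. Hence the choice of a word in \<open>act\<close> is
  immaterial and every family of commuting involutions is an action of \<open>W\<close>.\<close>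

lemma act_eval_word:
  assumes f: "commuting_involutions f" and u: "u \<in> words_over S"
  shows "act f (eval_word u) = run f u"
proof -
  define v where "v = (SOME v. v \<in> words_over S \<and> eval_word v = eval_word u)"
  have v: "v \<in> words_over S" "eval_word v = eval_word u"
    using someI[of "\<lambda>v. v \<in> words_over S \<and> eval_word v = eval_word u" u] u by (auto simp: v_def)
  then have "equivclp (presentation_step S (coxeter_relators S m)) v u"
    using presentation u unfolding has_presentation_def by blast
  then have "run f v x = run f u x" for x
    by (induction rule: equivclp_induct) (metis run_step[OF f])+
  then show ?thesis by (auto simp: act_def v_def)
qed

lemma act_add:
  assumes f: "commuting_involutions f"
  shows "act f (v + w) x = act f w (act f v x)"
proof -
  obtain a b where ab: "a \<in> words_over S" "eval_word a = v" "b \<in> words_over S" "eval_word b = w"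
    using words_surj by metis
  then have "a @ b \<in> words_over S" "eval_word (a @ b) = v + w"
    by (auto simp: words_over_def eval_word_def)
  then show ?thesis using ab act_eval_word[OF f] by (metis comp_apply fold_append run_def)
qed

lemma act_zero:
  assumes "commuting_involutions f"
  shows "act f 0 x = x"
  using act_eval_word[OF assms, of "[]"] by (simp add: words_over_def eval_word_def run_def)

lemma act_generator:
  assumes "commuting_involutions f" "s \<in> S"
  shows "act f s = f s"
  using act_eval_word[OF assms(1), of "[(s, True)]"] assms(2)
  by (auto simp: words_over_def eval_word_def run_def)

subsection \<open>Heaps of pieces\<close>

text \<open>
  A group element is encoded by a heap: the piece \<open>(j, s)\<close> is the generator \<open>s\<close> at level \<open>j\<close>, and
  \<open>s\<close> acts by toggling its piece at the lowest level above all pieces not commuting with it. That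
  level depends only on the latter pieces, so the defining relations hold on arbitrary sets of
  pieces, and also when toggling is disabled from level \<open>N\<close> on. The infinite \<open>N\<close> gives normal
  forms, the finite ones give finite permutation representations.
\<close>

definition height :: "(nat \<times> 'w) set \<Rightarrow> 'w \<Rightarrow> nat" where
  "height H s = Max (insert 0 {Suc j | j t. (j, t) \<in> H \<and> t \<in> nbrs s})"

definition flip :: "'p \<Rightarrow> 'p set \<Rightarrow> 'p set" where
  "flip p H = (if p \<in> H then H - {p} else insert p H)"

definition toggle :: "enat \<Rightarrow> 'w \<Rightarrow> (nat \<times> 'w) set \<Rightarrow> (nat \<times> 'w) set" where
  "toggle N s H = (if enat (height H s) < N then flip (height H s, s) H else H)"

lemma flip_flip [simp]: "flip p (flip p H) = H"
  by (auto simp: flip_def)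

lemma flip_commute: "flip p (flip q H) = flip q (flip p H)"
  by (auto simp: flip_def)

lemma height_flip: "t \<notin> nbrs s \<Longrightarrow> height (flip (j, t) H) s = height H s"
  unfolding height_def by (rule arg_cong[where f = "\<lambda>A. Max (insert 0 A)"]) (auto simp: flip_def)

lemma height_toggle: "t \<notin> nbrs s \<Longrightarrow> height (toggle N t H) s = height H s"
  by (simp add: toggle_def height_flip)

lemma commuting_involutions_toggle: "commuting_involutions (toggle N)"
proof -
  have "toggle N s (toggle N s H) = H" for s H
    by (simp add: toggle_def height_flip)
  moreover have "toggle N s (toggle N t H) = toggle N t (toggle N s H)"
    if "s \<in> S" "t \<in> S" "t \<notin> nbrs s" for s t H
    using that nbrs_sym[of s t] by (simp add: toggle_def height_flip flip_commute)
  ultimately show ?thesis unfolding commuting_involutions_def by blast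
qed

lemmas act_toggle_add = act_add[OF commuting_involutions_toggle]
lemmas act_toggle_zero = act_zero[OF commuting_involutions_toggle]
lemmas act_toggle_generator = act_generator[OF commuting_involutions_toggle]

definition heap :: "'w \<Rightarrow> (nat \<times> 'w) set" where
  "heap w = act (toggle \<infinity>) w {}"

lemma heap_zero [simp]: "heap 0 = {}"
  by (simp add: heap_def act_toggle_zero)

lemma heap_add_generator: "s \<in> S \<Longrightarrow> heap (w + s) = flip (height (heap w) s, s) (heap w)"
  by (simp add: heap_def act_toggle_add act_toggle_generator toggle_def)

text \<open>A fixed word reaches only finitely many levels, so a truncation above them is never
  noticed.\<close>

lemma act_toggle_eq_heap: "\<exists>N0. \<forall>N\<ge>N0. act (toggle (enat N)) w {} = heap w"
proof (induction w rule: group_induct)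
  case zero
  then show ?case by (simp add: act_toggle_zero)
next
  case (add w s)
  then obtain N0 where "\<forall>N\<ge>N0. act (toggle (enat N)) w {} = heap w" by blast
  then have "\<forall>N\<ge>max N0 (Suc (height (heap w) s)). act (toggle (enat N)) (w + s) {} = heap (w + s)"
    using add(1) by (simp add: act_toggle_add act_toggle_generator toggle_def heap_add_generator)
  then show ?case by blast
qed

text \<open>As \<open>S\<close> is finite, the truncated action therefore permutes a finite set of
  heaps.\<close>

lemma act_toggle_closed:
  assumes "H \<subseteq> {..<N} \<times> S"
  shows "act (toggle (enat N)) w H \<subseteq> {..<N} \<times> S"
proof (induction w rule: group_induct)
  case (add w s)
  have "act (toggle (enat N)) (w + s) H = toggle (enat N) s (act (toggle (enat N)) w H)"
    using add(1) by (simp add: act_toggle_add act_toggle_generator)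
  moreover have "toggle (enat N) s H' \<subseteq> {..<N} \<times> S" if "H' \<subseteq> {..<N} \<times> S" for H'
    using that add(1) by (auto simp: toggle_def flip_def)
  ultimately show ?case using add(2) by simp
qed (simp add: act_toggle_zero assms)

subsection \<open>Cliques\<close>

definition clique :: "'w set \<Rightarrow> bool" where
  "clique \<sigma> \<longleftrightarrow> \<sigma> \<subseteq> S \<and> (\<forall>s\<in>\<sigma>. \<forall>t\<in>\<sigma>. t \<notin> nbrs s)"

text \<open>Used for cliques only: there the factors commute and the order of the fold does not
  matter.\<close>

definition clique_elt :: "'w set \<Rightarrow> 'w" where
  "clique_elt = Finite_Set.fold (+) 0"

lemma clique_empty [simp]: "clique {}"
  by (simp add: clique_def)

lemma clique_mono: "clique \<sigma> \<Longrightarrow> \<tau> \<subseteq> \<sigma> \<Longrightarrow> clique \<tau>"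
  unfolding clique_def by blast

lemma clique_finite: "clique \<sigma> \<Longrightarrow> finite \<sigma>"
  using finite_S finite_subset by (auto simp: clique_def)

lemma clique_insert:
  "clique \<sigma> \<Longrightarrow> s \<in> S \<Longrightarrow> (\<And>t. t \<in> \<sigma> \<Longrightarrow> t \<notin> nbrs s) \<Longrightarrow> clique (insert s \<sigma>)"
  using nbrs_sym unfolding clique_def by (metis insert_iff insert_subset nbrs_irrefl subsetD)

lemma finite_cliques: "finite (Collect clique)"
  by (rule finite_subset[of _ "Pow S"]) (auto simp: clique_def finite_S)

lemma clique_elt_empty [simp]: "clique_elt {} = 0"
  by (simp add: clique_elt_def)

lemma clique_elt_insert:
  assumes "clique (insert s \<sigma>)" "s \<notin> \<sigma>"
  shows "clique_elt (insert s \<sigma>) = s + clique_elt \<sigma>"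
proof -
  interpret comp_fun_commute_on "insert s \<sigma>" "(+)"
  proof
    fix x y assume xy: "x \<in> insert s \<sigma>" "y \<in> insert s \<sigma>"
    have "x + y = y + x"
      using assms(1) xy by (intro generators_commute) (auto simp: clique_def)
    then show "(+) y \<circ> (+) x = (+) x \<circ> (+) y"
      by (simp add: fun_eq_iff flip: add.assoc)
  qed
  show ?thesis
    using assms clique_finite[OF assms(1)] unfolding clique_elt_def by (intro fold_insert) auto
qed

lemma clique_induct [consumes 1, case_names empty insert]:
  assumes "clique \<sigma>" "P {}"
    and "\<And>s \<sigma>. s \<notin> \<sigma> \<Longrightarrow> clique (insert s \<sigma>) \<Longrightarrow> clique \<sigma> \<Longrightarrow> P \<sigma> \<Longrightarrow> P (insert s \<sigma>)"
  shows "P \<sigma>"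
proof -
  have "finite \<sigma>" using assms(1) by (rule clique_finite)
  then show ?thesis using assms(1)
  proof (induction \<sigma> rule: finite_induct)
    case (insert s \<sigma>)
    then show ?case using assms(3) clique_mono[of "insert s \<sigma>" \<sigma>] by auto
  qed (rule assms(2))
qed

lemma clique_elt_commute:
  assumes "clique \<sigma>" "s \<in> S" "\<And>t. t \<in> \<sigma> \<Longrightarrow> t \<notin> nbrs s"
  shows "s + clique_elt \<sigma> = clique_elt \<sigma> + s"
  using assms
proof (induction \<sigma> rule: clique_induct)
  case (insert t \<sigma>)
  then have "s + t = t + s" by (intro generators_commute) (auto simp: clique_def)
  moreover have "s + clique_elt \<sigma> = clique_elt \<sigma> + s" using insert by blast
  ultimately show ?case using insert.hyps by (metis add.assoc clique_elt_insert)
qed simp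

lemma clique_elt_square: "clique \<sigma> \<Longrightarrow> clique_elt \<sigma> + clique_elt \<sigma> = 0"
proof (induction \<sigma> rule: clique_induct)
  case (insert s \<sigma>)
  then have s: "s \<in> S" and comm: "s + clique_elt \<sigma> = clique_elt \<sigma> + s"
    by (auto simp: clique_def intro!: clique_elt_commute)
  have "s + clique_elt \<sigma> + (s + clique_elt \<sigma>) = s + (clique_elt \<sigma> + s) + clique_elt \<sigma>"
    by (simp add: add.assoc)
  also have "\<dots> = (s + s) + (clique_elt \<sigma> + clique_elt \<sigma>)" 
    by (simp add: add.assoc flip: comm)
  finally show ?case using insert s by (simp add: clique_elt_insert generator_square)
qed simp

lemma clique_elt_flip:
  assumes "clique \<sigma>" "s \<in> S" "\<And>t. t \<in> \<sigma> \<Longrightarrow> t \<notin> nbrs s"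
  shows "clique_elt (flip s \<sigma>) = clique_elt \<sigma> + s"
proof (cases "s \<in> \<sigma>")
  case True
  then have ins: "insert s (\<sigma> - {s}) = \<sigma>" by auto
  have "clique_elt \<sigma> = s + clique_elt (\<sigma> - {s})"
    using clique_elt_insert[of s "\<sigma> - {s}"] assms(1) ins by simp
  then have "s + clique_elt \<sigma> = clique_elt (\<sigma> - {s})"
    using generator_square[OF assms(2)] by (simp flip: add.assoc)
  then show ?thesis using clique_elt_commute[OF assms] True by (simp add: flip_def)
next
  case False
  then show ?thesis
    using clique_elt_commute[OF assms] clique_insert[OF assms] by (simp add: flip_def clique_elt_insert)
qed

text \<open>The members of a clique do not influence each other's height, so all heights can be read
  off from \<open>H\<close> before acting and the clique toggles its pieces simultaneously.\<close>

lemma act_clique_elt: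
  "clique \<sigma> \<Longrightarrow> act (toggle \<infinity>) (clique_elt \<sigma>) H = sym_diff H {(height H s, s) | s. s \<in> \<sigma>}"
proof (induction \<sigma> arbitrary: H rule: clique_induct)
  case (insert s \<sigma>)
  then have s: "s \<in> S" and h: "height (toggle \<infinity> s H) t = height H t" if "t \<in> \<sigma>" for t
    using that by (auto simp: clique_def height_toggle)
  have "act (toggle \<infinity>) (clique_elt (insert s \<sigma>)) H = act (toggle \<infinity>) (clique_elt \<sigma>) (toggle \<infinity> s H)"
    using insert by (simp add: clique_elt_insert act_toggle_add act_toggle_generator clique_def)
  also have "\<dots> = sym_diff (toggle \<infinity> s H) {(height H t, t) | t. t \<in> \<sigma>}"
  proof -
    have "{(height (toggle \<infinity> s H) t, t) | t. t \<in> \<sigma>} = {(height H t, t) | t. t \<in> \<sigma>}" using h by force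
    then show ?thesis by (simp only: insert.IH)
  qed
  also have "\<dots> = sym_diff H {(height H t, t) | t. t \<in> insert s \<sigma>}"
    using insert.hyps(1) by (auto simp: toggle_def flip_def)
  finally show ?case .
qed (simp add: act_toggle_zero)

lemma heap_add_clique_elt:
  "clique \<sigma> \<Longrightarrow> heap (w + clique_elt \<sigma>) = sym_diff (heap w) {(height (heap w) s, s) | s. s \<in> \<sigma>}"
  by (simp add: heap_def act_toggle_add act_clique_elt)

lemma height_le: "H \<subseteq> {..<n} \<times> UNIV \<Longrightarrow> height H s \<le> n"
proof -
  assume H: "H \<subseteq> {..<n} \<times> UNIV"
  have "{Suc j | j t. (j, t) \<in> H \<and> t \<in> nbrs s} \<subseteq> {..n}" using H by auto
  then show ?thesis unfolding height_def by (intro Max.boundedI) (auto dest: finite_subset)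
qed

lemma height_gt: "finite H \<Longrightarrow> (j, t) \<in> H \<Longrightarrow> t \<in> nbrs s \<Longrightarrow> j < height H s"
proof -
  assume H: "finite H" "(j, t) \<in> H" "t \<in> nbrs s"
  have "{Suc j | j t. (j, t) \<in> H \<and> t \<in> nbrs s} \<subseteq> (\<lambda>p. Suc (fst p)) ` H" by force
  then have "finite {Suc j | j t. (j, t) \<in> H \<and> t \<in> nbrs s}" using H(1) by (auto intro: finite_subset)
  then show ?thesis using H unfolding height_def by (subst Suc_le_eq[symmetric], intro Max_ge) auto
qed

lemma height_Suc: "finite H \<Longrightarrow> height H s = Suc j \<Longrightarrow> \<exists>t\<in>nbrs s. (j, t) \<in> H"
proof -
  assume H: "finite H" "height H s = Suc j"
  have "{Suc j | j t. (j, t) \<in> H \<and> t \<in> nbrs s} \<subseteq> (\<lambda>p. Suc (fst p)) ` H" by force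
  then have "finite {Suc j | j t. (j, t) \<in> H \<and> t \<in> nbrs s}" using H(1) by (auto intro: finite_subset)
  then have "height H s \<in> insert 0 {Suc j | j t. (j, t) \<in> H \<and> t \<in> nbrs s}"
    unfolding height_def by (intro Max_in) auto
  then show ?thesis using H(2) by auto
qed

subsection \<open>Normal forms\<close>

definition layer :: "(nat \<times> 'w) set \<Rightarrow> nat \<Rightarrow> 'w set" where
  "layer H j = {s. (j, s) \<in> H}"

text \<open>The Cartier-Foata normal form as a heap: each layer commutes, and a piece above the
  ground rests on a noncommuting piece one level below.\<close>

definition normal_heap :: "(nat \<times> 'w) set \<Rightarrow> bool" where
  "normal_heap H \<longleftrightarrow> finite H \<and> (\<forall>j. clique (layer H j)) \<and>
     (\<forall>j s. (Suc j, s) \<in> H \<longrightarrow> (\<exists>t\<in>nbrs s. (j, t) \<in> H))"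

definition heap_product :: "(nat \<times> 'w) set \<Rightarrow> nat \<Rightarrow> 'w" where
  "heap_product H n = sum_list (map (\<lambda>j. clique_elt (layer H j)) [0..<n])"

lemma layer_flip: "layer (flip (k, s) H) j = (if j = k then flip s (layer H k) else layer H j)"
  by (auto simp: layer_def flip_def)

lemma height_layer:
  assumes "finite H" "height H s \<le> j" "t \<in> layer H j"
  shows "t \<notin> nbrs s"
  using assms height_gt[of H j t s] by (auto simp: layer_def)

text \<open>A new piece rests on a piece that attains the maximum in \<open>height\<close>. A
  removed piece supported nothing, since a piece resting on it would not commute with
  \<open>s\<close> and would raise the height of \<open>s\<close> above it.\<close>

lemma normal_heap_flip:
  assumes H: "normal_heap H" and s: "s \<in> S"
  shows "normal_heap (flip (height H s, s) H)"
proof -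
  let ?k = "height H s"
  have fin: "finite H" using H by (simp add: normal_heap_def)
  have "clique (flip s (layer H ?k))"
    using H s height_layer[OF fin order_refl] clique_insert[of "layer H ?k" s]
    by (auto simp: normal_heap_def flip_def intro: clique_mono)
  then have "\<forall>j. clique (layer (flip (?k, s) H) j)"
    using H by (simp add: layer_flip normal_heap_def)
  moreover have "\<exists>t\<in>nbrs x. (j, t) \<in> flip (?k, s) H" if x: "(Suc j, x) \<in> flip (?k, s) H" for j x
  proof (cases "(Suc j, x) \<in> H")
    case True
    then obtain t where t: "t \<in> nbrs x" "(j, t) \<in> H" using H unfolding normal_heap_def by blast
    have "(j, t) \<noteq> (?k, s)"
    proof
      assume "(j, t) = (?k, s)"
      moreover have "x \<in> S" using True H by (auto simp: normal_heap_def clique_def layer_def)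
      ultimately have "x \<in> nbrs s" "?k = j" using t(1) s nbrs_sym by auto
      then show False using height_gt[OF fin True] by force
    qed
    then show ?thesis using t by (auto simp: flip_def)
  next
    case False
    then have "Suc j = ?k" "x = s" using x by (auto simp: flip_def split: if_splits)
    then obtain t where "t \<in> nbrs x" "(j, t) \<in> H" using height_Suc[OF fin, of s j] by auto
    then show ?thesis using \<open>Suc j = ?k\<close> by (auto simp: flip_def)
  qed
  ultimately show ?thesis using fin by (auto simp: normal_heap_def flip_def)
qed

text \<open>All layers at or above the height of \<open>s\<close> commute with \<open>s\<close>, so
  a factor \<open>s\<close> changed at that level can be moved to the right end of the
  product.\<close>

lemma heap_product_flip:
  assumes H: "normal_heap H" and s: "s \<in> S"
  shows "heap_product (flip (height H s, s) H) n = heap_product H n + (if height H s < n then s else 0)"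
proof (induction n)
  case (Suc n)
  let ?k = "height H s"
  have fin: "finite H" and cl: "clique (layer H n)" using H by (auto simp: normal_heap_def)
  consider "n < ?k" | "n = ?k" | "?k < n" by linarith
  then show ?case
  proof cases
    case 2
    then show ?thesis
      using Suc clique_elt_flip[OF cl s height_layer[OF fin, of s n]]
      by (simp add: heap_product_def layer_flip add.assoc)
  next
    case 3
    then have "s + clique_elt (layer H n) = clique_elt (layer H n) + s"
      using clique_elt_commute[OF cl s height_layer[OF fin, of s n]] by simp
    then show ?thesis using Suc 3 by (simp add: heap_product_def layer_flip add.assoc)
  qed (use Suc in \<open>simp add: heap_product_def layer_flip\<close>)
qed (simp add: heap_product_def)

lemma normal_heap_heap: "normal_heap (heap w)"
  by (induction w rule: group_induct)
    (simp_all add: heap_add_generator normal_heap_flip, simp add: normal_heap_def layer_def)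

text \<open>The element can be read back from its heap, layer by layer; this makes the action on
  heaps faithful and settles the word problem.\<close>

lemma heap_product_heap: "\<exists>N. \<forall>n\<ge>N. heap_product (heap w) n = w"
proof (induction w rule: group_induct)
  case zero
  have "heap_product {} n = 0" for n by (induction n) (simp_all add: heap_product_def layer_def)
  then show ?case by simp
next
  case (add w s)
  then obtain N where "\<forall>n\<ge>N. heap_product (heap w) n = w" by blast
  then have "\<forall>n\<ge>max N (Suc (height (heap w) s)). heap_product (heap (w + s)) n = w + s"
    using add(1) by (simp add: heap_add_generator heap_product_flip normal_heap_heap)
  then show ?case by blast
qed

lemma heap_inj: "heap v = heap w \<Longrightarrow> v = w"
  using heap_product_heap[of v] heap_product_heap[of w] by (metis nle_le)

text \<open>One truncation is high enough for all of the finitely many elements, and their heaps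
  differ; so the orbit of the empty heap already separates them.\<close>

lemma residually_finite:
  assumes "finite A"
  obtains N where "inj_on (\<lambda>w. act (toggle (enat N)) w {}) A"
proof -
  have "\<exists>N0. \<forall>N\<ge>N0. \<forall>w\<in>A. act (toggle (enat N)) w {} = heap w"
    using assms
  proof (induction A)
    case (insert a A)
    then obtain N1 N2 where "\<forall>N\<ge>N1. \<forall>w\<in>A. act (toggle (enat N)) w {} = heap w"
      "\<forall>N\<ge>N2. act (toggle (enat N)) a {} = heap a"
      using act_toggle_eq_heap[of a] by blast
    then have "\<forall>N\<ge>max N1 N2. \<forall>w\<in>insert a A. act (toggle (enat N)) w {} = heap w" by simp
    then show ?case by blast
  qed simp
  then obtain N where "\<forall>w\<in>A. act (toggle (enat N)) w {} = heap w" by blast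
  then show ?thesis using heap_inj by (intro that[of N] inj_onI) metis
qed

section \<open>Chains of cliques as unique normal forms\<close>

definition blocks :: "'w set \<Rightarrow> 'w set \<Rightarrow> bool" where
  "blocks \<sigma> \<tau> \<longleftrightarrow> (\<forall>s\<in>\<tau>. \<exists>t\<in>\<sigma>. t \<in> nbrs s)"

definition chain :: "'w set list \<Rightarrow> bool" where
  "chain xs \<longleftrightarrow> (\<forall>\<sigma>\<in>set xs. clique \<sigma> \<and> \<sigma> \<noteq> {}) \<and> successively blocks xs"

definition chain_product :: "'w set list \<Rightarrow> 'w" where
  "chain_product xs = sum_list (map clique_elt xs)"

definition chain_heap :: "'w set list \<Rightarrow> (nat \<times> 'w) set" where
  "chain_heap xs = {(j, s). j < length xs \<and> s \<in> xs ! j}"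

text \<open>Each generator of the next clique lands exactly on the first free level: no higher
  because nothing lies there yet, no lower because the preceding clique blocks it. So the levels of
  the heap are the cliques of the chain.\<close>

lemma heap_chain_product: "chain xs \<Longrightarrow> heap (chain_product xs) = chain_heap xs"
proof (induction xs rule: rev_induct)
  case Nil
  then show ?case by (simp add: chain_product_def chain_heap_def)
next
  case (snoc \<tau> xs)
  let ?H = "chain_heap xs"
  have xs: "chain xs" and \<tau>: "clique \<tau>" and bl: "xs \<noteq> [] \<Longrightarrow> blocks (last xs) \<tau>"
    using snoc.prems by (auto simp: chain_def successively_append_iff)
  have H: "heap (chain_product xs) = ?H" by (rule snoc.IH[OF xs])
  have "normal_heap ?H" using normal_heap_heap by (metis H)
  then have fin: "finite ?H" by (simp add: normal_heap_def)
  have "height ?H s = length xs" if "s \<in> \<tau>" for s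
  proof (rule antisym)
    show "height ?H s \<le> length xs" by (rule height_le) (auto simp: chain_heap_def)
    show "length xs \<le> height ?H s"
    proof (cases xs rule: rev_cases)
      case (snoc ys \<sigma>)
      then obtain t where t: "t \<in> \<sigma>" "t \<in> nbrs s" using bl \<open>s \<in> \<tau>\<close> by (auto simp: blocks_def)
      then have "(length ys, t) \<in> ?H" by (simp add: chain_heap_def snoc)
      then show ?thesis using height_gt[OF fin _ t(2)] snoc by force
    qed simp
  qed
  then have "{(height ?H s, s) | s. s \<in> \<tau>} = {length xs} \<times> \<tau>" by auto
  then have "heap (chain_product (xs @ [\<tau>])) = sym_diff ?H ({length xs} \<times> \<tau>)"
    using heap_add_clique_elt[OF \<tau>, of "chain_product xs"] H by (simp add: chain_product_def)
  also have "\<dots> = chain_heap (xs @ [\<tau>])"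
    by (auto simp: chain_heap_def nth_append split: if_splits)
  finally show ?case .
qed

text \<open>The cliques of a chain are nonempty, so the occupied levels determine its
  length.\<close>

lemma chain_heap_inj:
  assumes "chain xs" "chain ys" "chain_heap xs = chain_heap ys"
  shows "xs = ys"
proof -
  have level: "j < length zs \<longleftrightarrow> (\<exists>s. (j, s) \<in> chain_heap zs)" if "chain zs" for zs j
  proof
    assume j: "j < length zs"
    then have "zs ! j \<noteq> {}" using that nth_mem[OF j] unfolding chain_def by blast
    with j show "\<exists>s. (j, s) \<in> chain_heap zs" by (auto simp: chain_heap_def)
  qed (auto simp: chain_heap_def)
  have len: "length xs = length ys"
    using level[OF assms(1)] level[OF assms(2)] assms(3) by (metis linorder_neqE_nat less_irrefl)
  have "xs ! j = ys ! j" if "j < length xs" for j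
    using assms(3) that len by (auto simp: chain_heap_def set_eq_iff)
  then show ?thesis using len by (simp add: nth_equalityI)
qed

lemma chain_product_inj: "inj_on chain_product (Collect chain)"
  using chain_heap_inj heap_chain_product by (intro inj_onI) (metis mem_Collect_eq)

lemma chain_product_surj: "\<exists>xs. chain xs \<and> chain_product xs = w"
proof -
  let ?H = "heap w"
  have H: "finite ?H" "\<And>j. clique (layer ?H j)" "\<And>j s. (Suc j, s) \<in> ?H \<Longrightarrow> \<exists>t\<in>nbrs s. (j, t) \<in> ?H"
    using normal_heap_heap[of w] unfolding normal_heap_def by blast+
  have "\<exists>n. n \<notin> fst ` ?H" using ex_new_if_finite[OF infinite_UNIV_nat, of "fst ` ?H"] H(1) by simp
  then have ex: "\<exists>n. layer ?H n = {}" by (force simp: layer_def)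
  define n where "n = (LEAST n. layer ?H n = {})"
  have n: "layer ?H n = {}" "\<And>j. j < n \<Longrightarrow> layer ?H j \<noteq> {}"
    using LeastI_ex[OF ex] not_less_Least by (auto simp: n_def)
  \<comment> \<open>An empty layer supports nothing, so the heap ends at its first empty
    layer.\<close>
  have above: "layer ?H (n + i) = {}" for i
  proof (induction i)
    case (Suc i)
    then show ?case using H(3)[of "n + i"] by (auto simp: layer_def)
  qed (use n(1) in simp)
  have prod: "heap_product ?H (n + i) = heap_product ?H n" for i
    by (induction i) (use above in \<open>auto simp: heap_product_def\<close>)
  define xs where "xs = map (layer ?H) [0..<n]"
  have "chain xs"
    using H n(2) by (force simp: chain_def xs_def successively_conv_nth blocks_def layer_def)
  moreover obtain N where "\<forall>i\<ge>N. heap_product ?H i = w" using heap_product_heap by blast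
  then have "heap_product ?H n = w" using prod[of N] by simp
  then have "chain_product xs = w" by (simp add: chain_product_def xs_def heap_product_def comp_def)
  ultimately show ?thesis by blast
qed

end

context right_angled_coxeter begin

subsection \<open>Nerve and greedy generators\<close>

lemma clique_elt_list:
  "clique \<sigma> \<Longrightarrow> \<exists>xs. set xs = \<sigma> \<and> length xs = card \<sigma> \<and> sum_list xs = clique_elt \<sigma>"
proof (induction \<sigma> rule: clique_induct)
  case (insert s \<sigma>)
  then obtain xs where "set xs = \<sigma>" "length xs = card \<sigma>" "sum_list xs = clique_elt \<sigma>" by blast
  then have "set (s # xs) = insert s \<sigma> \<and> length (s # xs) = card (insert s \<sigma>) \<and> sum_list (s # xs) = clique_elt (insert s \<sigma>)"
    using insert.hyps clique_finite[of \<sigma>] by (simp add: clique_elt_insert)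
  then show ?case by blast
qed simp

lemma uminus_generators: "\<sigma> \<subseteq> S \<Longrightarrow> uminus ` \<sigma> = \<sigma>"
  using uminus_generator by (auto simp: image_def subset_iff) 

lemma generated_clique:
  assumes "clique \<sigma>"
  shows "generated \<sigma> = clique_elt ` Pow \<sigma>"
proof -
  have gen: "generated \<sigma> = {sum_list xs | xs. set xs \<subseteq> \<sigma>}"
    using assms uminus_generators[of \<sigma>] by (simp add: generated_def clique_def)
  have "sum_list xs \<in> clique_elt ` Pow \<sigma>" if "set xs \<subseteq> \<sigma>" for xs
    using that
  proof (induction xs)
    case (Cons s xs)
    then obtain \<tau> where \<tau>: "\<tau> \<subseteq> \<sigma>" "sum_list xs = clique_elt \<tau>" by auto
    have s: "s \<in> S" "\<And>t. t \<in> \<tau> \<Longrightarrow> t \<notin> nbrs s" using assms Cons.prems \<tau>(1) by (auto simp: clique_def)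
    have "sum_list (s # xs) = clique_elt (flip s \<tau>)"
      using clique_elt_flip[OF clique_mono[OF assms \<tau>(1)] s] clique_elt_commute[OF clique_mono[OF assms \<tau>(1)] s] \<tau>(2) by simp
    moreover have "flip s \<tau> \<subseteq> \<sigma>" using \<tau>(1) Cons.prems by (auto simp: flip_def)
    ultimately show ?case by blast
  qed (use clique_elt_empty in force)
  moreover have "clique_elt \<tau> \<in> generated \<sigma>" if "\<tau> \<subseteq> \<sigma>" for \<tau>
    using clique_elt_list[OF clique_mono[OF assms that]] that unfolding gen by (auto intro: sym)
  ultimately show ?thesis by (auto simp: gen)
qed

lemma chain_replicate_alternating:
  assumes "s \<in> S" "t \<in> S" "t \<in> nbrs s"
  shows "chain (map (\<lambda>i. if even i then {s} else {t}) [0..<n])"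
  using assms nbrs_sym[of s t] by (auto simp: chain_def successively_conv_nth blocks_def clique_def)

text \<open>For a noncommuting pair, the alternating words in the two generators are chains of
  singletons of every length, hence pairwise distinct, and the generated subgroup is infinite. A
  clique generates only the products of its subsets.\<close>

lemma nerve_eq_cliques: "nerve S = Collect clique"
proof -
  have "clique \<sigma>" if \<sigma>: "\<sigma> \<subseteq> S" "finite (generated \<sigma>)" for \<sigma>
  proof (rule ccontr)
    assume "\<not> clique \<sigma>"
    then obtain s t where st: "s \<in> \<sigma>" "t \<in> \<sigma>" "t \<in> nbrs s" using \<sigma>(1) by (auto simp: clique_def)
    define xs where "xs n = map (\<lambda>i. if even i then {s} else {t}) [0..<n]" for n :: nat
    have ch: "chain (xs n)" for n
      unfolding xs_def using st \<sigma>(1) by (intro chain_replicate_alternating) auto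
    have "chain_product (xs n) \<in> generated \<sigma>" for n
    proof -
      have s: "clique_elt {x} = x" if "x \<in> \<sigma>" for x
        using clique_elt_insert[of x "{}"] that \<sigma>(1) by (auto simp: clique_def)
      have "chain_product (xs n) = sum_list (map (\<lambda>i. if even i then s else t) [0..<n])"
        using st s by (simp add: chain_product_def xs_def comp_def if_distrib cong: if_cong)
      moreover have "set (map (\<lambda>i. if even i then s else t) [0..<n]) \<subseteq> \<sigma> \<union> uminus ` \<sigma>" using st by auto
      ultimately show ?thesis unfolding generated_def by blast
    qed
    moreover have "inj (\<lambda>n. chain_product (xs n))"
    proof (rule injI)
      fix i j assume "chain_product (xs i) = chain_product (xs j)"
      then have "xs i = xs j" using chain_product_inj ch by (auto dest: inj_onD)
      then show "i = j" by (metis length_map length_upt minus_nat.diff_0 xs_def)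
    qed
    ultimately have "infinite (generated \<sigma>)"
      by (meson finite_subset image_subset_iff range_inj_infinite)
    then show False using \<sigma>(2) by simp
  qed
  moreover have "\<sigma> \<in> nerve S" if "clique \<sigma>" for \<sigma>
    using that clique_finite[OF that] by (simp add: nerve_def generated_clique) (simp add: clique_def)
  ultimately show ?thesis by (auto simp: nerve_def)
qed

section \<open>Lengths with respect to \<open>S\<close> and to the greedy generators\<close>

lemma word_length_eqI:
  assumes "set xs \<subseteq> X" "sum_list xs = w" 
    and "\<And>ys. set ys \<subseteq> X \<union> uminus ` X \<Longrightarrow> sum_list ys = w \<Longrightarrow> length xs \<le> length ys"
  shows "word_length X w = length xs"
  unfolding word_length_def using assms by (intro Least_equality) auto

lemma finite_heap: "finite (heap w)"
  using normal_heap_heap by (simp add: normal_heap_def)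

text \<open>A letter toggles one piece, so the number of pieces is a lower bound for the length in
  \<open>S\<close>.\<close>

lemma card_heap_le: "set xs \<subseteq> S \<Longrightarrow> card (heap (sum_list xs)) \<le> length xs"
proof (induction xs rule: rev_induct)
  case (snoc s xs)
  have "card (flip p H) \<le> Suc (card H)" if "finite H" for p :: "nat \<times> 'w" and H
    using that by (simp add: flip_def card_insert_le_m1 card_Diff_subset le_SucI card_insert_if card_Diff1_le)
  then show ?case using snoc finite_heap by (simp add: heap_add_generator) (meson Suc_le_mono le_trans)
qed simp

lemma heap_clique_elt:
  assumes "clique \<sigma>"
  shows "heap (clique_elt \<sigma>) = {0} \<times> \<sigma>"
proof -
  have "height {} s = 0" for s by (simp add: height_def)
  then show ?thesis using heap_add_clique_elt[OF assms, of 0] by auto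
qed

lemma word_length_clique_elt:
  assumes "clique \<sigma>"
  shows "word_length S (clique_elt \<sigma>) = card \<sigma>"
proof -
  obtain xs where xs: "set xs = \<sigma>" "length xs = card \<sigma>" "sum_list xs = clique_elt \<sigma>"
    using clique_elt_list[OF assms] by blast
  have "card \<sigma> \<le> length ys" if "set ys \<subseteq> S \<union> uminus ` S" "sum_list ys = clique_elt \<sigma>" for ys
    using card_heap_le[of ys] that uminus_generators[of S] heap_clique_elt[OF assms]
    by (simp add: card_cartesian_product_singleton)
  then have "word_length S (clique_elt \<sigma>) = length xs"
    using xs assms by (intro word_length_eqI) (auto simp: clique_def)
  then show ?thesis using xs by simp
qed

text \<open>The elements of the subgroup are the products of subsets, with the cardinality as
  length, so the maximum is attained at the full clique only and the definite description has a
  unique solution.\<close>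

lemma longest_element_clique:
  assumes "clique \<sigma>"
  shows "longest_element S \<sigma> = clique_elt \<sigma>"
proof -
  have wl: "word_length S (clique_elt \<tau>) = card \<tau>" if "\<tau> \<subseteq> \<sigma>" for \<tau>
    using word_length_clique_elt[OF clique_mono[OF assms that]] .
  show ?thesis
    unfolding longest_element_def generated_clique[OF assms]
  proof (rule the_equality)
    show "clique_elt \<sigma> \<in> clique_elt ` Pow \<sigma> \<and>
      (\<forall>v\<in>clique_elt ` Pow \<sigma>. word_length S v \<le> word_length S (clique_elt \<sigma>))"
      using wl clique_finite[OF assms] by (auto simp: card_mono)
  next
    fix w assume w: "w \<in> clique_elt ` Pow \<sigma> \<and> (\<forall>v\<in>clique_elt ` Pow \<sigma>. word_length S v \<le> word_length S w)"
    then obtain \<tau> where \<tau>: "\<tau> \<subseteq> \<sigma>" "w = clique_elt \<tau>" by auto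
    have "word_length S (clique_elt \<sigma>) \<le> word_length S (clique_elt \<tau>)" using w \<tau>(2) by auto
    then have "card \<sigma> \<le> card \<tau>" using wl[OF \<tau>(1)] wl[of \<sigma>] by simp
    then have "\<tau> = \<sigma>" using card_seteq[OF clique_finite[OF assms] \<tau>(1)] by simp
    then show "w = clique_elt \<sigma>" using \<tau> by simp
  qed
qed

definition simplices :: "'w set set" where
  "simplices = {\<sigma>. clique \<sigma> \<and> \<sigma> \<noteq> {}}"

lemma finite_simplices: "finite simplices"
  using finite_cliques by (rule rev_finite_subset) (auto simp: simplices_def)

lemma greedy_generators_eq: "greedy_generators S = clique_elt ` simplices"
  unfolding greedy_generators_def nerve_eq_cliques simplices_def
  using longest_element_clique by (auto simp: image_def)

text \<open>A greedy generator fills at most one new level. Since a chain occupies as many levels as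
  it has cliques, this bounds the length in the greedy generators from below.\<close>

lemma heap_levels:
  "set xs \<subseteq> greedy_generators S \<union> uminus ` greedy_generators S \<Longrightarrow>
    heap (sum_list xs) \<subseteq> {..<length xs} \<times> UNIV"
proof (induction xs rule: rev_induct)
  case (snoc a xs)
  \<comment> \<open>Clique elements are involutions, so inverses of greedy generators are greedy
    generators again.\<close>
  have "\<exists>\<sigma>. clique \<sigma> \<and> a = clique_elt \<sigma>"
    using snoc.prems minus_unique[OF clique_elt_square]
    by (simp add: greedy_generators_eq simplices_def) blast
  then obtain \<sigma> where \<sigma>: "clique \<sigma>" "a = clique_elt \<sigma>" by blast
  have IH: "heap (sum_list xs) \<subseteq> {..<length xs} \<times> UNIV" using snoc by simp
  then have "height (heap (sum_list xs)) s \<le> length xs" for s by (rule height_le)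
  then show ?case using IH heap_add_clique_elt[OF \<sigma>(1)] \<sigma>(2) by (fastforce simp: less_Suc_eq_le)
qed simp

lemma word_length_chain_product:
  assumes "chain xs"
  shows "word_length (greedy_generators S) (chain_product xs) = length xs"
proof -
  have "length xs \<le> length ys" 
    if "set ys \<subseteq> greedy_generators S \<union> uminus ` greedy_generators S" "sum_list ys = chain_product xs" for ys
  proof (cases xs rule: rev_cases)
    case (snoc zs \<sigma>)
    then obtain s where "s \<in> \<sigma>" using assms by (auto simp: chain_def)
    then have "(length zs, s) \<in> chain_heap xs" by (simp add: chain_heap_def snoc)
    then have "length zs < length ys"
      using heap_levels[OF that(1)] heap_chain_product[OF assms] that(2) by auto
    then show ?thesis using snoc by simp
  qed simp
  then have "length (map clique_elt xs) \<le> length ys" 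
    if "set ys \<subseteq> greedy_generators S \<union> uminus ` greedy_generators S" "sum_list ys = chain_product xs" for ys
    using that by simp
  then have "word_length (greedy_generators S) (chain_product xs) = length (map clique_elt xs)"
    using assms by (intro word_length_eqI)
      (auto simp: greedy_generators_eq simplices_def chain_def chain_product_def)
  then show ?thesis by simp
qed

subsection \<open>Growth series\<close>

definition chains :: "'w set set \<Rightarrow> nat \<Rightarrow> 'w set list set" where
  "chains T n = {xs. chain xs \<and> length xs = n \<and> (xs \<noteq> [] \<longrightarrow> hd xs \<in> T)}"

text \<open>The multiplicative weight \<phi> covers both growth series: it is constantly 1 for one
  and the embedding into the group ring for the other.\<close>

definition chain_sum :: "('w \<Rightarrow> 'r::ring_1) \<Rightarrow> 'w set set \<Rightarrow> nat \<Rightarrow> 'r" where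
  "chain_sum \<phi> T n = (\<Sum>xs\<in>chains T n. \<phi> (chain_product xs))"

lemma finite_chains: "finite (chains T n)"
proof (rule finite_subset)
  show "chains T n \<subseteq> {xs. set xs \<subseteq> Collect clique \<and> length xs = n}"
    by (auto simp: chains_def chain_def)
qed (use finite_lists_length_eq[OF finite_cliques] in blast)

lemma chain_Cons: "chain (\<tau> # xs) \<longleftrightarrow> \<tau> \<in> simplices \<and> chain xs \<and> (xs \<noteq> [] \<longrightarrow> blocks \<tau> (hd xs))"
  by (cases xs) (auto simp: chain_def simplices_def)

lemma chain_sum_0: "\<phi> 0 = 1 \<Longrightarrow> chain_sum \<phi> T 0 = 1"
proof -
  have "chains T 0 = {[]}" by (auto simp: chains_def chain_def)
  then show "\<phi> 0 = 1 \<Longrightarrow> chain_sum \<phi> T 0 = 1" by (simp add: chain_sum_def chain_product_def)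
qed

lemma chain_sum_Suc:
  assumes "\<And>v w. \<phi> (v + w) = \<phi> v * \<phi> w"
  shows "chain_sum \<phi> T (Suc n) = (\<Sum>\<tau>\<in>simplices \<inter> T. \<phi> (clique_elt \<tau>) * chain_sum \<phi> (Collect (blocks \<tau>)) n)"
proof -
  have "chain_sum \<phi> T (Suc n) = (\<Sum>(\<tau>, xs)\<in>(SIGMA \<tau>:simplices \<inter> T. chains (Collect (blocks \<tau>)) n). \<phi> (chain_product (\<tau> # xs)))"
    unfolding chain_sum_def
    by (rule sum.reindex_bij_witness[of _ "\<lambda>(\<tau>, xs). \<tau> # xs" "\<lambda>xs. (hd xs, tl xs)"])
      (auto simp: chains_def chain_Cons length_Suc_conv)
  also have "\<dots> = (\<Sum>\<tau>\<in>simplices \<inter> T. \<Sum>xs\<in>chains (Collect (blocks \<tau>)) n. \<phi> (chain_product (\<tau> # xs)))"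
    using finite_simplices finite_chains by (subst sum.Sigma) auto
  finally show ?thesis
    using assms by (simp add: chain_sum_def chain_product_def sum_distrib_left)
qed

lemma word_length_fiber:
  "{w. word_length (greedy_generators S) w = n} = chain_product ` chains UNIV n"
proof (intro equalityI subsetI)
  fix w assume "w \<in> {w. word_length (greedy_generators S) w = n}"
  moreover obtain xs where "chain xs" "w = chain_product xs" using chain_product_surj by metis
  ultimately show "w \<in> chain_product ` chains UNIV n"
    using word_length_chain_product by (auto simp: chains_def)
qed (auto simp: chains_def word_length_chain_product)

lemma sum_word_length_fiber:
  "(\<Sum>w | word_length (greedy_generators S) w = n. \<phi> w) = chain_sum \<phi> UNIV n"
  unfolding word_length_fiber chain_sum_def
  by (rule sum.reindex_cong[OF inj_on_subset[OF chain_product_inj]]) (auto simp: chains_def)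

lemma greedy_growth_eq: "greedy_growth S = Abs_fps (chain_sum (\<lambda>_. 1) UNIV)"
  by (simp only: greedy_growth_def sum_word_length_fiber)

lemma complete_greedy_growth_eq:
  "complete_greedy_growth S = Abs_fps (chain_sum (\<lambda>w. Poly_Mapping.single w 1) UNIV)"
  by (simp only: complete_greedy_growth_def sum_word_length_fiber)

text \<open>Splitting off the first clique gives a finite linear system for the series of
  continuations of the nonempty cliques, whose coefficients are multiples of \<open>fps_X\<close>.
  One more equation of the same form expresses the series for arbitrary \<open>T\<close>.\<close>

lemma rational_chain_sum:
  fixes \<phi> :: "'w \<Rightarrow> 'r::ring_1"
  assumes "\<phi> 0 = 1" "\<And>v w. \<phi> (v + w) = \<phi> v * \<phi> w"
  shows "rational_series (Abs_fps (chain_sum \<phi> T))"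
proof -
  let ?Y = "\<lambda>T. Abs_fps (chain_sum \<phi> T)"
  let ?q = "\<lambda>T \<tau>. fps_const (of_bool (\<tau> \<in> T) * \<phi> (clique_elt \<tau>)) * fps_X"
  have q: "rational_series (?q T \<tau>)" for T \<tau>
    by (intro rational_series.mult rational_series_const rational_series_X)
  have Y: "?Y T = 1 + (\<Sum>\<tau>\<in>simplices. ?q T \<tau> * ?Y (Collect (blocks \<tau>)))" for T
  proof (rule fps_ext)
    fix n
    show "fps_nth (?Y T) n = fps_nth (1 + (\<Sum>\<tau>\<in>simplices. ?q T \<tau> * ?Y (Collect (blocks \<tau>)))) n"
    proof (cases n)
      case (Suc k)
      have "fps_nth (?Y T) n = (\<Sum>\<tau>\<in>simplices. (of_bool (\<tau> \<in> T) * \<phi> (clique_elt \<tau>)) * chain_sum \<phi> (Collect (blocks \<tau>)) k)"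
        using finite_simplices unfolding Suc
        by (simp add: chain_sum_Suc[OF assms(2)]) (intro sum.mono_neutral_cong_left, auto)
      then show ?thesis
        by (simp add: Suc fps_sum_nth mult.assoc)
    qed (simp add: chain_sum_0[where \<phi> = \<phi>, OF assms(1)] fps_sum_nth mult.assoc)
  qed
  have "rational_series (?Y (Collect (blocks \<sigma>)))" if "\<sigma> \<in> simplices" for \<sigma>
    using finite_simplices Y _ q _ that
  proof (rule rational_series_linear_system[where b = "\<lambda>_. 1" and y = "\<lambda>\<sigma>. ?Y (Collect (blocks \<sigma>))"
        and q = "\<lambda>\<sigma>. ?q (Collect (blocks \<sigma>))"])
  qed (use rational_series_const[of "1::'r"] in \<open>simp_all add: mult.assoc\<close>)
  then show ?thesis
    using rational_series_const[of "1::'r"] q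
    by (subst Y) (intro rational_series.add rational_series_sum rational_series.mult[OF q], simp_all)
qed

lemma rational_greedy_growth: "rational_series (greedy_growth S)"
  unfolding greedy_growth_eq by (rule rational_chain_sum) simp_all

lemma rational_complete_greedy_growth: "rational_series (complete_greedy_growth S)"
  unfolding complete_greedy_growth_eq by (rule rational_chain_sum) (simp_all add: mult_single)

section \<open>The nerve as a flag complex\<close>

lemma star_vertices_nerve:
  assumes "clique \<sigma>" "s \<in> S"
  shows "s \<in> star_vertices (nerve S) \<sigma> \<longleftrightarrow> (\<forall>t\<in>\<sigma>. t \<notin> nbrs s)"
  using assms clique_insert[OF assms] by (auto simp: star_vertices_def nerve_eq_cliques) (auto simp: clique_def)

sublocale nerve: flag_complex "nerve S"
proof
  show "finite (nerve S)" using finite_cliques by (simp add: nerve_eq_cliques)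
next
  fix \<sigma> \<tau> assume st: "\<sigma> \<in> nerve S" "\<tau> \<in> nerve S" "\<tau> \<subseteq> star_vertices (nerve S) \<sigma>"
  then have cl: "clique \<sigma>" "clique \<tau>" by (auto simp: nerve_eq_cliques)
  then have "t \<notin> nbrs s" if "s \<in> \<tau>" "t \<in> \<sigma>" for s t
    using st(3) star_vertices_nerve[OF cl(1), of s] cl(2) that unfolding clique_def by blast
  then have "clique (\<sigma> \<union> \<tau>)" using cl nbrs_sym unfolding clique_def by blast
  then show "\<sigma> \<union> \<tau> \<in> nerve S" by (simp add: nerve_eq_cliques)
qed (auto simp: nerve_eq_cliques intro: clique_finite clique_mono)

lemma linked_nerve:
  assumes "clique \<sigma>" "clique \<tau>"
  shows "nerve.linked \<sigma> \<tau> \<longleftrightarrow> blocks \<sigma> \<tau>"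
  using assms star_vertices_nerve[OF assms(1)]
  by (auto simp: nerve.linked_def blocks_def clique_def disjoint_iff subset_iff)

end

section \<open>Uniqueness of the value at the inverse\<close>

lemma eval_at_X_nth:
  fixes p :: "'r::ring_1 poly"
  shows "fls_nth (eval_at p fls_X) n = (if n \<ge> 0 then coeff p (nat n) else 0)"
proof -
  have "fls_nth (eval_at p fls_X) n = (\<Sum>i\<le>degree p. if n = int i then coeff p i else 0)"
    by (simp add: eval_at_def fls_nth_sum fls_X_power_times_conv_shift if_distrib cong: if_cong)
  also have "\<dots> = (if n \<ge> 0 then coeff p (nat n) else 0)"
  proof (cases "n \<ge> 0")
    case True
    then have "(\<Sum>i\<le>degree p. if n = int i then coeff p i else 0) = (\<Sum>i\<le>degree p. if i = nat n then coeff p i else 0)"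
      by (intro sum.cong) auto
    then show ?thesis using True by (simp add: coeff_eq_0)
  qed (simp add: sum.neutral)
  finally show ?thesis .
qed

lemma eval_at_X_inv_nth:
  fixes p :: "'r::ring_1 poly"
  shows "fls_nth (eval_at p fls_X_inv) n = (if n \<le> 0 then coeff p (nat (- n)) else 0)"
proof -
  have "fls_nth (eval_at p fls_X_inv) n = (\<Sum>i\<le>degree p. if n = - int i then coeff p i else 0)"
    by (simp add: eval_at_def fls_nth_sum fls_X_inv_power_times_conv_shift if_distrib cong: if_cong)
      (intro sum.cong, auto)
  also have "\<dots> = (if n \<le> 0 then coeff p (nat (- n)) else 0)"
  proof (cases "n \<le> 0")
    case True
    then have "(\<Sum>i\<le>degree p. if n = - int i then coeff p i else 0) = (\<Sum>i\<le>degree p. if i = nat (- n) then coeff p i else 0)"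
      by (intro sum.cong) auto
    then show ?thesis using True by (simp add: coeff_eq_0)
  qed (simp add: sum.neutral)
  finally show ?thesis .
qed

lemma eval_at_comm:
  fixes p :: "'r::comm_ring_1 poly"
  shows "eval_at p u = poly (map_poly fls_const p) u"
proof -
  have "poly (map_poly fls_const p) u = (\<Sum>i\<le>degree p. coeff (map_poly fls_const p) i * u ^ i)"
    by (subst poly_altdef, rule sum.mono_neutral_left) (auto simp: map_poly_degree_leq coeff_eq_0)
  then show ?thesis by (simp add: eval_at_def coeff_map_poly)
qed

text \<open>Both substitutions embed the polynomials into Laurent series. Hence an equality of
  fractions at \<open>fls_X\<close> comes from a polynomial identity by cross-multiplication, and
  that identity can be evaluated at \<open>fls_X_inv\<close>.\<close>

lemma inj_comm_ring_hom_eval_at: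
  assumes "u = fls_X \<or> u = fls_X_inv"
  shows "inj_comm_ring_hom (\<lambda>p :: rat poly. eval_at p u)"
proof
  fix p q :: "rat poly"
  have const: "comm_ring_hom (fls_const :: rat \<Rightarrow> _)" by unfold_locales (auto simp: fls_plus_const)
  interpret c: map_poly_comm_ring_hom "fls_const :: rat \<Rightarrow> rat fls"
    by (simp add: map_poly_comm_ring_hom_def const)
  show "eval_at 0 u = 0" "eval_at 1 u = 1" by (simp_all add: eval_at_def)
  show "eval_at (p + q) u = eval_at p u + eval_at q u"
    and "eval_at (p * q) u = eval_at p u * eval_at q u"
    by (simp_all add: eval_at_comm c.hom_add c.hom_mult)
  show "p = 0" if "eval_at p u = 0"
  proof (rule poly_eqI)
    fix n
    show "coeff p n = coeff 0 n"
      using assms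
    proof
      assume "u = fls_X"
      then show ?thesis using arg_cong[OF that, of "\<lambda>f. fls_nth f (int n)"] by (simp add: eval_at_X_nth)
    next
      assume "u = fls_X_inv"
      then show ?thesis using arg_cong[OF that, of "\<lambda>f. fls_nth f (- int n)"] by (simp add: eval_at_X_inv_nth)
    qed
  qed
qed

lemma ratfun_value_at_inverse_unique:
  assumes "ratfun_value_at_inverse f g" "ratfun_value_at_inverse f g'"
  shows "g = g'"
proof -
  interpret X: inj_comm_ring_hom "\<lambda>p :: rat poly. eval_at p fls_X"
    by (rule inj_comm_ring_hom_eval_at) simp
  interpret Xi: inj_comm_ring_hom "\<lambda>p :: rat poly. eval_at p fls_X_inv"
    by (rule inj_comm_ring_hom_eval_at) simp
  obtain p q p' q' where q: "q \<noteq> 0" "q' \<noteq> 0"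
    and f: "fps_to_fls f = eval_at p fls_X / eval_at q fls_X" "fps_to_fls f = eval_at p' fls_X / eval_at q' fls_X"
    and g: "g = eval_at p fls_X_inv / eval_at q fls_X_inv" "g' = eval_at p' fls_X_inv / eval_at q' fls_X_inv"
    using assms unfolding ratfun_value_at_inverse_def by blast
  have "eval_at (p * q') fls_X = eval_at (p' * q) fls_X"
    using f q by (simp add: X.hom_mult frac_eq_eq)
  then have "p * q' = p' * q" by (rule X.injectivity)
  then have "eval_at p fls_X_inv * eval_at q' fls_X_inv = eval_at p' fls_X_inv * eval_at q fls_X_inv"
    by (metis Xi.hom_mult)
  then show ?thesis using g q by (simp add: frac_eq_eq)
qed

section \<open>Matrix representations of the group ring applied to resolvents\<close>

definition fls_map :: "('a::zero \<Rightarrow> 'b::zero) \<Rightarrow> 'a fls \<Rightarrow> 'b fls" where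
  "fls_map \<phi> f = Abs_fls (\<lambda>n. \<phi> (fls_nth f n))"

lemma fls_map_nth [simp]: "\<phi> 0 = 0 \<Longrightarrow> fls_nth (fls_map \<phi> f) n = \<phi> (fls_nth f n)"
  unfolding fls_map_def by (rule nth_Abs_fls_lower_bound[of "fls_subdegree f"]) simp

text \<open>Arbitrary lower bounds replace the subdegrees, because a matrix coefficient of a
  representation may annihilate leading coefficients.\<close>

lemma fls_times_nth_bounds:
  fixes f g :: "'r::semiring_0 fls"
  assumes f: "\<And>i. i < a \<Longrightarrow> fls_nth f i = 0" and g: "\<And>i. i < b \<Longrightarrow> fls_nth g i = 0"
  shows "fls_nth (f * g) n = (\<Sum>i=a..n - b. fls_nth f i * fls_nth g (n - i))"
proof -
  let ?I = "{min a (fls_subdegree f)..max (n - b) (n - fls_subdegree g)}"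
  have "fls_nth (f * g) n = (\<Sum>i\<in>?I. fls_nth f i * fls_nth g (n - i))"
    unfolding fls_times_nth(2) by (rule sum.mono_neutral_left) (auto simp: not_le)
  also have "\<dots> = (\<Sum>i=a..n - b. fls_nth f i * fls_nth g (n - i))"
    by (rule sum.mono_neutral_right) (auto simp: not_le f g)
  finally show ?thesis .
qed

lemma sum_div_mod:
  fixes F :: "nat \<Rightarrow> nat \<Rightarrow> 'a::comm_monoid_add"
  shows "(\<Sum>k=0..<n * d. F (k div d) (k mod d)) = (\<Sum>a=0..<n. \<Sum>c=0..<d. F a c)"
proof -
  have "(\<Sum>k=0..<n * d. F (k div d) (k mod d)) = (\<Sum>(a, c)\<in>{0..<n} \<times> {0..<d}. F a c)"
  proof (rule sum.reindex_bij_witness[of _ "\<lambda>(a, c). a * d + c" "\<lambda>k. (k div d, k mod d)"])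
    fix k assume k: "k \<in> {0..<n * d}"
    then have "d > 0" by (cases d) auto
    then show "(k div d, k mod d) \<in> {0..<n} \<times> {0..<d}"
      using k by (simp add: less_mult_imp_div_less)
  next
    fix x assume "x \<in> {0..<n} \<times> {0..<d}"
    then obtain a c where x: "x = (a, c)" "a < n" "c < d" by auto
    have "a * d + c < Suc a * d" using x(3) by simp
    also have "\<dots> \<le> n * d" using x(2) by (intro mult_le_mono1) simp
    finally show "(case x of (a, c) \<Rightarrow> a * d + c) \<in> {0..<n * d}" using x(1) by simp
  qed auto
  then show ?thesis by (simp add: sum.cartesian_product)
qed

text \<open>A unital algebra homomorphism from the group ring to \<open>d\<close> by
  \<open>d\<close> matrices, given by its entries so that each can be applied coefficientwise to
  Laurent series.\<close>

locale matrix_representation =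
  fixes d :: nat and \<rho> :: "nat \<Rightarrow> nat \<Rightarrow> ('w::monoid_add \<Rightarrow>\<^sub>0 rat) \<Rightarrow> rat"
  assumes rep_add: "i < d \<Longrightarrow> j < d \<Longrightarrow> \<rho> i j (x + y) = \<rho> i j x + \<rho> i j y"
    and rep_mult: "i < d \<Longrightarrow> j < d \<Longrightarrow> \<rho> i j (x * y) = (\<Sum>k=0..<d. \<rho> i k x * \<rho> k j y)"
    and rep_scalar: "i < d \<Longrightarrow> j < d \<Longrightarrow> \<rho> i j (Poly_Mapping.single 0 c) = (if i = j then c else 0)"
begin

lemma rep_zero [simp]: "i < d \<Longrightarrow> j < d \<Longrightarrow> \<rho> i j 0 = 0"
  using rep_add[of i j 0 0] by simp

lemma rep_diff: "i < d \<Longrightarrow> j < d \<Longrightarrow> \<rho> i j (x - y) = \<rho> i j x - \<rho> i j y"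
  using rep_add[of i j "x - y" y] by simp

lemma rep_one: "i < d \<Longrightarrow> j < d \<Longrightarrow> \<rho> i j 1 = (if i = j then 1 else 0)"
  using rep_scalar[of i j 1] by simp

lemma rep_sum: "i < d \<Longrightarrow> j < d \<Longrightarrow> \<rho> i j (\<Sum>a\<in>A. f a) = (\<Sum>a\<in>A. \<rho> i j (f a))"
  by (induction A rule: infinite_finite_induct) (auto simp: rep_add)

lemma fls_map_mult:
  assumes "i < d" "j < d"
  shows "fls_map (\<rho> i j) (f * g) = (\<Sum>k=0..<d. fls_map (\<rho> i k) f * fls_map (\<rho> k j) g)"
proof (rule fls_eqI)
  fix n
  let ?a = "fls_subdegree f" and ?b = "fls_subdegree g"
  have "fls_nth (fls_map (\<rho> i j) (f * g)) n = (\<Sum>l=?a..n - ?b. \<Sum>k=0..<d. \<rho> i k (fls_nth f l) * \<rho> k j (fls_nth g (n - l)))"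
    using assms by (simp add: fls_times_nth(2) rep_sum rep_mult)
  also have "\<dots> = (\<Sum>k=0..<d. \<Sum>l=?a..n - ?b. fls_nth (fls_map (\<rho> i k) f) l * fls_nth (fls_map (\<rho> k j) g) (n - l))"
    using assms by (subst sum.swap) (auto intro!: sum.cong)
  also have "\<dots> = (\<Sum>k=0..<d. fls_nth (fls_map (\<rho> i k) f * fls_map (\<rho> k j) g) n)"
    using assms by (intro sum.cong refl fls_times_nth_bounds[symmetric]) auto
  finally show "fls_nth (fls_map (\<rho> i j) (f * g)) n = fls_nth (\<Sum>k=0..<d. fls_map (\<rho> i k) f * fls_map (\<rho> k j) g) n"
    by (simp add: fls_nth_sum)
qed

lemma fls_map_sum:
  "i < d \<Longrightarrow> j < d \<Longrightarrow> fls_map (\<rho> i j) (\<Sum>a\<in>A. f a) = (\<Sum>a\<in>A. fls_map (\<rho> i j) (f a))"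
  by (rule fls_eqI) (simp add: fls_nth_sum rep_sum)

text \<open>Every entry is blown up to a \<open>d\<close> by \<open>d\<close> block;
  \<open>div\<close> locates the block and \<open>mod\<close> the place in it. The result lives over
  a field, where determinants are available.\<close>

definition flatten :: "('w \<Rightarrow>\<^sub>0 rat) fls mat \<Rightarrow> rat fls mat" where
  "flatten M = mat (dim_row M * d) (dim_col M * d)
     (\<lambda>(i, j). fls_map (\<rho> (i mod d) (j mod d)) (M $$ (i div d, j div d)))"

lemma flatten_carrier [simp]: "M \<in> carrier_mat r c \<Longrightarrow> flatten M \<in> carrier_mat (r * d) (c * d)"
  by (auto simp: flatten_def)

lemma mod_less: "i < r * d \<Longrightarrow> i mod d < d" for i r :: nat
  by (cases d) auto

lemma flatten_mult:
  assumes M: "M \<in> carrier_mat r n" and N: "N \<in> carrier_mat n c"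
  shows "flatten (M * N) = flatten M * flatten N"
proof (rule eq_matI)
  fix i j assume "i < dim_row (flatten M * flatten N)" "j < dim_col (flatten M * flatten N)"
  then have ij: "i < r * d" "j < c * d" using M N by (auto simp: flatten_def)
  note lt = ij[THEN less_mult_imp_div_less] ij[THEN mod_less]
  let ?m = "\<lambda>a k. fls_map (\<rho> (i mod d) k) (M $$ (i div d, a)) * fls_map (\<rho> k (j mod d)) (N $$ (a, j div d))"
  have "flatten (M * N) $$ (i, j) = fls_map (\<rho> (i mod d) (j mod d)) (\<Sum>a=0..<n. M $$ (i div d, a) * N $$ (a, j div d))"
    using M N ij lt by (simp add: flatten_def scalar_prod_def)
  also have "\<dots> = (\<Sum>a=0..<n. \<Sum>k=0..<d. ?m a k)"
    using lt by (simp add: fls_map_sum fls_map_mult)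
  also have "\<dots> = (\<Sum>k=0..<n * d. ?m (k div d) (k mod d))" by (rule sum_div_mod[symmetric])
  also have "\<dots> = (flatten M * flatten N) $$ (i, j)"
    using M N ij by (simp add: flatten_def scalar_prod_def)
  finally show "flatten (M * N) $$ (i, j) = (flatten M * flatten N) $$ (i, j)" .
qed (use M N in \<open>auto simp: flatten_def\<close>)

lemma flatten_one: "flatten (1\<^sub>m n) = 1\<^sub>m (n * d)"
proof (rule eq_matI)
  fix i j assume "i < dim_row (1\<^sub>m (n * d) :: rat fls mat)" "j < dim_col (1\<^sub>m (n * d) :: rat fls mat)"
  then have ij: "i < n * d" "j < n * d" by auto
  note lt = ij[THEN less_mult_imp_div_less] ij[THEN mod_less]
  have eq: "i = j \<longleftrightarrow> i div d = j div d \<and> i mod d = j mod d" by (metis mod_div_decomp)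
  show "flatten (1\<^sub>m n) $$ (i, j) = 1\<^sub>m (n * d) $$ (i, j)"
    using ij lt by (auto simp: flatten_def eq rep_one intro!: fls_eqI)
qed (auto simp: flatten_def)

lemma flatten_diff:
  assumes "M \<in> carrier_mat r c" "N \<in> carrier_mat r c"
  shows "flatten (M - N) = flatten M - flatten N"
proof (rule eq_matI)
  fix i j assume "i < dim_row (flatten M - flatten N)" "j < dim_col (flatten M - flatten N)"
  then have ij: "i < r * d" "j < c * d" using assms by (auto simp: flatten_def)
  note lt = ij[THEN less_mult_imp_div_less] ij[THEN mod_less]
  show "flatten (M - N) $$ (i, j) = (flatten M - flatten N) $$ (i, j)"
    using assms ij lt by (auto simp: flatten_def rep_diff intro!: fls_eqI)
qed (use assms in \<open>auto simp: flatten_def\<close>)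

definition flatten_poly :: "('w \<Rightarrow>\<^sub>0 rat) poly mat \<Rightarrow> rat poly mat" where
  "flatten_poly M = mat (dim_row M * d) (dim_col M * d)
     (\<lambda>(i, j). map_poly (\<rho> (i mod d) (j mod d)) (M $$ (i div d, j div d)))"

text \<open>Here \<open>u\<close> and \<open>v\<close> are the same point in Laurent series over two
  different rings. The matrix \<open>flatten_poly M\<close> does not depend on the point, which is
  what ties the value at \<open>fls_X_inv\<close> to the one at \<open>fls_X\<close>.\<close>

lemma flatten_eval_at:
  assumes u: "u = fls_X \<and> v = fls_X \<or> u = fls_X_inv \<and> v = fls_X_inv"
  shows "flatten (map_mat (\<lambda>q. eval_at q u) M) = map_mat (\<lambda>q. eval_at q v) (flatten_poly M)"
proof (rule eq_matI)
  fix i j assume "i < dim_row (map_mat (\<lambda>q. eval_at q v) (flatten_poly M))"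
    "j < dim_col (map_mat (\<lambda>q. eval_at q v) (flatten_poly M))"
  then have ij: "i < dim_row M * d" "j < dim_col M * d" by (auto simp: flatten_poly_def)
  note lt = ij[THEN less_mult_imp_div_less] ij[THEN mod_less]
  show "flatten (map_mat (\<lambda>q. eval_at q u) M) $$ (i, j) = map_mat (\<lambda>q. eval_at q v) (flatten_poly M) $$ (i, j)"
    using u ij lt 
    by (auto simp: flatten_def flatten_poly_def eval_at_X_nth eval_at_X_inv_nth coeff_map_poly intro!: fls_eqI)
qed (auto simp: flatten_def flatten_poly_def)

lemma scalar_eq_eval_at: "scalar c = eval_at [:Poly_Mapping.single 0 c:] u"
  by (simp add: scalar_def eval_at_def)

text \<open>Cramer's rule: flattening preserves the two-sided inverse, so \<open>det K\<close> is
  nonzero and the flattened resolvent is the adjugate divided by the determinant. \<open>P\<close>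
  and \<open>K\<close> are polynomial matrices defined without reference to the point, so both
  values of an expression are values of one fraction.\<close>

lemma resolvent_value_matrix_coefficient:
  assumes u: "u = fls_X \<and> v = fls_X \<or> u = fls_X_inv \<and> v = fls_X_inv"
    and C: "C \<in> carrier_mat 1 n" and Q: "Q \<in> carrier_mat n n" and B: "B \<in> carrier_mat n 1"
    and res: "resolvent_value C (map_mat (\<lambda>q. eval_at q u) Q) B g"
    and ij: "i < d" "j < d"
  defines "K \<equiv> 1\<^sub>m (n * d) - flatten_poly Q"
  defines "P \<equiv> flatten_poly (map_mat (\<lambda>c. [:Poly_Mapping.single 0 c:]) C) * adj_mat K *
    flatten_poly (map_mat (\<lambda>c. [:Poly_Mapping.single 0 c:]) B)"
  shows "det K \<noteq> 0" "fls_map (\<rho> i j) g = eval_at (P $$ (i, j)) v / eval_at (det K) v"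
proof -
  interpret h: inj_comm_ring_hom "\<lambda>p :: rat poly. eval_at p v"
    by (rule inj_comm_ring_hom_eval_at) (use u in auto)
  let ?h = "map_mat (\<lambda>p :: rat poly. eval_at p v)"
  let ?M = "map_mat (\<lambda>q. eval_at q u) Q"
  let ?C = "map_mat (\<lambda>c. [:Poly_Mapping.single 0 c:]) C" and ?B = "map_mat (\<lambda>c. [:Poly_Mapping.single 0 c:]) B"
  obtain N where N: "N \<in> carrier_mat n n" and inv: "(1\<^sub>m n - ?M) * N = 1\<^sub>m n" "N * (1\<^sub>m n - ?M) = 1\<^sub>m n"
    and val: "map_mat scalar C * N * map_mat scalar B = mat 1 1 (\<lambda>_. g)"
    using res Q unfolding resolvent_value_def inverts_mat_def by auto
  have [simp]: "flatten_poly Q \<in> carrier_mat (n * d) (n * d)" "flatten_poly ?C \<in> carrier_mat d (n * d)"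
    "flatten_poly ?B \<in> carrier_mat (n * d) d"
    using Q C B by (auto simp: flatten_poly_def)
  have K: "K \<in> carrier_mat (n * d) (n * d)" unfolding K_def by (intro minus_carrier_mat) simp
  have hK: "?h K = flatten (1\<^sub>m n - ?M)"
  proof -
    have "flatten (1\<^sub>m n - ?M) = 1\<^sub>m (n * d) - ?h (flatten_poly Q)"
      using Q by (simp add: flatten_diff[of _ n n] flatten_one flatten_eval_at[OF u])
    also have "\<dots> = ?h K"
      unfolding K_def by (rule eq_matI) (use Q in \<open>auto simp: flatten_poly_def h.hom_minus\<close>)
    finally show ?thesis ..
  qed
  let ?N = "flatten N"
  have NK: "?N * ?h K = 1\<^sub>m (n * d)"
  proof -
    have "1\<^sub>m n - ?M \<in> carrier_mat n n" using Q by (intro minus_carrier_mat) simp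
    then show ?thesis unfolding hK using flatten_mult[OF N, of "1\<^sub>m n - ?M" n] inv(2) flatten_one by simp
  qed
  have fN: "?N \<in> carrier_mat (n * d) (n * d)" using N by simp
  have "det ?N * det (?h K) = 1"
    using det_mult[OF fN, of "?h K"] K NK by simp
  then show det: "det K \<noteq> 0" by (auto simp: h.hom_det)
  have adj: "?h (adj_mat K) = eval_at (det K) v \<cdot>\<^sub>m ?N"
  proof -
    have aK: "adj_mat K \<in> carrier_mat (n * d) (n * d)" "K * adj_mat K = det K \<cdot>\<^sub>m 1\<^sub>m (n * d)"
      using adj_mat[OF K] by auto
    have "?h (adj_mat K) = ?N * ?h K * ?h (adj_mat K)" using NK aK by simp
    also have "\<dots> = ?N * (?h K * ?h (adj_mat K))" using fN K aK by (intro assoc_mult_mat) auto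
    also have "?h K * ?h (adj_mat K) = ?h (det K \<cdot>\<^sub>m 1\<^sub>m (n * d))"
      using aK K by (simp flip: h.mat_hom_mult)
    also have "\<dots> = eval_at (det K) v \<cdot>\<^sub>m 1\<^sub>m (n * d)"
      by (rule eq_matI) (auto simp: h.hom_mult)
    also have "?N * \<dots> = eval_at (det K) v \<cdot>\<^sub>m ?N"
      using fN by (subst mult_smult_distrib[OF fN]) auto
    finally show ?thesis .
  qed
  have sc: "flatten (map_mat scalar C) = ?h (flatten_poly ?C)" "flatten (map_mat scalar B) = ?h (flatten_poly ?B)"
  proof -
    have "map_mat scalar A = map_mat (\<lambda>q. eval_at q u) (map_mat (\<lambda>c. [:Poly_Mapping.single 0 c:]) A)" for A
      by (rule eq_matI) (auto simp: scalar_eq_eval_at)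
    then show "flatten (map_mat scalar C) = ?h (flatten_poly ?C)" "flatten (map_mat scalar B) = ?h (flatten_poly ?B)"
      by (simp_all add: flatten_eval_at[OF u])
  qed
  have aK: "adj_mat K \<in> carrier_mat (n * d) (n * d)" using adj_mat[OF K] by auto
  define FC where "FC = flatten_poly ?C"
  define FB where "FB = flatten_poly ?B"
  have FC: "FC \<in> carrier_mat d (n * d)" and FB: "FB \<in> carrier_mat (n * d) d" by (simp_all add: FC_def FB_def)
  have hF: "?h FC \<in> carrier_mat d (n * d)" "?h FB \<in> carrier_mat (n * d) d" using FC FB by simp_all
  have "?h P = ?h (FC * adj_mat K) * ?h FB"
    unfolding P_def FC_def[symmetric] FB_def[symmetric] using FC FB aK
    by (intro h.mat_hom_mult[of _ d "n * d" _ d]) auto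
  also have "?h (FC * adj_mat K) = ?h FC * (eval_at (det K) v \<cdot>\<^sub>m ?N)"
    unfolding adj[symmetric] by (rule h.mat_hom_mult[OF FC aK])
  also have "\<dots> = eval_at (det K) v \<cdot>\<^sub>m (?h FC * ?N)"
    using hF fN by (intro mult_smult_distrib) auto
  also have "\<dots> * ?h FB = eval_at (det K) v \<cdot>\<^sub>m (?h FC * ?N * ?h FB)"
    using hF fN by (intro mult_smult_assoc_mat) auto
  also have "?h FC * ?N * ?h FB = flatten (mat 1 1 (\<lambda>_. g))"
    using flatten_mult[of "map_mat scalar C" 1 n N n] flatten_mult[of "map_mat scalar C * N" 1 n "map_mat scalar B" 1]
      C N B by (simp add: val sc FC_def FB_def)
  finally have "?h P $$ (i, j) = (eval_at (det K) v \<cdot>\<^sub>m flatten (mat 1 1 (\<lambda>_. g))) $$ (i, j)" by simp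
  moreover have "P \<in> carrier_mat d d" unfolding P_def using aK by (intro mult_carrier_mat) auto
  ultimately have "eval_at (P $$ (i, j)) v = eval_at (det K) v * fls_map (\<rho> i j) g"
    using ij by (simp add: flatten_def)
  then show "fls_map (\<rho> i j) g = eval_at (P $$ (i, j)) v / eval_at (det K) v"
    using det by simp
qed

lemma value_at_inverse_matrix_coefficient:
  assumes "value_at_inverse f g" and ij: "i < d" "j < d"
  shows "ratfun_value_at_inverse (Abs_fps (\<lambda>n. \<rho> i j (fps_nth f n))) (fls_map (\<rho> i j) g)"
proof -
  obtain n C Q B where C: "C \<in> carrier_mat 1 n" and Q: "Q \<in> carrier_mat n n" and B: "B \<in> carrier_mat n 1"
    and f: "resolvent_value C (map_mat (\<lambda>q. eval_at q fls_X) Q) B (fps_to_fls f)"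
    and g: "resolvent_value C (map_mat (\<lambda>q. eval_at q fls_X_inv) Q) B g"
    using assms(1) unfolding value_at_inverse_def by blast
  have "fps_to_fls (Abs_fps (\<lambda>n. \<rho> i j (fps_nth f n))) = fls_map (\<rho> i j) (fps_to_fls f)"
    using ij by (intro fls_eqI) (simp split: if_splits)
  then show ?thesis
    unfolding ratfun_value_at_inverse_def
    using resolvent_value_matrix_coefficient[OF _ C Q B f ij, of fls_X]
      resolvent_value_matrix_coefficient[OF _ C Q B g ij, of fls_X_inv] by auto
qed

end

section \<open>Permutation representations\<close>

text \<open>An entry of the permutation matrix of \<open>r\<close>. Rows are indexed by the source,
  so a right action yields a homomorphism without reversing products.\<close>

definition transition_coeff :: "('w \<Rightarrow> 'x \<Rightarrow> 'x) \<Rightarrow> 'x \<Rightarrow> 'x \<Rightarrow> ('w::monoid_add \<Rightarrow>\<^sub>0 rat) \<Rightarrow> rat" where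
  "transition_coeff \<alpha> a b r = (\<Sum>w\<in>Poly_Mapping.keys r. if \<alpha> w a = b then Poly_Mapping.lookup r w else 0)"

lemma transition_coeff_superset:
  "finite A \<Longrightarrow> Poly_Mapping.keys r \<subseteq> A \<Longrightarrow>
    transition_coeff \<alpha> a b r = (\<Sum>w\<in>A. if \<alpha> w a = b then Poly_Mapping.lookup r w else 0)"
  unfolding transition_coeff_def by (rule sum.mono_neutral_left) (auto simp: in_keys_iff)

lemma transition_coeff_add:
  "transition_coeff \<alpha> a b (r + s) = transition_coeff \<alpha> a b r + transition_coeff \<alpha> a b s"
proof -
  let ?A = "Poly_Mapping.keys r \<union> Poly_Mapping.keys s"
  have "transition_coeff \<alpha> a b x = (\<Sum>w\<in>?A. if \<alpha> w a = b then Poly_Mapping.lookup x w else 0)" if "Poly_Mapping.keys x \<subseteq> ?A" for x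
    using that by (intro transition_coeff_superset) auto
  then show ?thesis
    using keys_add[of r s] by (auto simp: lookup_add simp flip: sum.distrib intro!: sum.cong)
qed

lemma transition_coeff_single:
  "transition_coeff \<alpha> a b (Poly_Mapping.single w c) = (if \<alpha> w a = b then c else 0)"
  by (subst transition_coeff_superset[of "{w}"]) auto

lemma transition_coeff_sum:
  "transition_coeff \<alpha> a b (\<Sum>i\<in>I. f i) = (\<Sum>i\<in>I. transition_coeff \<alpha> a b (f i))"
proof (induction I rule: infinite_finite_induct)
  case (insert i I)
  then show ?case by (simp add: transition_coeff_add)
qed (simp_all add: transition_coeff_def)

lemma poly_mapping_sum_single: "(\<Sum>w\<in>Poly_Mapping.keys r. Poly_Mapping.single w (Poly_Mapping.lookup r w)) = r"
  by (rule poly_mapping_eqI) (auto simp: lookup_sum lookup_single when_def in_keys_iff)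

lemma transition_coeff_mult:
  assumes \<alpha>: "\<And>v w. \<alpha> (v + w) a = \<alpha> w (\<alpha> v a)" and X: "finite X" "\<And>w. \<alpha> w a \<in> X"
  shows "transition_coeff \<alpha> a b (r * s) = (\<Sum>c\<in>X. transition_coeff \<alpha> a c r * transition_coeff \<alpha> c b s)"
proof -
  let ?s = "\<lambda>x w. Poly_Mapping.single w (Poly_Mapping.lookup x w)"
  have prod: "transition_coeff \<alpha> a b (?s r v * ?s s w) =
    (\<Sum>c\<in>X. (if \<alpha> v a = c then Poly_Mapping.lookup r v else 0) * (if \<alpha> w c = b then Poly_Mapping.lookup s w else 0))" for v w
  proof -
    have "(\<Sum>c\<in>X. (if \<alpha> v a = c then Poly_Mapping.lookup r v else 0) * (if \<alpha> w c = b then Poly_Mapping.lookup s w else 0)) =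
      (\<Sum>c\<in>X. if c = \<alpha> v a then Poly_Mapping.lookup r v * (if \<alpha> w c = b then Poly_Mapping.lookup s w else 0) else 0)"
      by (intro sum.cong) auto
    then show ?thesis using X by (simp add: mult_single transition_coeff_single \<alpha>)
  qed
  have "transition_coeff \<alpha> a b (r * s) = transition_coeff \<alpha> a b
    ((\<Sum>v\<in>Poly_Mapping.keys r. ?s r v) * (\<Sum>w\<in>Poly_Mapping.keys s. ?s s w))"
    by (simp add: poly_mapping_sum_single)
  also have "\<dots> = (\<Sum>v\<in>Poly_Mapping.keys r. \<Sum>w\<in>Poly_Mapping.keys s. \<Sum>c\<in>X.
      (if \<alpha> v a = c then Poly_Mapping.lookup r v else 0) * (if \<alpha> w c = b then Poly_Mapping.lookup s w else 0))"
    by (simp add: sum_product transition_coeff_sum prod)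
  also have "\<dots> = (\<Sum>v\<in>Poly_Mapping.keys r. \<Sum>c\<in>X. \<Sum>w\<in>Poly_Mapping.keys s.
      (if \<alpha> v a = c then Poly_Mapping.lookup r v else 0) * (if \<alpha> w c = b then Poly_Mapping.lookup s w else 0))"
    by (intro sum.cong refl sum.swap)
  also have "\<dots> = (\<Sum>c\<in>X. \<Sum>v\<in>Poly_Mapping.keys r. \<Sum>w\<in>Poly_Mapping.keys s.
      (if \<alpha> v a = c then Poly_Mapping.lookup r v else 0) * (if \<alpha> w c = b then Poly_Mapping.lookup s w else 0))"
    by (rule sum.swap)
  also have "\<dots> = (\<Sum>c\<in>X. transition_coeff \<alpha> a c r * transition_coeff \<alpha> c b s)"
    by (simp only: transition_coeff_def sum_product)
  finally show ?thesis .
qed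

lemma value_at_inverse_transition_coeff:
  assumes X: "finite X" "\<And>w x. x \<in> X \<Longrightarrow> \<alpha> w x \<in> X"
    and \<alpha>: "\<And>v w x. x \<in> X \<Longrightarrow> \<alpha> (v + w) x = \<alpha> w (\<alpha> v x)" "\<And>x. x \<in> X \<Longrightarrow> \<alpha> 0 x = x"
    and ab: "a \<in> X" "b \<in> X" and "value_at_inverse f g"
  shows "ratfun_value_at_inverse (Abs_fps (\<lambda>n. transition_coeff \<alpha> a b (fps_nth f n))) (fls_map (transition_coeff \<alpha> a b) g)"
proof -
  obtain e where e: "bij_betw e {0..<card X} X" using ex_bij_betw_nat_finite[OF X(1)] by blast
  have eX: "e i \<in> X" if "i < card X" for i using e that by (auto simp: bij_betw_def)
  interpret matrix_representation "card X" "\<lambda>i j. transition_coeff \<alpha> (e i) (e j)"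
  proof
    fix i j x y assume ij: "i < card X" "j < card X"
    show "transition_coeff \<alpha> (e i) (e j) (x * y) =
      (\<Sum>k=0..<card X. transition_coeff \<alpha> (e i) (e k) x * transition_coeff \<alpha> (e k) (e j) y)"
      unfolding transition_coeff_mult[OF \<alpha>(1)[OF eX[OF ij(1)]] X(1) X(2)[OF eX[OF ij(1)]]]
      by (rule sum.reindex_bij_betw[OF e, symmetric])
  next
    fix i j c assume ij: "i < card X" "j < card X"
    then have "e i = e j \<longleftrightarrow> i = j" using e by (auto simp: bij_betw_def inj_on_def)
    then show "transition_coeff \<alpha> (e i) (e j) (Poly_Mapping.single 0 c) = (if i = j then c else 0)"
      using \<alpha>(2)[OF eX[OF ij(1)]] by (simp add: transition_coeff_single)
  qed (simp add: transition_coeff_add)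
  have "a \<in> e ` {0..<card X}" "b \<in> e ` {0..<card X}" using e ab by (simp_all add: bij_betw_def)
  then obtain i j where ij: "i < card X" "e i = a" "j < card X" "e j = b" by auto
  then show ?thesis using value_at_inverse_matrix_coefficient[OF assms(7) ij(1,3)] by simp
qed

section \<open>Resolvents of constant matrices\<close>

definition coeff_series_mat :: "nat \<Rightarrow> (nat \<Rightarrow> 'r::ring_1 mat) \<Rightarrow> 'r fls mat" where
  "coeff_series_mat n c = mat n n (\<lambda>(i, j). fps_to_fls (Abs_fps (\<lambda>k. c k $$ (i, j))))"

lemma coeff_series_mat_carrier [simp]: "coeff_series_mat n c \<in> carrier_mat n n"
  by (simp add: coeff_series_mat_def)

lemma coeff_series_mat_nth:
  "i < n \<Longrightarrow> j < n \<Longrightarrow> fls_nth (coeff_series_mat n c $$ (i, j)) r = (if r < 0 then 0 else c (nat r) $$ (i, j))"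
  by (simp add: coeff_series_mat_def)

lemma fls_nth_const_X_mult:
  fixes f :: "'r::ring_1 fls"
  assumes "u = fls_X \<and> s = 1 \<or> u = fls_X_inv \<and> s = - 1"
  shows "fls_nth (fls_const a * u * f) r = a * fls_nth f (r - s)"
    and "fls_nth (f * (fls_const a * u)) r = fls_nth f (r - s) * a"
proof -
  have comm: "f * (fls_const a * u) = (f * fls_const a) * u" by (simp add: mult.assoc)
  show "fls_nth (fls_const a * u * f) r = a * fls_nth f (r - s)"
    using assms by (auto simp: mult.assoc fls_X_times_conv_shift(1) fls_X_inv_times_conv_shift(1))
  show "fls_nth (f * (fls_const a * u)) r = fls_nth f (r - s) * a"
    unfolding comm using assms by (auto simp: fls_X_times_conv_shift(2) fls_X_inv_times_conv_shift(2))
qed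

text \<open>Turns both equations for an inverse into recursions for coefficients. The shift
  \<open>s\<close> treats the indeterminate and its inverse together.\<close>

lemma resolvent_mult_nth:
  fixes M :: "'r::ring_1 mat"
  assumes u: "u = fls_X \<and> s = 1 \<or> u = fls_X_inv \<and> s = - 1"
    and M: "M \<in> carrier_mat n n" and N: "N \<in> carrier_mat n n" and ij: "i < n" "j < n"
  defines "U \<equiv> map_mat (\<lambda>a. fls_const a * u) M"
  shows "fls_nth (((1\<^sub>m n - U) * N) $$ (i, j)) r =
      fls_nth (N $$ (i, j)) r - (\<Sum>l=0..<n. M $$ (i, l) * fls_nth (N $$ (l, j)) (r - s))"
    and "fls_nth ((N * (1\<^sub>m n - U)) $$ (i, j)) r =
      fls_nth (N $$ (i, j)) r - (\<Sum>l=0..<n. fls_nth (N $$ (i, l)) (r - s) * M $$ (l, j))"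
proof -
  have U: "U \<in> carrier_mat n n" using M by (simp add: U_def)
  have "(1\<^sub>m n - U) * N = N - U * N" "N * (1\<^sub>m n - U) = N - N * U"
    using U N minus_mult_distrib_mat[OF _ U N, of "1\<^sub>m n"] mult_minus_distrib_mat[OF N _ U, of "1\<^sub>m n"]
    by simp_all
  then show "fls_nth (((1\<^sub>m n - U) * N) $$ (i, j)) r =
      fls_nth (N $$ (i, j)) r - (\<Sum>l=0..<n. M $$ (i, l) * fls_nth (N $$ (l, j)) (r - s))"
    "fls_nth ((N * (1\<^sub>m n - U)) $$ (i, j)) r =
      fls_nth (N $$ (i, j)) r - (\<Sum>l=0..<n. fls_nth (N $$ (i, l)) (r - s) * M $$ (l, j))"
    using ij M N fls_nth_const_X_mult[OF u] by (simp_all add: U_def scalar_prod_def fls_nth_sum)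
qed

lemma pow_mat_Suc_left:
  assumes "A \<in> carrier_mat n n"
  shows "A ^\<^sub>m Suc k = A * A ^\<^sub>m k"
  using assms
proof (induction k)
  case (Suc k)
  then have "A ^\<^sub>m Suc (Suc k) = (A * A ^\<^sub>m k) * A" by simp
  also have "\<dots> = A * (A ^\<^sub>m k * A)" using Suc.prems by (intro assoc_mult_mat) auto
  finally show ?case by simp
qed simp

lemma mat_mult_nth:
  "A \<in> carrier_mat n n \<Longrightarrow> B \<in> carrier_mat n n \<Longrightarrow> i < n \<Longrightarrow> j < n \<Longrightarrow>
    (A * B) $$ (i, j) = (\<Sum>l=0..<n. A $$ (i, l) * B $$ (l, j))"
  by (simp add: scalar_prod_def)

lemma one_mat_fls_nth:
  "i < n \<Longrightarrow> j < n \<Longrightarrow> fls_nth (1\<^sub>m n $$ (i, j)) r = (if r = 0 then 1\<^sub>m n $$ (i, j) else 0)"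
  by simp

lemma resolvent_at_X:
  fixes M :: "'r::ring_1 mat"
  assumes M: "M \<in> carrier_mat n n"
  defines "U \<equiv> map_mat (\<lambda>a. fls_const a * fls_X) M" and "N \<equiv> coeff_series_mat n (\<lambda>k. M ^\<^sub>m k)"
  shows "(1\<^sub>m n - U) * N = 1\<^sub>m n" "N * (1\<^sub>m n - U) = 1\<^sub>m n"
proof -
  have N: "N \<in> carrier_mat n n" by (simp add: N_def)
  have pow: "M ^\<^sub>m k \<in> carrier_mat n n" for k using M by simp
  have u: "(fls_X :: 'r fls) = fls_X \<and> (1 :: int) = 1 \<or> fls_X = (fls_X_inv :: 'r fls) \<and> (1 :: int) = - 1" by simp
  have L: "fls_nth (((1\<^sub>m n - U) * N) $$ (i, j)) r = fls_nth (1\<^sub>m n $$ (i, j)) r" 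
    and R: "fls_nth ((N * (1\<^sub>m n - U)) $$ (i, j)) r = fls_nth (1\<^sub>m n $$ (i, j)) r"
    if ij: "i < n" "j < n" for i j r
  proof -
    consider "r < 0" | "r = 0" | k where "r = int (Suc k)" by (metis int_cases3 not_gr_zero of_nat_0 gr0_conv_Suc neg_less_0_iff_less of_nat_0_less_iff)
    note cases = this
    note eqs = resolvent_mult_nth[OF u M N ij, folded U_def] one_mat_fls_nth[OF ij]
    have Nn: "fls_nth (N $$ (a, b)) r = (if r < 0 then 0 else (M ^\<^sub>m nat r) $$ (a, b))" if "a < n" "b < n" for a b r
      using that by (simp add: N_def coeff_series_mat_nth)
    show "fls_nth (((1\<^sub>m n - U) * N) $$ (i, j)) r = fls_nth (1\<^sub>m n $$ (i, j)) r"
      using cases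
    proof cases
      case (3 k)
      have "(M ^\<^sub>m Suc k) $$ (i, j) = (\<Sum>l=0..<n. M $$ (i, l) * (M ^\<^sub>m k) $$ (l, j))"
        unfolding pow_mat_Suc_left[OF M] by (rule mat_mult_nth[OF M pow ij])
      then show ?thesis
        using ij 3 by (simp add: eqs Nn nat_add_distrib del: pow_mat.simps)
    qed (use ij M in \<open>simp_all add: eqs Nn\<close>)
    show "fls_nth ((N * (1\<^sub>m n - U)) $$ (i, j)) r = fls_nth (1\<^sub>m n $$ (i, j)) r"
      using cases
    proof cases
      case (3 k)
      have "(M ^\<^sub>m Suc k) $$ (i, j) = (\<Sum>l=0..<n. (M ^\<^sub>m k) $$ (i, l) * M $$ (l, j))"
        unfolding pow_mat.simps by (rule mat_mult_nth[OF pow M ij])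
      then show ?thesis
        using ij 3 by (simp add: eqs Nn nat_add_distrib del: pow_mat.simps)
    qed (use ij M in \<open>simp_all add: eqs Nn\<close>)
  qed
  have U: "U \<in> carrier_mat n n" using M by (simp add: U_def)
  show "(1\<^sub>m n - U) * N = 1\<^sub>m n" by (rule eq_matI) (use L U N in \<open>auto intro!: fls_eqI simp del: index_mult_mat(1) index_one_mat(1)\<close>)
  show "N * (1\<^sub>m n - U) = 1\<^sub>m n" by (rule eq_matI) (use R U N in \<open>auto intro!: fls_eqI simp del: index_mult_mat(1) index_one_mat(1)\<close>)
qed

text \<open>
  \<open>M\<close> need not be invertible: \<open>G\<close> is a group inverse, and \<open>1 - M G\<close> is the projection to the kernel
  of \<open>M\<close> along its image.
\<close>

lemma resolvent_at_X_inv: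
  fixes M G :: "'r::ring_1 mat"
  assumes M: "M \<in> carrier_mat n n" and G: "G \<in> carrier_mat n n"
    and comm: "G * M = M * G" and MGM: "M * G * M = M" and GMG: "G * (M * G) = G"
  defines "U \<equiv> map_mat (\<lambda>a. fls_const a * fls_X_inv) M"
    and "N \<equiv> coeff_series_mat n (\<lambda>k. if k = 0 then 1\<^sub>m n - M * G else - (G ^\<^sub>m k))"
  shows "(1\<^sub>m n - U) * N = 1\<^sub>m n" "N * (1\<^sub>m n - U) = 1\<^sub>m n"
proof -
  \<comment> \<open>On the image of \<open>M\<close>, where \<open>G\<close> inverts
    \<open>M\<close>, the resolvent expands into minus the geometric series of \<open>G\<close>
    times \<open>t\<close>, starting at exponent 1. On the kernel of \<open>M\<close> the resolvent
    is the identity, which contributes the projection at exponent 0.\<close>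
  let ?c = "\<lambda>k. if k = 0 then 1\<^sub>m n - M * G else - (G ^\<^sub>m k)"
  have N: "N \<in> carrier_mat n n" by (simp add: N_def)
  have J: "M * G \<in> carrier_mat n n" using M G by simp
  have c: "?c k \<in> carrier_mat n n" for k using M G by (simp add: minus_carrier_mat)
  have pow: "G ^\<^sub>m k \<in> carrier_mat n n" for k using G by simp
  have u: "(fls_X_inv :: 'r fls) = fls_X \<and> (- 1 :: int) = 1 \<or> fls_X_inv = (fls_X_inv :: 'r fls) \<and> (- 1 :: int) = - 1" by simp
  have Mc0: "M * ?c 0 = 0\<^sub>m n n"
  proof -
    have "M * (M * G) = M * (G * M)" by (simp only: comm)
    also have "\<dots> = M" using assoc_mult_mat[OF M G M] MGM by simp
    finally show ?thesis using mult_minus_distrib_mat[OF M _ J, of "1\<^sub>m n"] M by simp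
  qed
  have c0M: "?c 0 * M = 0\<^sub>m n n"
    using minus_mult_distrib_mat[OF _ J M, of "1\<^sub>m n"] M MGM by simp
  have Mc1: "M * ?c 1 = - (M * G)" "?c 1 * M = - (M * G)" using M G comm by simp_all
  have Mc: "M * ?c (Suc (Suc k)) = ?c (Suc k)" for k
  proof -
    have "M * G ^\<^sub>m Suc (Suc k) = M * (G * (G * G ^\<^sub>m k))" by (simp only: pow_mat_Suc_left[OF G])
    also have "\<dots> = M * ((G * G) * G ^\<^sub>m k)" using assoc_mult_mat[OF G G pow] by simp
    also have "\<dots> = (M * (G * G)) * G ^\<^sub>m k" using G M pow by (intro assoc_mult_mat[symmetric]) auto
    also have "M * (G * G) = (M * G) * G" using assoc_mult_mat[OF M G G] by simp
    also have "\<dots> = G * M * G" by (simp only: comm)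
    also have "\<dots> = G" using assoc_mult_mat[OF G M G] GMG by simp
    finally have "M * G ^\<^sub>m Suc (Suc k) = G ^\<^sub>m Suc k" by (simp only: pow_mat_Suc_left[OF G])
    then show ?thesis
      using M carrier_matD[OF pow[of "Suc (Suc k)"]] by (simp del: pow_mat.simps)
  qed
  have cM: "?c (Suc (Suc k)) * M = ?c (Suc k)" for k
  proof -
    have "G ^\<^sub>m Suc (Suc k) * M = (G ^\<^sub>m k * (G * G)) * M" using assoc_mult_mat[OF pow G G] by simp
    also have "\<dots> = G ^\<^sub>m k * ((G * G) * M)" using G M pow by (intro assoc_mult_mat) auto
    also have "(G * G) * M = G * (M * G)" using assoc_mult_mat[OF G G M] comm by simp
    finally have "G ^\<^sub>m Suc (Suc k) * M = G ^\<^sub>m Suc k" by (simp add: GMG)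
    then show ?thesis
      using M carrier_matD[OF pow[of "Suc (Suc k)"]] by (simp del: pow_mat.simps)
  qed
  \<comment> \<open>These are the coefficients of the two products at exponents from 0 on. The only
    other one that could be nonzero sits at exponent -1 and vanishes by \<open>Mc0\<close> and
    \<open>c0M\<close>.\<close>
  have key: "?c k - M * ?c (Suc k) = (if k = 0 then 1\<^sub>m n else 0\<^sub>m n n)" 
    "?c k - ?c (Suc k) * M = (if k = 0 then 1\<^sub>m n else 0\<^sub>m n n)" for k
  proof -
    have c0: "?c 0 - (- (M * G)) = 1\<^sub>m n"
      using M G by (intro eq_matI) auto
    have diff: "A - A = 0\<^sub>m n n" if "A \<in> carrier_mat n n" for A :: "'r mat"
      using that by (intro eq_matI) auto
    show "?c k - M * ?c (Suc k) = (if k = 0 then 1\<^sub>m n else 0\<^sub>m n n)"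
      using c0 Mc1(1) Mc diff[OF c, of k] by (cases k) (simp_all del: pow_mat.simps)
    show "?c k - ?c (Suc k) * M = (if k = 0 then 1\<^sub>m n else 0\<^sub>m n n)"
      using c0 Mc1(2) cM diff[OF c, of k] by (cases k) (simp_all del: pow_mat.simps)
  qed
  have L: "fls_nth (((1\<^sub>m n - U) * N) $$ (i, j)) r = fls_nth (1\<^sub>m n $$ (i, j)) r"
    and R: "fls_nth ((N * (1\<^sub>m n - U)) $$ (i, j)) r = fls_nth (1\<^sub>m n $$ (i, j)) r"
    if ij: "i < n" "j < n" for i j r
  proof -
    consider "r < - 1" | "r = - 1" | k where "r = int k" by (metis int_cases int_one_le_iff_zero_less minus_less_iff linorder_neqE_linordered_idom nonneg_int_cases not_le zle_diff1_eq diff_0)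
    note cases = this
    note eqs = resolvent_mult_nth[OF u M N ij, folded U_def] one_mat_fls_nth[OF ij]
    have Nn: "fls_nth (N $$ (a, b)) r = (if r < 0 then 0 else ?c (nat r) $$ (a, b))" if "a < n" "b < n" for a b r
      using that by (simp add: N_def coeff_series_mat_nth)
    have Mn: "(\<Sum>l=0..<n. M $$ (i, l) * ?c k $$ (l, j)) = (M * ?c k) $$ (i, j)"
      "(\<Sum>l=0..<n. ?c k $$ (i, l) * M $$ (l, j)) = (?c k * M) $$ (i, j)" for k
      using mat_mult_nth[OF M c ij, of k] mat_mult_nth[OF c M ij, of k] by simp_all
    have sub: "(A - B) $$ (i, j) = A $$ (i, j) - B $$ (i, j)" if "B \<in> carrier_mat n n" for A B :: "'r mat"
      using that ij by simp
    show "fls_nth (((1\<^sub>m n - U) * N) $$ (i, j)) r = fls_nth (1\<^sub>m n $$ (i, j)) r"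
      using cases
    proof cases
      case 2
      then show ?thesis using ij Mn(1)[of 0] Mc0 by (simp add: eqs Nn)
    next
      case (3 k)
      have "?c k $$ (i, j) - (M * ?c (Suc k)) $$ (i, j) = (if k = 0 then 1\<^sub>m n else 0\<^sub>m n n) $$ (i, j)"
        using arg_cong[OF key(1)[of k], of "\<lambda>A. A $$ (i, j)"] sub[of "M * ?c (Suc k)" "?c k"] M c[of "Suc k"] by simp
      then show ?thesis
        using ij 3 Mn(1)[of "Suc k"] by (cases k) (simp_all add: eqs Nn nat_add_distrib del: pow_mat.simps split: if_splits)
    qed (use ij in \<open>simp add: eqs Nn\<close>)
    show "fls_nth ((N * (1\<^sub>m n - U)) $$ (i, j)) r = fls_nth (1\<^sub>m n $$ (i, j)) r"
      using cases
    proof cases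
      case 2
      then show ?thesis using ij Mn(2)[of 0] c0M by (simp add: eqs Nn)
    next
      case (3 k)
      have "?c k $$ (i, j) - (?c (Suc k) * M) $$ (i, j) = (if k = 0 then 1\<^sub>m n else 0\<^sub>m n n) $$ (i, j)"
        using arg_cong[OF key(2)[of k], of "\<lambda>A. A $$ (i, j)"] sub[of "?c (Suc k) * M" "?c k"] M c[of "Suc k"] by simp
      then show ?thesis
        using ij 3 Mn(2)[of "Suc k"] by (cases k) (simp_all add: eqs Nn nat_add_distrib del: pow_mat.simps split: if_splits)
    qed (use ij in \<open>simp add: eqs Nn\<close>)
  qed
  have U: "U \<in> carrier_mat n n" using M by (simp add: U_def)
  show "(1\<^sub>m n - U) * N = 1\<^sub>m n" by (rule eq_matI) (use L U N in \<open>auto intro!: fls_eqI simp del: index_mult_mat(1) index_one_mat(1)\<close>)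
  show "N * (1\<^sub>m n - U) = 1\<^sub>m n" by (rule eq_matI) (use R U N in \<open>auto intro!: fls_eqI simp del: index_mult_mat(1) index_one_mat(1)\<close>)
qed

section \<open>Reciprocity\<close>

lemma scalar_mult_nth: "fls_nth (scalar c * f) r = Poly_Mapping.single 0 c * fls_nth f r"
  by (simp add: scalar_def)

lemma mult_scalar_one: "f * scalar 1 = f"
  by (simp add: scalar_def)

context right_angled_coxeter begin

text \<open>To compare the coefficients of \<open>w\<close>, a finite permutation representation is
  chosen that separates \<open>w\<close> from the finitely many elements in the two supports. Its
  entry from the empty heap to the image under \<open>w\<close> then reads off exactly the
  coefficient of \<open>w\<close>.\<close>

lemma value_at_inverse_unique:
  assumes "value_at_inverse f g" "value_at_inverse f g'"
  shows "g = (g' :: ('w \<Rightarrow>\<^sub>0 rat) fls)"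
proof (rule fls_eqI, rule poly_mapping_eqI)
  fix r w
  let ?x = "fls_nth g r" and ?y = "fls_nth g' r"
  let ?A = "insert w (Poly_Mapping.keys ?x \<union> Poly_Mapping.keys ?y)"
  obtain N where inj: "inj_on (\<lambda>w. act (toggle (enat N)) w {}) ?A"
    using residually_finite[of ?A] by auto
  let ?\<alpha> = "act (toggle (enat N))"
  let ?\<phi> = "transition_coeff ?\<alpha> {} (?\<alpha> w {})"
  have val: "ratfun_value_at_inverse (Abs_fps (\<lambda>n. ?\<phi> (fps_nth f n))) (fls_map ?\<phi> h)"
    if "value_at_inverse f h" for h
  proof (rule value_at_inverse_transition_coeff[where X = "Pow ({..<N} \<times> S)"])
    show "?\<alpha> v H \<in> Pow ({..<N} \<times> S)" if "H \<in> Pow ({..<N} \<times> S)" for v H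
      using act_toggle_closed[of H N v] that by blast
    show "?\<alpha> w {} \<in> Pow ({..<N} \<times> S)" using act_toggle_closed[of "{}" N w] by blast
    show "value_at_inverse f h" by (rule that)
  qed (simp_all add: finite_S act_toggle_add act_toggle_zero)
  have "fls_map ?\<phi> g = fls_map ?\<phi> g'"
    by (rule ratfun_value_at_inverse_unique[OF val[OF assms(1)] val[OF assms(2)]])
  then have "fls_nth (fls_map ?\<phi> g) r = fls_nth (fls_map ?\<phi> g') r" by simp
  then have eq: "?\<phi> ?x = ?\<phi> ?y" by (simp add: fls_map_nth transition_coeff_def)
  have lookup: "?\<phi> z = Poly_Mapping.lookup z w" if "Poly_Mapping.keys z \<subseteq> ?A" for z
  proof -
    have "?\<phi> z = (\<Sum>v\<in>?A. if ?\<alpha> v {} = ?\<alpha> w {} then Poly_Mapping.lookup z v else 0)"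
      using that by (intro transition_coeff_superset) auto
    also have "\<dots> = (\<Sum>v\<in>?A. if v = w then Poly_Mapping.lookup z v else 0)"
      using inj by (intro sum.cong refl if_cong) (auto dest: inj_onD)
    finally show ?thesis by (simp add: sum.delta)
  qed
  have "Poly_Mapping.lookup ?x w = ?\<phi> ?x" by (rule lookup[symmetric]) blast
  also note eq
  also have "?\<phi> ?y = Poly_Mapping.lookup ?y w" by (rule lookup) blast
  finally show "Poly_Mapping.lookup ?x w = Poly_Mapping.lookup ?y w" .
qed

text \<open>The trivial action on one point has the augmentation of the group ring as its only
  matrix coefficient, and the augmentation maps the complete series to the ordinary one.\<close>

lemma ratfun_value_of_complete_value:
  assumes "value_at_inverse (complete_greedy_growth S) (scalar c * fps_to_fls (complete_greedy_growth S))"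
  shows "ratfun_value_at_inverse (greedy_growth S) (fls_const c * fps_to_fls (greedy_growth S))"
proof -
  define \<phi> where "\<phi> = transition_coeff (\<lambda>(_::'w) (x::unit). x) () ()"
  have coeff: "\<phi> (fps_nth (complete_greedy_growth S) n) = fps_nth (greedy_growth S) n" for n
    by (simp add: \<phi>_def complete_greedy_growth_eq greedy_growth_eq chain_sum_def transition_coeff_sum transition_coeff_single)
  have zero: "\<phi> 0 = 0" by (simp add: \<phi>_def transition_coeff_def)
  have "\<phi> (Poly_Mapping.single 0 c * x) = c * \<phi> x" for x
    unfolding \<phi>_def
    by (subst transition_coeff_mult[where X = UNIV]) (auto simp: transition_coeff_single UNIV_unit)
  then have "fls_map \<phi> (scalar c * fps_to_fls (complete_greedy_growth S)) = fls_const c * fps_to_fls (greedy_growth S)"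
    by (intro fls_eqI) (simp add: zero scalar_mult_nth coeff)
  moreover have "Abs_fps (\<lambda>n. \<phi> (fps_nth (complete_greedy_growth S) n)) = greedy_growth S"
    by (rule fps_ext) (simp add: coeff)
  moreover have "ratfun_value_at_inverse (Abs_fps (\<lambda>n. \<phi> (fps_nth (complete_greedy_growth S) n)))
      (fls_map \<phi> (scalar c * fps_to_fls (complete_greedy_growth S)))"
    unfolding \<phi>_def by (rule value_at_inverse_transition_coeff[where X = UNIV]) (use assms in auto)
  ultimately show ?thesis by simp
qed

end

section \<open>The transfer matrix of an Eulerian nerve and its group inverse\<close>

locale eulerian_coxeter = right_angled_coxeter +
  fixes k :: int
  assumes eulerian_nerve: "eulerian_sphere k (nerve S)"
begin

sublocale nerve: eulerian_flag_complex "nerve S" k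
  by unfold_locales (rule eulerian_nerve)

abbreviation group_elt :: "'a \<Rightarrow> 'a \<Rightarrow>\<^sub>0 rat" where
  "group_elt w \<equiv> Poly_Mapping.single w 1"

text \<open>The matrix \<open>P\<close> with the column of the empty clique erased. The row of the
  empty clique becomes zero as well, since the empty clique blocks nothing nonempty.\<close>

definition link_coeff :: "'a set \<Rightarrow> 'a set \<Rightarrow> rat" where
  "link_coeff \<sigma> \<tau> = of_bool (\<tau> \<noteq> {} \<and> blocks \<sigma> \<tau>)"

lemma link_coeff_empty [simp]: "link_coeff {} \<tau> = 0" "link_coeff \<sigma> {} = 0"
  by (auto simp: link_coeff_def blocks_def)

lemma linked_eq_blocks: "\<sigma> \<in> nerve S \<Longrightarrow> \<tau> \<in> nerve S \<Longrightarrow> nerve.linked \<sigma> \<tau> \<longleftrightarrow> blocks \<sigma> \<tau>"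
  using linked_nerve by (simp add: nerve_eq_cliques)

text \<open>Erasing the column does no harm: for nonempty \<tau> the term at the empty \<rho> was
  zero already, because \<open>linked {} \<tau>\<close> fails. So the involution survives on the
  nonempty cliques.\<close>

lemma link_coeff_sign_involution:
  assumes "\<sigma> \<in> nerve S" "\<tau> \<in> nerve S"
  shows "(\<Sum>\<rho>\<in>nerve S. link_coeff \<sigma> \<rho> * (- 1) ^ card \<rho> * link_coeff \<rho> \<tau> * (- 1) ^ card \<tau>) =
    of_bool (\<sigma> = \<tau> \<and> \<tau> \<noteq> {})"
proof (cases "\<tau> = {}")
  case False
  have eq: "link_coeff \<sigma> \<rho> * (- 1) ^ card \<rho> * link_coeff \<rho> \<tau> * (- 1) ^ card \<tau> =
    of_bool (nerve.linked \<sigma> \<rho>) * (- 1) ^ card \<rho> * of_bool (nerve.linked \<rho> \<tau>) * (- 1) ^ card \<tau>"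
    if "\<rho> \<in> nerve S" for \<rho>
    using assms that False by (cases "\<rho> = {}") (auto simp: linked_eq_blocks link_coeff_def blocks_def)
  have "(\<Sum>\<rho>\<in>nerve S. link_coeff \<sigma> \<rho> * (- 1) ^ card \<rho> * link_coeff \<rho> \<tau> * (- 1) ^ card \<tau>) =
    (\<Sum>\<rho>\<in>nerve S. of_bool (nerve.linked \<sigma> \<rho>) * (- 1) ^ card \<rho> * of_bool (nerve.linked \<rho> \<tau>) * (- 1) ^ card \<tau>)"
    by (intro sum.cong refl eq)
  then show ?thesis unfolding nerve.linked_sign_involution[OF assms] using False by simp
qed simp

lemma sum_link_coeff_left:
  assumes "\<tau> \<in> nerve S"
  shows "(\<Sum>\<sigma>\<in>nerve S. (- 1) ^ card \<sigma> * link_coeff \<sigma> \<tau>) = nerve.\<epsilon> * of_bool (\<tau> \<noteq> {})"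
proof (cases "\<tau> = {}")
  case False
  then have "(\<Sum>\<sigma>\<in>nerve S. (- 1) ^ card \<sigma> * link_coeff \<sigma> \<tau>) = (\<Sum>\<sigma>\<in>nerve S. (- 1) ^ card \<sigma> * of_bool (nerve.linked \<sigma> \<tau>))"
    using assms by (intro sum.cong) (auto simp: linked_eq_blocks link_coeff_def)
  then show ?thesis using nerve.alternating_sum_linked_left[OF assms] False by simp
qed simp

text \<open>The column of the empty clique in the involution identity: everything is linked to the
  empty clique, so that column gives the row sums of \<open>P E\<close>. Removing the term at the
  empty \<rho>, which is 1, leaves the claim.\<close>

lemma sum_link_coeff_right:
  assumes "\<sigma> \<in> nerve S"
  shows "(\<Sum>\<tau>\<in>nerve S. link_coeff \<sigma> \<tau> * (- 1) ^ card \<tau>) = - of_bool (\<sigma> \<noteq> {})"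
proof -
  have bl: "blocks \<rho> {}" for \<rho> by (simp add: blocks_def)
  have "(\<Sum>\<rho>\<in>nerve S. of_bool (nerve.linked \<sigma> \<rho>) * (- 1) ^ card \<rho> * of_bool (nerve.linked \<rho> {}) * (- 1) ^ card ({} :: 'a set) :: rat) =
    (\<Sum>\<rho>\<in>nerve S. link_coeff \<sigma> \<rho> * (- 1) ^ card \<rho> + of_bool (\<rho> = {}))"
    using assms nerve.empty_simplex by (intro sum.cong) (auto simp: linked_eq_blocks link_coeff_def bl)
  also have "\<dots> = (\<Sum>\<rho>\<in>nerve S. link_coeff \<sigma> \<rho> * (- 1) ^ card \<rho>) + 1"
    using nerve.finite_K nerve.empty_simplex by (simp add: sum.distrib of_bool_def sum.delta)
  finally show ?thesis
    using nerve.linked_sign_involution[OF assms nerve.empty_simplex]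
    by (cases "\<sigma> = {}") (simp_all add: eq_neg_iff_add_eq_0)
qed

lemma sum_signs: "(\<Sum>\<sigma>\<in>nerve S. (- 1) ^ card \<sigma>) = nerve.\<epsilon>"
  using nerve.alternating_sum_above[OF nerve.empty_simplex] by simp

definition enum :: "nat \<Rightarrow> 'a set" where
  "enum = (SOME e. bij_betw e {0..<card (nerve S)} (nerve S))"

lemma enum: "bij_betw enum {0..<card (nerve S)} (nerve S)"
  unfolding enum_def using someI_ex[OF ex_bij_betw_nat_finite[OF nerve.finite_K]] .

lemma enum_in: "i < card (nerve S) \<Longrightarrow> enum i \<in> nerve S"
  using enum by (auto simp: bij_betw_def)

lemma enum_eq_iff: "i < card (nerve S) \<Longrightarrow> j < card (nerve S) \<Longrightarrow> enum i = enum j \<longleftrightarrow> i = j"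
  using enum by (auto simp: bij_betw_def inj_on_def)

lemma sum_enum: "(\<Sum>i=0..<card (nerve S). f (enum i)) = (\<Sum>\<sigma>\<in>nerve S. f \<sigma>)"
  by (rule sum.reindex_bij_betw[OF enum])

definition nerve_mat :: "('a set \<Rightarrow> 'a set \<Rightarrow> 'r) \<Rightarrow> 'r mat" where
  "nerve_mat f = mat (card (nerve S)) (card (nerve S)) (\<lambda>(i, j). f (enum i) (enum j))"

lemma nerve_mat_carrier [simp]: "nerve_mat f \<in> carrier_mat (card (nerve S)) (card (nerve S))"
  by (simp add: nerve_mat_def)

lemma nerve_mat_mult:
  "nerve_mat f * nerve_mat g = nerve_mat (\<lambda>\<sigma> \<tau>. \<Sum>\<rho>\<in>nerve S. f \<sigma> \<rho> * g \<rho> \<tau> :: 'r::semiring_1)"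
  by (rule eq_matI) (simp_all add: nerve_mat_def scalar_prod_def flip: sum_enum)

lemma nerve_mat_cong:
  "(\<And>\<sigma> \<tau>. \<sigma> \<in> nerve S \<Longrightarrow> \<tau> \<in> nerve S \<Longrightarrow> f \<sigma> \<tau> = g \<sigma> \<tau>) \<Longrightarrow> nerve_mat f = nerve_mat g"
  by (rule eq_matI) (auto simp: nerve_mat_def enum_in)

definition transfer_mat :: "('a \<Rightarrow>\<^sub>0 rat) mat" where
  "transfer_mat = nerve_mat (\<lambda>\<sigma> \<tau>. Poly_Mapping.single (clique_elt \<tau>) (link_coeff \<sigma> \<tau>))"

text \<open>In matrix form \<open>D E P E\<close>, which is the inverse of \<open>P D\<close> on
  nonempty cliques because \<open>E P E\<close> inverts \<open>P\<close> and \<open>D\<close> is its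
  own inverse.\<close>

definition transfer_inv :: "('a \<Rightarrow>\<^sub>0 rat) mat" where
  "transfer_inv = nerve_mat (\<lambda>\<sigma> \<tau>. Poly_Mapping.single (clique_elt \<sigma>)
     ((- 1) ^ card \<sigma> * link_coeff \<sigma> \<tau> * (- 1) ^ card \<tau>))"

lemma clique_elt_involution: "\<sigma> \<in> nerve S \<Longrightarrow> clique_elt \<sigma> + clique_elt \<sigma> = 0"
  by (simp add: nerve_eq_cliques clique_elt_square)

lemma single_sum: "Poly_Mapping.single w (\<Sum>i\<in>I. f i) = (\<Sum>i\<in>I. Poly_Mapping.single w (f i))"
  by (induction I rule: infinite_finite_induct) (simp_all add: single_add)

lemma sign_square: "(- 1) ^ n * ((- 1) ^ n * x) = (x :: rat)"
  by (simp flip: mult.assoc power_add)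

lemma transfer_mat_mult_inv: "transfer_mat * transfer_inv = nerve_mat (\<lambda>\<sigma> \<tau>. of_bool (\<sigma> = \<tau> \<and> \<tau> \<noteq> {}))"
  unfolding transfer_mat_def transfer_inv_def nerve_mat_mult
proof (rule nerve_mat_cong)
  fix \<sigma> \<tau> assume st: "\<sigma> \<in> nerve S" "\<tau> \<in> nerve S"
  have "(\<Sum>\<rho>\<in>nerve S. Poly_Mapping.single (clique_elt \<rho>) (link_coeff \<sigma> \<rho>) *
      Poly_Mapping.single (clique_elt \<rho>) ((- 1) ^ card \<rho> * link_coeff \<rho> \<tau> * (- 1) ^ card \<tau>)) =
    Poly_Mapping.single 0 (\<Sum>\<rho>\<in>nerve S. link_coeff \<sigma> \<rho> * (- 1) ^ card \<rho> * link_coeff \<rho> \<tau> * (- 1) ^ card \<tau>)"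
    unfolding single_sum by (intro sum.cong refl) (simp add: mult_single clique_elt_involution mult.assoc)
  then show "(\<Sum>\<rho>\<in>nerve S. Poly_Mapping.single (clique_elt \<rho>) (link_coeff \<sigma> \<rho>) *
      Poly_Mapping.single (clique_elt \<rho>) ((- 1) ^ card \<rho> * link_coeff \<rho> \<tau> * (- 1) ^ card \<tau>)) =
    of_bool (\<sigma> = \<tau> \<and> \<tau> \<noteq> {})"
    using link_coeff_sign_involution[OF st] by simp
qed

lemma transfer_inv_mult_mat: "transfer_inv * transfer_mat = nerve_mat (\<lambda>\<sigma> \<tau>. of_bool (\<sigma> = \<tau> \<and> \<tau> \<noteq> {}))"
  unfolding transfer_mat_def transfer_inv_def nerve_mat_mult
proof (rule nerve_mat_cong)
  fix \<sigma> \<tau> assume st: "\<sigma> \<in> nerve S" "\<tau> \<in> nerve S"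
  \<comment> \<open>\<open>link_coeff_sign_involution\<close> carries the sign of \<tau>, which this
    product lacks; it is inserted twice.\<close>
  have signs: "s * t * (a * r * b * t) = s * a * r * b" if "t = (- 1) ^ card \<tau>" for s t a r b :: rat
  proof -
    have "s * t * (a * r * b * t) = t * (t * (s * a * r * b))" by (simp only: mult_ac)
    then show ?thesis using that by (simp only: sign_square)
  qed
  have "(\<Sum>\<rho>\<in>nerve S. Poly_Mapping.single (clique_elt \<sigma>) ((- 1) ^ card \<sigma> * link_coeff \<sigma> \<rho> * (- 1) ^ card \<rho>) *
      Poly_Mapping.single (clique_elt \<tau>) (link_coeff \<rho> \<tau>)) =
    Poly_Mapping.single (clique_elt \<sigma> + clique_elt \<tau>) ((- 1) ^ card \<sigma> * (- 1) ^ card \<tau> *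
      (\<Sum>\<rho>\<in>nerve S. link_coeff \<sigma> \<rho> * (- 1) ^ card \<rho> * link_coeff \<rho> \<tau> * (- 1) ^ card \<tau>))"
    unfolding sum_distrib_left single_sum
    by (intro sum.cong refl) (simp add: mult_single signs)
  also have "\<dots> = of_bool (\<sigma> = \<tau> \<and> \<tau> \<noteq> {})"
    unfolding link_coeff_sign_involution[OF st] using clique_elt_involution[OF st(1)]
    by (auto simp flip: power_add)
  finally show "(\<Sum>\<rho>\<in>nerve S. Poly_Mapping.single (clique_elt \<sigma>) ((- 1) ^ card \<sigma> * link_coeff \<sigma> \<rho> * (- 1) ^ card \<rho>) *
      Poly_Mapping.single (clique_elt \<tau>) (link_coeff \<rho> \<tau>)) = of_bool (\<sigma> = \<tau> \<and> \<tau> \<noteq> {})" .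
qed

text \<open>Both products are the projection to the nonempty cliques, and both matrices vanish in
  the row and column of the empty one.\<close>

lemma transfer_group_inverse:
  "transfer_inv * transfer_mat = transfer_mat * transfer_inv"
  "transfer_mat * transfer_inv * transfer_mat = transfer_mat"
  "transfer_inv * (transfer_mat * transfer_inv) = transfer_inv"
proof -
  show "transfer_inv * transfer_mat = transfer_mat * transfer_inv"
    by (simp only: transfer_mat_mult_inv transfer_inv_mult_mat)
  show "transfer_mat * transfer_inv * transfer_mat = transfer_mat"
    unfolding transfer_mat_mult_inv unfolding transfer_mat_def nerve_mat_mult
  proof (rule nerve_mat_cong)
    fix \<sigma> \<tau> assume "\<sigma> \<in> nerve S" "\<tau> \<in> nerve S"
    have "(\<Sum>\<rho>\<in>nerve S. of_bool (\<sigma> = \<rho> \<and> \<rho> \<noteq> {}) * Poly_Mapping.single (clique_elt \<tau>) (link_coeff \<rho> \<tau>)) =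
      (\<Sum>\<rho>\<in>nerve S. if \<rho> = \<sigma> then Poly_Mapping.single (clique_elt \<tau>) (link_coeff \<rho> \<tau>) else 0)"
      by (intro sum.cong) auto
    then show "(\<Sum>\<rho>\<in>nerve S. of_bool (\<sigma> = \<rho> \<and> \<rho> \<noteq> {}) * Poly_Mapping.single (clique_elt \<tau>) (link_coeff \<rho> \<tau>)) =
      Poly_Mapping.single (clique_elt \<tau>) (link_coeff \<sigma> \<tau>)"
      using \<open>\<sigma> \<in> nerve S\<close> nerve.finite_K by simp
  qed
  show "transfer_inv * (transfer_mat * transfer_inv) = transfer_inv"
    unfolding transfer_mat_mult_inv unfolding transfer_inv_def nerve_mat_mult
  proof (rule nerve_mat_cong)
    fix \<sigma> \<tau> assume "\<sigma> \<in> nerve S" "\<tau> \<in> nerve S"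
    let ?g = "\<lambda>\<rho>. Poly_Mapping.single (clique_elt \<sigma>) ((- 1) ^ card \<sigma> * link_coeff \<sigma> \<rho> * (- 1) ^ card \<rho>)"
    have "(\<Sum>\<rho>\<in>nerve S. ?g \<rho> * of_bool (\<rho> = \<tau> \<and> \<tau> \<noteq> {})) = (\<Sum>\<rho>\<in>nerve S. if \<rho> = \<tau> then ?g \<rho> else 0)"
      by (intro sum.cong) auto
    then show "(\<Sum>\<rho>\<in>nerve S. ?g \<rho> * of_bool (\<rho> = \<tau> \<and> \<tau> \<noteq> {})) = ?g \<tau>"
      using \<open>\<tau> \<in> nerve S\<close> nerve.finite_K by simp
  qed
qed

section \<open>Row sums of powers and the coefficients of the two resolvents\<close>

definition row_sum :: "('a \<Rightarrow>\<^sub>0 rat) mat \<Rightarrow> nat \<Rightarrow> 'a \<Rightarrow>\<^sub>0 rat" where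
  "row_sum M i = (\<Sum>j=0..<card (nerve S). M $$ (i, j))"

lemma row_sum_mult:
  assumes "M \<in> carrier_mat (card (nerve S)) (card (nerve S))" "i < card (nerve S)"
  shows "row_sum (nerve_mat f * M) i = (\<Sum>l=0..<card (nerve S). f (enum i) (enum l) * row_sum M l)"
proof -
  let ?n = "card (nerve S)"
  have "row_sum (nerve_mat f * M) i = (\<Sum>j=0..<?n. \<Sum>l=0..<?n. f (enum i) (enum l) * M $$ (l, j))"
    unfolding row_sum_def
  proof (intro sum.cong refl)
    fix j assume "j \<in> {0..<?n}"
    then have j: "j < ?n" by simp
    show "(nerve_mat f * M) $$ (i, j) = (\<Sum>l=0..<?n. f (enum i) (enum l) * M $$ (l, j))"
      unfolding mat_mult_nth[OF nerve_mat_carrier assms j] using assms(2) by (simp add: nerve_mat_def)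
  qed
  then show ?thesis by (subst (asm) sum.swap) (simp add: row_sum_def sum_distrib_left)
qed

lemma row_sum_one: "i < card (nerve S) \<Longrightarrow> row_sum (1\<^sub>m (card (nerve S))) i = 1"
  by (simp add: row_sum_def)

abbreviation tail_sum :: "'a set \<Rightarrow> nat \<Rightarrow> 'a \<Rightarrow>\<^sub>0 rat" where
  "tail_sum \<sigma> n \<equiv> chain_sum group_elt (Collect (blocks \<sigma>)) n"

lemma tail_sum_Suc:
  "tail_sum \<sigma> (Suc n) = (\<Sum>\<tau>\<in>nerve S. Poly_Mapping.single (clique_elt \<tau>) (link_coeff \<sigma> \<tau>) * tail_sum \<tau> n)"
proof -
  have "tail_sum \<sigma> (Suc n) = (\<Sum>\<tau>\<in>simplices \<inter> Collect (blocks \<sigma>). group_elt (clique_elt \<tau>) * tail_sum \<tau> n)"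
    by (rule chain_sum_Suc) (simp add: mult_single)
  also have "\<dots> = (\<Sum>\<tau>\<in>nerve S. Poly_Mapping.single (clique_elt \<tau>) (link_coeff \<sigma> \<tau>) * tail_sum \<tau> n)"
    using nerve.finite_K
    by (intro sum.mono_neutral_cong_left) (auto simp: simplices_def nerve_eq_cliques link_coeff_def)
  finally show ?thesis .
qed

lemma row_sum_transfer_pow:
  "i < card (nerve S) \<Longrightarrow> row_sum (transfer_mat ^\<^sub>m n) i = tail_sum (enum i) n"
proof (induction n arbitrary: i)
  case 0
  then show ?case by (simp add: chain_sum_0 row_sum_one transfer_mat_def nerve_mat_def)
next
  case (Suc n)
  have T: "transfer_mat \<in> carrier_mat (card (nerve S)) (card (nerve S))" by (simp add: transfer_mat_def)
  have "row_sum (transfer_mat ^\<^sub>m Suc n) i = row_sum (transfer_mat * transfer_mat ^\<^sub>m n) i"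
    by (simp only: pow_mat_Suc_left[OF T])
  also have "\<dots> = (\<Sum>l=0..<card (nerve S). Poly_Mapping.single (clique_elt (enum l)) (link_coeff (enum i) (enum l)) * row_sum (transfer_mat ^\<^sub>m n) l)"
    using Suc.prems T by (subst (1) transfer_mat_def, subst row_sum_mult) auto
  also have "\<dots> = (\<Sum>l=0..<card (nerve S). Poly_Mapping.single (clique_elt (enum l)) (link_coeff (enum i) (enum l)) * tail_sum (enum l) n)"
    using Suc.IH by (intro sum.cong) auto
  finally show ?case using sum_enum tail_sum_Suc by simp
qed

text \<open>Writing \<open>G\<close> for \<open>transfer_inv\<close>, \<open>T\<close> for
  \<open>transfer_mat\<close> and \<open>1\<close> for the column of ones, on nonempty cliques
  \<open>G^(n+1) 1 = - D E T^n 1\<close>. The case \<open>n = 0\<close> is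
  \<open>sum_link_coeff_right\<close>, and the step is \<open>G D E = D E T\<close>, where
  \<open>E\<close> and \<open>D\<close> cancel against their copies. Thus powers of the inverse
  count chains again.\<close>

lemma row_sum_transfer_inv_pow:
  "i < card (nerve S) \<Longrightarrow> row_sum (transfer_inv ^\<^sub>m Suc n) i =
    - (Poly_Mapping.single (clique_elt (enum i)) ((- 1) ^ card (enum i) * of_bool (enum i \<noteq> {})) * tail_sum (enum i) n)"
proof (induction n arbitrary: i)
  case 0
  let ?\<sigma> = "enum i"
  have "row_sum (transfer_inv ^\<^sub>m Suc 0) i = (\<Sum>\<tau>\<in>nerve S. Poly_Mapping.single (clique_elt ?\<sigma>) ((- 1) ^ card ?\<sigma> * (link_coeff ?\<sigma> \<tau> * (- 1) ^ card \<tau>)))"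
    using 0 by (simp add: row_sum_def transfer_inv_def nerve_mat_def mult.assoc flip: sum_enum)
  also have "\<dots> = Poly_Mapping.single (clique_elt ?\<sigma>) ((- 1) ^ card ?\<sigma> * - of_bool (?\<sigma> \<noteq> {}))"
    using sum_link_coeff_right[OF enum_in[OF 0]] by (simp flip: single_sum sum_distrib_left)
  finally show ?case by (simp add: chain_sum_0 single_uminus)
next
  case (Suc n)
  let ?\<sigma> = "enum i"
  have T: "transfer_inv \<in> carrier_mat (card (nerve S)) (card (nerve S))" by (simp add: transfer_inv_def)
  let ?g = "\<lambda>\<tau>. Poly_Mapping.single (clique_elt ?\<sigma>) ((- 1) ^ card ?\<sigma> * link_coeff ?\<sigma> \<tau> * (- 1) ^ card \<tau>)"
  have "row_sum (transfer_inv ^\<^sub>m Suc (Suc n)) i = row_sum (transfer_inv * transfer_inv ^\<^sub>m Suc n) i"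
    by (simp only: pow_mat_Suc_left[OF T])
  also have "\<dots> = (\<Sum>l=0..<card (nerve S). ?g (enum l) * row_sum (transfer_inv ^\<^sub>m Suc n) l)"
    using Suc.prems T by (subst (1) transfer_inv_def, subst row_sum_mult) (auto simp del: pow_mat.simps)
  also have "\<dots> = (\<Sum>l=0..<card (nerve S). ?g (enum l) *
      - (Poly_Mapping.single (clique_elt (enum l)) ((- 1) ^ card (enum l) * of_bool (enum l \<noteq> {})) * tail_sum (enum l) n))"
    using Suc.IH by (intro sum.cong) auto
  also have "\<dots> = (\<Sum>\<tau>\<in>nerve S. ?g \<tau> *
      - (Poly_Mapping.single (clique_elt \<tau>) ((- 1) ^ card \<tau> * of_bool (\<tau> \<noteq> {})) * tail_sum \<tau> n))"
    by (rule sum_enum)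
  also have "\<dots> = (\<Sum>\<tau>\<in>nerve S. - (Poly_Mapping.single (clique_elt ?\<sigma>) ((- 1) ^ card ?\<sigma> * of_bool (?\<sigma> \<noteq> {})) *
      (Poly_Mapping.single (clique_elt \<tau>) (link_coeff ?\<sigma> \<tau>) * tail_sum \<tau> n)))"
  proof (intro sum.cong refl)
    fix \<tau>
    have "link_coeff ?\<sigma> \<tau> * of_bool (\<tau> \<noteq> {}) = of_bool (?\<sigma> \<noteq> {}) * link_coeff ?\<sigma> \<tau>"
      by (auto simp: link_coeff_def blocks_def)
    then have "(- 1) ^ card ?\<sigma> * link_coeff ?\<sigma> \<tau> * (- 1) ^ card \<tau> * ((- 1) ^ card \<tau> * of_bool (\<tau> \<noteq> {})) =
      (- 1) ^ card ?\<sigma> * of_bool (?\<sigma> \<noteq> {}) * link_coeff ?\<sigma> \<tau>"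
      by (simp only: mult.assoc sign_square)
    then show "?g \<tau> * - (Poly_Mapping.single (clique_elt \<tau>) ((- 1) ^ card \<tau> * of_bool (\<tau> \<noteq> {})) * tail_sum \<tau> n) =
      - (Poly_Mapping.single (clique_elt ?\<sigma>) ((- 1) ^ card ?\<sigma> * of_bool (?\<sigma> \<noteq> {})) *
        (Poly_Mapping.single (clique_elt \<tau>) (link_coeff ?\<sigma> \<tau>) * tail_sum \<tau> n))"
      by (simp only: mult_single mult_minus_right mult.assoc[symmetric])
  qed
  finally show ?case by (simp add: tail_sum_Suc sum_negf sum_distrib_left)
qed

text \<open>
  By \<open>sum_link_coeff_left\<close> this row of signs acts as an initial state from which every nonempty clique
  can be reached, so that no additional state is needed.
\<close>

abbreviation left_vec :: "rat mat" where
  "left_vec \<equiv> mat 1 (card (nerve S)) (\<lambda>(_, i). nerve.\<epsilon> * (- 1) ^ card (enum i))"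

abbreviation right_vec :: "rat mat" where
  "right_vec \<equiv> mat (card (nerve S)) 1 (\<lambda>_. 1)"

lemma sandwich:
  assumes "N \<in> carrier_mat (card (nerve S)) (card (nerve S))"
    and "\<And>r. (\<Sum>i=0..<card (nerve S). Poly_Mapping.single 0 (nerve.\<epsilon> * (- 1) ^ card (enum i)) *
      (\<Sum>j=0..<card (nerve S). fls_nth (N $$ (i, j)) r)) = fls_nth g r"
  shows "map_mat scalar left_vec * N * map_mat scalar right_vec = mat 1 1 (\<lambda>_. g)"
proof (rule eq_matI)
  let ?n = "card (nerve S)"
  fix i j assume ij: "i < dim_row (mat 1 1 (\<lambda>_. g))" "j < dim_col (mat 1 1 (\<lambda>_. g))"
  have "(map_mat scalar left_vec * N * map_mat scalar right_vec) $$ (0, 0) =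
    (\<Sum>j=0..<?n. \<Sum>i=0..<?n. scalar (nerve.\<epsilon> * (- 1) ^ card (enum i)) * N $$ (i, j))"
    using assms(1) by (simp add: scalar_prod_def mult_scalar_one)
  also have "\<dots> = g"
  proof (rule fls_eqI)
    fix r
    show "fls_nth (\<Sum>j=0..<?n. \<Sum>i=0..<?n. scalar (nerve.\<epsilon> * (- 1) ^ card (enum i)) * N $$ (i, j)) r = fls_nth g r"
      unfolding assms(2)[symmetric] by (subst sum.swap) (simp add: fls_nth_sum scalar_mult_nth sum_distrib_left)
  qed
  finally show "(map_mat scalar left_vec * N * map_mat scalar right_vec) $$ (i, j) = mat 1 1 (\<lambda>_. g) $$ (i, j)"
    using ij by simp
qed (use assms(1) in auto)

lemma growth_coeff_Suc:
  "fps_nth (complete_greedy_growth S) (Suc n) = (\<Sum>\<tau>\<in>nerve S. Poly_Mapping.single (clique_elt \<tau>) (of_bool (\<tau> \<noteq> {})) * tail_sum \<tau> n)"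
proof -
  have "chain_sum group_elt UNIV (Suc n) = (\<Sum>\<tau>\<in>simplices \<inter> UNIV. group_elt (clique_elt \<tau>) * tail_sum \<tau> n)"
    by (rule chain_sum_Suc) (simp add: mult_single)
  also have "\<dots> = (\<Sum>\<tau>\<in>nerve S. Poly_Mapping.single (clique_elt \<tau>) (of_bool (\<tau> \<noteq> {})) * tail_sum \<tau> n)"
    using nerve.finite_K
    by (intro sum.mono_neutral_cong_left) (auto simp: simplices_def nerve_eq_cliques)
  finally show ?thesis by (simp add: complete_greedy_growth_eq)
qed

lemma growth_coeff_0: "fps_nth (complete_greedy_growth S) 0 = 1"
  by (simp add: complete_greedy_growth_eq chain_sum_0)

text \<open>The constant term is \<open>\<epsilon>\<close> times the sum of all signs, which is
  \<open>\<epsilon>\<close> itself. In higher degree the row of signs absorbs one transfer step by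
  \<open>sum_link_coeff_left\<close> and becomes a free choice of the first clique.\<close>

lemma resolvent_coeff_at_X:
  "(\<Sum>i=0..<card (nerve S). Poly_Mapping.single 0 (nerve.\<epsilon> * (- 1) ^ card (enum i)) * row_sum (transfer_mat ^\<^sub>m n) i) =
    fps_nth (complete_greedy_growth S) n"
proof -
  have "(\<Sum>i=0..<card (nerve S). Poly_Mapping.single 0 (nerve.\<epsilon> * (- 1) ^ card (enum i)) * row_sum (transfer_mat ^\<^sub>m n) i) =
    (\<Sum>\<sigma>\<in>nerve S. Poly_Mapping.single 0 (nerve.\<epsilon> * (- 1) ^ card \<sigma>) * tail_sum \<sigma> n)"
    unfolding sum_enum[symmetric] by (intro sum.cong) (simp_all add: row_sum_transfer_pow)
  also have "\<dots> = fps_nth (complete_greedy_growth S) n"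
  proof (cases n)
    case 0
    have "(\<Sum>\<sigma>\<in>nerve S. Poly_Mapping.single (0::'a) (nerve.\<epsilon> * (- 1) ^ card \<sigma>)) = 1"
      by (simp add: sum_signs nerve.\<epsilon>_square flip: single_sum sum_distrib_left)
    then show ?thesis using 0 by (simp add: growth_coeff_0 chain_sum_0)
  next
    case (Suc l)
    have "(\<Sum>\<sigma>\<in>nerve S. Poly_Mapping.single 0 (nerve.\<epsilon> * (- 1) ^ card \<sigma>) * tail_sum \<sigma> n) =
      (\<Sum>\<sigma>\<in>nerve S. \<Sum>\<tau>\<in>nerve S. Poly_Mapping.single (clique_elt \<tau>) (nerve.\<epsilon> * ((- 1) ^ card \<sigma> * link_coeff \<sigma> \<tau>)) * tail_sum \<tau> l)"
      unfolding Suc tail_sum_Suc sum_distrib_left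
      by (intro sum.cong refl) (simp add: mult_single mult.assoc flip: mult.assoc[of "Poly_Mapping.single _ _"])
    also have "\<dots> = (\<Sum>\<tau>\<in>nerve S. Poly_Mapping.single (clique_elt \<tau>) (nerve.\<epsilon> * (\<Sum>\<sigma>\<in>nerve S. (- 1) ^ card \<sigma> * link_coeff \<sigma> \<tau>)) * tail_sum \<tau> l)"
      by (subst sum.swap) (simp add: single_sum sum_distrib_left sum_distrib_right)
    also have "\<dots> = fps_nth (complete_greedy_growth S) n"
      unfolding Suc growth_coeff_Suc
      by (intro sum.cong refl) (simp add: sum_link_coeff_left nerve.\<epsilon>_square flip: mult.assoc[of "nerve.\<epsilon>"])
    finally show ?thesis .
  qed
  finally show ?thesis .
qed

text \<open>The projection in degree 0 sees the empty clique alone, which contributes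
  \<open>\<epsilon>\<close>. In higher degree the signs of the initial vector cancel those of
  \<open>row_sum_transfer_inv_pow\<close>, so that the first cliques again occur with coefficient 1
  and a single factor \<open>\<epsilon>\<close> remains.\<close>

lemma resolvent_coeff_at_X_inv:
  "(\<Sum>i=0..<card (nerve S). Poly_Mapping.single 0 (nerve.\<epsilon> * (- 1) ^ card (enum i)) *
      row_sum (if n = 0 then 1\<^sub>m (card (nerve S)) - transfer_mat * transfer_inv else - (transfer_inv ^\<^sub>m n)) i) =
    Poly_Mapping.single 0 nerve.\<epsilon> * fps_nth (complete_greedy_growth S) n"
proof (cases n)
  case 0
  let ?n = "card (nerve S)"
  have "row_sum (1\<^sub>m ?n - transfer_mat * transfer_inv) i = of_bool (enum i = {})" if i: "i < ?n" for i
  proof -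
    have "row_sum (1\<^sub>m ?n - transfer_mat * transfer_inv) i =
      (\<Sum>j=0..<?n. 1\<^sub>m ?n $$ (i, j) - of_bool (enum i = enum j \<and> enum j \<noteq> {}))"
      unfolding row_sum_def transfer_mat_mult_inv using i by (intro sum.cong) (auto simp: nerve_mat_def)
    also have "\<dots> = (\<Sum>j=0..<?n. if j = i then of_bool (enum i = {}) else 0)"
      using i by (intro sum.cong) (auto simp: enum_eq_iff)
    finally show ?thesis using i by simp
  qed
  then have "(\<Sum>i=0..<?n. Poly_Mapping.single 0 (nerve.\<epsilon> * (- 1) ^ card (enum i)) * row_sum (1\<^sub>m ?n - transfer_mat * transfer_inv) i) =
    (\<Sum>i=0..<?n. Poly_Mapping.single 0 (nerve.\<epsilon> * (- 1) ^ card (enum i)) * of_bool (enum i = {}))"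
    by (intro sum.cong) auto
  also have "\<dots> = (\<Sum>\<sigma>\<in>nerve S. if \<sigma> = {} then Poly_Mapping.single 0 nerve.\<epsilon> else 0)"
    unfolding sum_enum[symmetric] by (intro sum.cong) auto
  also have "\<dots> = Poly_Mapping.single 0 nerve.\<epsilon>" using nerve.finite_K nerve.empty_simplex by simp
  finally show ?thesis using 0 by (simp add: growth_coeff_0)
next
  case (Suc l)
  let ?n = "card (nerve S)"
  have "row_sum (- (transfer_inv ^\<^sub>m Suc l)) i =
    Poly_Mapping.single (clique_elt (enum i)) ((- 1) ^ card (enum i) * of_bool (enum i \<noteq> {})) * tail_sum (enum i) l"
    if i: "i < ?n" for i
  proof -
    have T: "transfer_inv ^\<^sub>m Suc l \<in> carrier_mat ?n ?n" by (intro pow_carrier_mat) (simp add: transfer_inv_def)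
    have "row_sum (- (transfer_inv ^\<^sub>m Suc l)) i = - row_sum (transfer_inv ^\<^sub>m Suc l) i"
      unfolding row_sum_def sum_negf[symmetric] using carrier_matD[OF T] i
      by (intro sum.cong refl index_uminus_mat(1)) simp_all
    then show ?thesis using row_sum_transfer_inv_pow[OF i, of l] by simp
  qed
  then have "(\<Sum>i=0..<?n. Poly_Mapping.single 0 (nerve.\<epsilon> * (- 1) ^ card (enum i)) * row_sum (- (transfer_inv ^\<^sub>m Suc l)) i) =
    (\<Sum>i=0..<?n. Poly_Mapping.single 0 (nerve.\<epsilon> * (- 1) ^ card (enum i)) *
      (Poly_Mapping.single (clique_elt (enum i)) ((- 1) ^ card (enum i) * of_bool (enum i \<noteq> {})) * tail_sum (enum i) l))"
    by (intro sum.cong) auto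
  also have "\<dots> = (\<Sum>\<sigma>\<in>nerve S. Poly_Mapping.single 0 (nerve.\<epsilon> * (- 1) ^ card \<sigma>) *
      (Poly_Mapping.single (clique_elt \<sigma>) ((- 1) ^ card \<sigma> * of_bool (\<sigma> \<noteq> {})) * tail_sum \<sigma> l))"
    by (rule sum_enum)
  also have "\<dots> = (\<Sum>\<sigma>\<in>nerve S. Poly_Mapping.single 0 nerve.\<epsilon> * (Poly_Mapping.single (clique_elt \<sigma>) (of_bool (\<sigma> \<noteq> {})) * tail_sum \<sigma> l))"
    by (intro sum.cong refl) (simp add: mult_single sign_square mult.assoc flip: mult.assoc[of "Poly_Mapping.single _ _"])
  finally show ?thesis using Suc by (simp add: growth_coeff_Suc sum_distrib_left del: pow_mat.simps)
qed

section \<open>The reciprocity formula for the complete series\<close>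

lemma eval_at_monom_1:
  "eval_at (monom a 1) fls_X = fls_const a * fls_X" "eval_at (monom a 1) fls_X_inv = fls_const (a :: 'r::ring_1) * fls_X_inv"
  using fls_nth_const_X_mult(1)[of "fls_X :: 'r fls" 1 a 1] fls_nth_const_X_mult(1)[of "fls_X_inv :: 'r fls" "- 1" a 1]
  by (auto intro!: fls_eqI simp: eval_at_X_nth eval_at_X_inv_nth)

lemma value_at_inverse_complete_growth:
  "value_at_inverse (complete_greedy_growth S) (scalar nerve.\<epsilon> * fps_to_fls (complete_greedy_growth S))"
proof -
  let ?n = "card (nerve S)"
  let ?Q = "map_mat (\<lambda>a. monom a 1) transfer_mat"
  have T: "transfer_mat \<in> carrier_mat ?n ?n" and G: "transfer_inv \<in> carrier_mat ?n ?n"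
    by (simp_all add: transfer_mat_def transfer_inv_def)
  have Q: "map_mat (\<lambda>q. eval_at q fls_X) ?Q = map_mat (\<lambda>a. fls_const a * fls_X) transfer_mat"
    "map_mat (\<lambda>q. eval_at q fls_X_inv) ?Q = map_mat (\<lambda>a. fls_const a * fls_X_inv) transfer_mat"
    by (auto intro!: eq_matI simp: eval_at_monom_1[unfolded One_nat_def])
  have dims: "dim_row transfer_mat = ?n" using T by simp
  have "resolvent_value left_vec (map_mat (\<lambda>q. eval_at q fls_X) ?Q) right_vec (fps_to_fls (complete_greedy_growth S))"
    unfolding resolvent_value_def Q inverts_mat_def
  proof (intro bexI conjI)
    let ?N = "coeff_series_mat ?n (\<lambda>k. transfer_mat ^\<^sub>m k)"
    show "map_mat scalar left_vec * ?N * map_mat scalar right_vec = mat 1 1 (\<lambda>_. fps_to_fls (complete_greedy_growth S))"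
    proof (rule sandwich)
      fix r
      show "(\<Sum>i=0..<?n. Poly_Mapping.single 0 (nerve.\<epsilon> * (- 1) ^ card (enum i)) * (\<Sum>j=0..<?n. fls_nth (?N $$ (i, j)) r)) =
        fls_nth (fps_to_fls (complete_greedy_growth S)) r"
        using resolvent_coeff_at_X[of "nat r"] by (cases "r < 0") (simp_all add: coeff_series_mat_nth row_sum_def)
    qed simp
  qed (use resolvent_at_X[OF T] in \<open>simp_all add: dims carrier_matD[OF coeff_series_mat_carrier]\<close>)
  moreover have "resolvent_value left_vec (map_mat (\<lambda>q. eval_at q fls_X_inv) ?Q) right_vec
      (scalar nerve.\<epsilon> * fps_to_fls (complete_greedy_growth S))"
    unfolding resolvent_value_def Q inverts_mat_def
  proof (intro bexI conjI)
    let ?c = "\<lambda>k. if k = 0 then 1\<^sub>m ?n - transfer_mat * transfer_inv else - (transfer_inv ^\<^sub>m k)"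
    let ?N = "coeff_series_mat ?n ?c"
    show "map_mat scalar left_vec * ?N * map_mat scalar right_vec = mat 1 1 (\<lambda>_. scalar nerve.\<epsilon> * fps_to_fls (complete_greedy_growth S))"
    proof (rule sandwich)
      fix r
      show "(\<Sum>i=0..<?n. Poly_Mapping.single 0 (nerve.\<epsilon> * (- 1) ^ card (enum i)) * (\<Sum>j=0..<?n. fls_nth (?N $$ (i, j)) r)) =
        fls_nth (scalar nerve.\<epsilon> * fps_to_fls (complete_greedy_growth S)) r"
        using resolvent_coeff_at_X_inv[of "nat r"]
        by (cases "r < 0") (simp_all add: coeff_series_mat_nth row_sum_def scalar_mult_nth)
    qed simp
  qed (use resolvent_at_X_inv[OF T G transfer_group_inverse] in \<open>simp_all add: dims carrier_matD[OF coeff_series_mat_carrier]\<close>)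
  moreover have "coeff q 0 = 0" if "q \<in> elements_mat ?Q" for q
    using that by (auto simp: elements_mat_def)
  moreover have "left_vec \<in> carrier_mat 1 ?n" "?Q \<in> carrier_mat ?n ?n" "right_vec \<in> carrier_mat ?n 1"
    using T by simp_all
  ultimately show ?thesis unfolding value_at_inverse_def by blast
qed

end

theorem corollary9p3:
  fixes S :: "'w::group_add set" and m :: "'w \<Rightarrow> 'w \<Rightarrow> enat"
  assumes "finite S" and "coxeter_system S m" and "right_angled S m"
  shows "rational_series (greedy_growth S) \<and>
    rational_series (complete_greedy_growth S) \<and>
    (\<forall>k. eulerian_sphere k (nerve S) \<longrightarrow>
       (\<exists>!g. ratfun_value_at_inverse (greedy_growth S) g) \<and>
       ratfun_at_inverse (greedy_growth S) =
         fls_const ((- 1) powi (k + 1)) * fps_to_fls (greedy_growth S) \<and>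
       (\<exists>!g. value_at_inverse (complete_greedy_growth S) g) \<and>
       at_inverse (complete_greedy_growth S) =
         scalar ((- 1) powi (k + 1)) * fps_to_fls (complete_greedy_growth S))"
proof (intro conjI allI impI)
  interpret right_angled_coxeter S m using assms by unfold_locales
  show "rational_series (greedy_growth S)" by (rule rational_greedy_growth)
  show "rational_series (complete_greedy_growth S)" by (rule rational_complete_greedy_growth)
  fix k assume "eulerian_sphere k (nerve S)"
  then interpret eulerian_coxeter S m k by unfold_locales
  have c: "value_at_inverse (complete_greedy_growth S) (scalar ((- 1) powi (k + 1)) * fps_to_fls (complete_greedy_growth S))"
    using value_at_inverse_complete_growth by (simp add: nerve.\<epsilon>_def)
  then have g: "ratfun_value_at_inverse (greedy_growth S) (fls_const ((- 1) powi (k + 1)) * fps_to_fls (greedy_growth S))"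
    by (rule ratfun_value_of_complete_value)
  show "\<exists>!g. ratfun_value_at_inverse (greedy_growth S) g"
    using g ratfun_value_at_inverse_unique by blast
  then show "ratfun_at_inverse (greedy_growth S) = fls_const ((- 1) powi (k + 1)) * fps_to_fls (greedy_growth S)"
    unfolding ratfun_at_inverse_def using g by (rule the1_equality)
  show "\<exists>!g. value_at_inverse (complete_greedy_growth S) g"
    using c value_at_inverse_unique by blast
  then show "at_inverse (complete_greedy_growth S) = scalar ((- 1) powi (k + 1)) * fps_to_fls (complete_greedy_growth S)"
    unfolding at_inverse_def using c by (rule the1_equality)
qed

end
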